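(* Let $K:\mathbb{R}^d\times\mathbb{R}^d\to\mathbb{R}$ be a kernel which is shift-invariant (normalized so $K(0)=1$) and analytic at the origin, with feature mapping $\varphi:\mathbb{R}^d\to\mathcal{H}$, and let $p\ge1$, $k\in\mathbb{N}$, $0<\epsilon,\delta<1$. For every finite data set $P\subset\mathbb{R}^d$, the RFF mapping $\pi:\mathbb{R}^d\to\mathbb{R}^D$ with target dimension $D=\Omega\big(p^2\log^3\frac{k}{\delta}+p^5\log^3\frac1\epsilon+p^8\big)/\epsilon^2$ satisfies \[\Pr\big[\forall\ k\text{-partitions }\mathcal{C}\text{ of }P:\ \mathrm{cost}_p^\pi(P,\mathcal{C})\in(1\pm\epsilon)\cdot\mathrm{cost}_p^\varphi(P,\mathcal{C})\big]\ge1-\delta.\]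
   Context: $K$ analytic at the origin means analytic on $\{x:\|x\|_1<r\}$ for some $r>0$. RFF mapping with target dimension $D$: $\pi(x)=\sqrt{1/D}\,(\sin\langle\omega_j,x\rangle,\cos\langle\omega_j,x\rangle)_{j=1}^D$ with $\omega_j$ i.i.d. from the density $p_K$ satisfying $K(x)=\int p_K(\omega)e^{\mathrm{i}\langle\omega,x\rangle}d\omega$. For a mapping $f$ into a Hilbert space $\mathcal{H}'$ and a partition $\mathcal{C}=\{C_1,\dots,C_k\}$ of $P$, the kernel $k$-clustering cost with $\ell_2^p$-objective is $\mathrm{cost}_p^f(P,\mathcal{C})=\sum_{i=1}^k\min_{c_i\in\mathcal{H}'}\sum_{x\in C_i}\|f(x)-c_i\|_2^p$ (for $p=2$ this is kernel $k$-means). The constant hidden in $\Omega(\cdot)$ depends on $K$. *)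

theory Defs
  imports "HOL-Analysis.Analysis" "HOL-Probability.Probability"
begin

definition real_analytic_on :: "(real^'d \<Rightarrow> real) \<Rightarrow> (real^'d) set \<Rightarrow> bool" where
  "real_analytic_on f S \<longleftrightarrow>
     (\<forall>y\<in>S. \<exists>e>0. \<exists>c::('d \<Rightarrow> nat) \<Rightarrow> real.
        \<forall>x. (\<Sum>i\<in>UNIV. \<bar>x$i - y$i\<bar>) < e \<longrightarrow>
          ((\<lambda>\<alpha>. c \<alpha> * (\<Prod>i\<in>UNIV. (x$i - y$i) ^ \<alpha> i)) has_sum f x) UNIV)"

definition analytic_at_origin :: "(real^'d \<Rightarrow> real) \<Rightarrow> bool" where
  "analytic_at_origin f \<longleftrightarrow> (\<exists>r>0. real_analytic_on f {x. (\<Sum>i\<in>UNIV. \<bar>x$i\<bar>) < r})"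

text \<open>Kernel k-clustering cost with l2^p objective for a mapping f into a space with
  distance dst; a k-partition is given by an assignment sigma of points to clusters 0..k-1
  (empty clusters contribute 0). The minimum over centers is written as an infimum.\<close>
definition clust_cost ::
  "('b \<Rightarrow> 'b \<Rightarrow> real) \<Rightarrow> real \<Rightarrow> ('a \<Rightarrow> 'b) \<Rightarrow> 'a set \<Rightarrow> nat \<Rightarrow> ('a \<Rightarrow> nat) \<Rightarrow> real" where
  "clust_cost dst p f P k \<sigma> =
     (\<Sum>i<k. INF c. \<Sum>x\<in>{x\<in>P. \<sigma> x = i}. dst (f x) c powr p)"

definition euclid_dist :: "nat \<Rightarrow> (nat \<Rightarrow> real) \<Rightarrow> (nat \<Rightarrow> real) \<Rightarrow> real" where
  "euclid_dist m u v = sqrt (\<Sum>j<m. (u j - v j)^2)"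

definition rff :: "nat \<Rightarrow> (nat \<Rightarrow> real^'d) \<Rightarrow> real^'d \<Rightarrow> (nat \<Rightarrow> real)" where
  "rff D W x = (\<lambda>j. if j < D then sin (W j \<bullet> x) / sqrt (real D)
                    else if j < 2*D then cos (W (j - D) \<bullet> x) / sqrt (real D) else 0)"

definition rff_space :: "(real^'d \<Rightarrow> real) \<Rightarrow> nat \<Rightarrow> (nat \<Rightarrow> real^'d) measure" where
  "rff_space pK D = PiM {..<D} (\<lambda>_. density lborel (\<lambda>\<omega>. ennreal (pK \<omega>)))"

end

theory Submission
  imports Defs
begin

text \<open>
  The distance of two points under the random map is, relative to the kernel distance, an average
  of i.i.d. variables of mean one. Analyticity of \<open>K\<close> at the origin gives the spectral density an
  exponential moment, and \<open>1 - K z\<close> is at least a constant times \<open>min 1 (norm z ^ 2)\<close>; so these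
  variables are dominated by one square of a variable with an exponential moment, uniformly in the
  pair of points, and a single pair fails with probability \<open>exp (- c * (D * \<eta>^2) powr (1/3))\<close>.

  From pairs to partitions: fix \<open>k\<close> data points as centres whose cost \<open>R\<close> is at most \<open>2 powr p\<close>
  times that of every partition. By Markov's inequality the points that are badly placed with
  respect to a centre, or that form bad pairs with a noticeable part of the cost measure, carry
  little of \<open>R\<close> and can be moved to their centres. Every remaining bad pair is short compared with
  its distance to the centres. The cost of a cluster is then compared in the two spaces through
  the identity between a weighted variance and the weighted sum of squared pair distances, with
  weights \<open>dist (u x) c powr (p - 2)\<close>; this takes the place of an extension theorem of Kirszbraun
  type and tolerates bad pairs.
\<close>

section \<open>Cluster costs in inner product spaces\<close>

text \<open>A union bound is affordable over the at most \<open>k\<close> centres. The weights come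
  from a linearisation: the \<open>p\<close>-th power of a distance is the power p / 2 of its
  square, and replacing that power by its tangent turns the cost into a weighted sum of squares,
  where the variance identity applies. The shape of the dimension has three sources. The cube of a
  logarithm inverts the cube root in the exponent of the pair failure. The accuracy per pair is
  proportional to \<epsilon> / p, whence the factor p^2 / \<epsilon>^2. The failure probability of a
  pair must beat a power of (k / \<delta>) (1 / \<epsilon>)^p exp (p^2), where exp (p^2) arises
  because a power of order \<open>p\<close> is applied to a quantity that itself contains
  \<open>2 powr p\<close>. Cubing ln (k / \<delta>) + p ln (1 / \<epsilon>) + p^2 and multiplying by
  p^2 gives the three summands.\<close>

definition pcost :: "real \<Rightarrow> 'i set \<Rightarrow> ('i \<Rightarrow> 'a::real_inner) \<Rightarrow> real" where
  "pcost p I u = (INF c. \<Sum>x\<in>I. dist (u x) c powr p)"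

lemma pcost_le: "pcost p I u \<le> (\<Sum>x\<in>I. dist (u x) c powr p)"
  unfolding pcost_def
  by (rule cINF_lower) (auto intro!: bdd_belowI2[where m=0] sum_nonneg)

lemma pcost_ge:
  assumes "\<And>c. B \<le> (\<Sum>x\<in>I. dist (u x) c powr p)"
  shows "B \<le> pcost p I u"
  unfolding pcost_def by (rule cINF_greatest) (use assms in auto)

text \<open>Expanding the squares around \<open>c\<close>, the cross terms assemble into the squared
  norm of the weighted sum. That correction vanishes when \<open>c\<close> is the weighted
  barycentre and may be dropped in an upper bound for the left side when \<open>c\<close> is
  arbitrary; both uses occur.\<close>

lemma weighted_dist_identity:
  fixes u :: "'i \<Rightarrow> 'a::real_inner"
  assumes "finite I"
  shows "(\<Sum>x\<in>I. \<Sum>y\<in>I. w x * w y * (dist (u x) (u y))\<^sup>2) =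
     2 * sum w I * (\<Sum>x\<in>I. w x * (dist (u x) c)\<^sup>2) - 2 * (norm (\<Sum>x\<in>I. w x *\<^sub>R (u x - c)))\<^sup>2"
proof -
  define z where "z x = u x - c" for x
  have d: "(dist (u x) (u y))\<^sup>2 = z x \<bullet> z x - 2 * (z x \<bullet> z y) + z y \<bullet> z y" for x y
    unfolding z_def dist_norm power2_norm_eq_inner
    by (simp add: inner_diff_left inner_diff_right inner_commute)
  have d2: "(dist (u x) c)\<^sup>2 = z x \<bullet> z x" for x
    unfolding z_def dist_norm power2_norm_eq_inner ..
  have 1: "(norm (\<Sum>x\<in>I. w x *\<^sub>R z x))\<^sup>2 = (\<Sum>x\<in>I. \<Sum>y\<in>I. w x * w y * (z x \<bullet> z y))"
    unfolding power2_norm_eq_inner inner_sum_left inner_sum_right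
    by (subst sum.swap) (simp add: sum_distrib_left mult_ac inner_commute)
  have 2: "(\<Sum>x\<in>I. \<Sum>y\<in>I. w x * w y * (z x \<bullet> z x)) = sum w I * (\<Sum>x\<in>I. w x * (z x \<bullet> z x))"
    by (subst mult.commute, subst sum_product) (simp add: mult_ac)
  have 3: "(\<Sum>x\<in>I. \<Sum>y\<in>I. w x * w y * (z y \<bullet> z y)) = sum w I * (\<Sum>x\<in>I. w x * (z x \<bullet> z x))"
    by (subst sum_product) (simp add: mult_ac)
  have "(\<Sum>x\<in>I. \<Sum>y\<in>I. w x * w y * (dist (u x) (u y))\<^sup>2) =
    (\<Sum>x\<in>I. \<Sum>y\<in>I. w x * w y * (z x \<bullet> z x)) - 2 * (\<Sum>x\<in>I. \<Sum>y\<in>I. w x * w y * (z x \<bullet> z y))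
     + (\<Sum>x\<in>I. \<Sum>y\<in>I. w x * w y * (z y \<bullet> z y))"
    unfolding d by (simp add: algebra_simps sum.distrib sum_subtractf sum_distrib_left)
  then show ?thesis
    unfolding 1[symmetric] 2 3 d2 z_def[symmetric] by simp
qed

text \<open>One-sided on purpose: in a lower bound for the cost in \<open>v\<close> only pairs that
  shrink do harm. The upper bound is obtained by exchanging the two maps.\<close>

definition contracted :: "real \<Rightarrow> ('i \<Rightarrow> 'a::metric_space) \<Rightarrow> ('i \<Rightarrow> 'b::metric_space) \<Rightarrow> 'i \<Rightarrow> 'i \<Rightarrow> bool" where
  "contracted \<eta> u v x y \<longleftrightarrow> dist (v x) (v y) < (1-\<eta>) * dist (u x) (u y)"

text \<open>Averaging over \<open>x\<close> with weights \<open>w x / W\<close> turns the bound per neighbourhood of contracted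
  pairs into a bound on all contracted pairs.\<close>
lemma weighted_sum_transfer:
  fixes u :: "'i \<Rightarrow> 'a::real_inner" and v :: "'i \<Rightarrow> 'b::real_inner"
  assumes I: "finite I" and w: "\<And>x. x \<in> I \<Longrightarrow> 0 \<le> w x" and W: "0 < sum w I" and \<eta>: "0 \<le> \<eta>" "\<eta> \<le> 1"
    and bad: "\<And>x. x \<in> I \<Longrightarrow>
      (\<Sum>y | y \<in> I \<and> contracted \<eta> u v x y. w y * (dist (u x) (u y))\<^sup>2) \<le> b"
    and c: "(\<Sum>x\<in>I. w x *\<^sub>R (u x - c)) = 0"
    and b: "0 \<le> b"
  shows "(1-\<eta>)\<^sup>2 * ((\<Sum>x\<in>I. w x * (dist (u x) c)\<^sup>2) - b) \<le> (\<Sum>x\<in>I. w x * (dist (v x) c')\<^sup>2)"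
proof -
  define W where "W = sum w I"
  let ?d = "\<lambda>x y. (dist (u x) (u y))\<^sup>2" and ?e = "\<lambda>x y. (dist (v x) (v y))\<^sup>2"
  let ?N = "\<lambda>x. {y. y \<in> I \<and> contracted \<eta> u v x y}"
  have row: "(1-\<eta>)\<^sup>2 * ((\<Sum>y\<in>I. w y * ?d x y) - b) \<le> (\<Sum>y\<in>I. w y * ?e x y)" if x: "x \<in> I" for x
  proof -
    have "(\<Sum>y\<in>I. w y * ?d x y) - b \<le> (\<Sum>y\<in>I. w y * ?d x y) - (\<Sum>y\<in>?N x. w y * ?d x y)"
      using bad[OF x] by simp
    also have "\<dots> = (\<Sum>y\<in>I - ?N x. w y * ?d x y)"
      using I by (subst sum_diff) auto
    finally have "(1-\<eta>)\<^sup>2 * ((\<Sum>y\<in>I. w y * ?d x y) - b) \<le> (1-\<eta>)\<^sup>2 * (\<Sum>y\<in>I - ?N x. w y * ?d x y)"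
      by (intro mult_left_mono) auto
    also have "\<dots> = (\<Sum>y\<in>I - ?N x. w y * ((1-\<eta>) * dist (u x) (u y))\<^sup>2)"
      by (simp add: sum_distrib_left power_mult_distrib mult_ac)
    also have "\<dots> \<le> (\<Sum>y\<in>I - ?N x. w y * ?e x y)"
      by (intro sum_mono mult_left_mono power_mono) (use w \<eta> in \<open>auto simp: contracted_def not_less\<close>)
    also have "\<dots> \<le> (\<Sum>y\<in>I. w y * ?e x y)"
      by (intro sum_mono2) (use I w in auto)
    finally show ?thesis .
  qed
  have "(1-\<eta>)\<^sup>2 * ((\<Sum>x\<in>I. \<Sum>y\<in>I. w x * w y * ?d x y) - W * b) =
     (\<Sum>x\<in>I. w x * ((1-\<eta>)\<^sup>2 * ((\<Sum>y\<in>I. w y * ?d x y) - b)))"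
    unfolding W_def
    by (simp add: sum_distrib_left sum_distrib_right right_diff_distrib sum_subtractf mult_ac)
  also have "\<dots> \<le> (\<Sum>x\<in>I. w x * (\<Sum>y\<in>I. w y * ?e x y))"
    by (intro sum_mono mult_left_mono row) (use w in auto)
  also have "\<dots> = (\<Sum>x\<in>I. \<Sum>y\<in>I. w x * w y * ?e x y)"
    by (simp add: sum_distrib_left mult_ac)
  \<comment> \<open>Here the centre is arbitrary, so the norm term of the identity is dropped; for
    \<open>u\<close> it is zero by the choice of \<open>c\<close>.\<close>
  also have "\<dots> \<le> 2 * W * (\<Sum>x\<in>I. w x * (dist (v x) c')\<^sup>2)"
    unfolding weighted_dist_identity[OF I, of w v c'] W_def by simp
  finally have "(1-\<eta>)\<^sup>2 * (2 * W * (\<Sum>x\<in>I. w x * (dist (u x) c)\<^sup>2) - W * b) \<le> 2 * W * (\<Sum>x\<in>I. w x * (dist (v x) c')\<^sup>2)"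
    unfolding weighted_dist_identity[OF I, of w u c] c W_def by simp
  then have "W * ((1-\<eta>)\<^sup>2 * (2 * (\<Sum>x\<in>I. w x * (dist (u x) c)\<^sup>2) - b)) \<le> W * (2 * (\<Sum>x\<in>I. w x * (dist (v x) c')\<^sup>2))"
    by (simp add: algebra_simps)
  then have "(1-\<eta>)\<^sup>2 * (2 * (\<Sum>x\<in>I. w x * (dist (u x) c)\<^sup>2) - b) \<le> 2 * (\<Sum>x\<in>I. w x * (dist (v x) c')\<^sup>2)"
    using W unfolding W_def by simp
  \<comment> \<open>Subtracting \<open>2 * b\<close> instead of \<open>b\<close> lets the common
    factor 2 cancel.\<close>
  moreover have "(1-\<eta>)\<^sup>2 * (2 * (\<Sum>x\<in>I. w x * (dist (u x) c)\<^sup>2) - 2 * b) \<le> (1-\<eta>)\<^sup>2 * (2 * (\<Sum>x\<in>I. w x * (dist (u x) c)\<^sup>2) - b)"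
    by (intro mult_left_mono) (use b in auto)
  ultimately show ?thesis by (simp add: algebra_simps)
qed

section \<open>Tangent and addition inequalities for real powers\<close>

lemma power2_powr:
  fixes x :: real
  assumes "0 \<le> x"
  shows "(x\<^sup>2) powr q = x powr (2 * q)"
proof -
  have "x\<^sup>2 = x powr 2" using assms by (simp add: powr_numeral)
  then show ?thesis by (simp only: powr_powr)
qed

lemma powr_mult_power2:
  fixes x :: real
  assumes "0 < x"
  shows "x powr (q - 2) * x\<^sup>2 = x powr q"
proof -
  have "x\<^sup>2 = x powr 2" using assms by (simp add: powr_numeral)
  then show ?thesis by (simp only: flip: powr_add) simp
qed
text \<open>A concave power lies below its tangent at \<open>h\<close>; after division by
  \<open>h\<close> this is Young's inequality for \<open>A / h\<close> and 1.\<close>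

lemma powr_tangent_le:
  fixes A h q :: real
  assumes "0 \<le> A" "0 < h" "0 < q" "q \<le> 1"
  shows "A powr q \<le> q * (h powr (q-1) * A) + (1-q) * h powr q"
proof -
  have *: "t powr q \<le> q * t + (1-q)" if "0 \<le> t" for t
  proof (cases "t = 0")
    case False
    then show ?thesis
      using Youngs_inequality_0[of q "1-q" t 1] that assms by simp
  qed (use assms in auto)
  have "A powr q = h powr q * (A/h) powr q"
    using assms by (simp add: powr_divide)
  also have "\<dots> \<le> h powr q * (q * (A/h) + (1-q))"
    by (intro mult_left_mono *) (use assms in auto)
  also have "\<dots> = q * (h powr (q-1) * A) + (1-q) * h powr q"
    using assms by (simp add: powr_diff field_simps)
  finally show ?thesis .
qed

text \<open>The convex counterpart, deduced by applying the concave bound with exponent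
  \<open>1 / q\<close> to \<open>t powr q\<close>. At \<open>h = 0\<close> the left side is 0,
  because \<open>0 powr x = 0\<close> for every \<open>x\<close>, also for
  \<open>x = 0\<close>.\<close>

lemma powr_tangent_ge:
  fixes A h q :: real
  assumes "0 \<le> A" "0 \<le> h" "1 \<le> q"
  shows "q * (h powr (q-1) * A) - (q-1) * h powr q \<le> A powr q"
proof (cases "h = 0")
  case False
  then have h: "0 < h" using assms by simp
  have *: "q * t - (q-1) \<le> t powr q" if "0 \<le> t" for t
  proof -
    have "(t powr q) powr (1/q) \<le> (1/q) * (1 powr (1/q-1) * (t powr q)) + (1-1/q) * 1 powr (1/q)"
      by (rule powr_tangent_le) (use assms in auto)
    then have "t \<le> (1/q) * t powr q + (1-1/q)"
      using that assms by (simp add: powr_powr)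
    then have "q * t \<le> q * ((1/q) * t powr q + (1-1/q))"
      using assms by (intro mult_left_mono) auto
    also have "\<dots> = t powr q + (q-1)" using assms by (simp add: field_simps)
    finally show ?thesis by simp
  qed
  have "q * (h powr (q-1) * A) - (q-1) * h powr q = h powr q * (q * (A/h) - (q-1))"
    using h by (simp add: powr_diff field_simps)
  also have "\<dots> \<le> h powr q * (A/h) powr q"
    by (intro mult_left_mono *) (use assms h in auto)
  also have "\<dots> = A powr q" using assms h by (simp add: powr_divide)
  finally show ?thesis .
qed (use assms in auto)

text \<open>By homogeneity \<open>a + b\<close> is normalised to 1, and a number in [0, 1] is at
  most its \<open>q\<close>-th power.\<close>

lemma powr_add_le:
  fixes a b q :: real
  assumes "0 \<le> a" "0 \<le> b" "0 < q" "q \<le> 1"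
  shows "(a + b) powr q \<le> a powr q + b powr q"
proof (cases "a + b = 0")
  case False
  then have ab: "0 < a + b" using assms by simp
  have *: "t \<le> t powr q" if "0 \<le> t" "t \<le> 1" for t :: real
    using powr_mono'[of q 1 t] that assms by simp
  have "1 = a/(a+b) + b/(a+b)" using ab by (simp flip: add_divide_distrib)
  also have "\<dots> \<le> (a/(a+b)) powr q + (b/(a+b)) powr q"
    by (intro add_mono *) (use assms ab in auto)
  also have "\<dots> = (a powr q + b powr q) / (a+b) powr q"
    using assms ab by (simp add: powr_divide add_divide_distrib)
  finally show ?thesis using ab by (simp add: le_divide_eq)
qed (use assms in auto)

text \<open>A minimiser over the convex hull is automatically the barycentre for the weights
  \<open>dist (u x) c powr (p - 2)\<close>: otherwise moving towards that barycentre decreases the cost.\<close>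
lemma stationary_center_exists:
  fixes u :: "'i \<Rightarrow> 'a::real_inner"
  assumes I: "finite I" and p: "2 \<le> p"
  shows "\<exists>c. (\<Sum>x\<in>I. (dist (u x) c powr (p-2)) *\<^sub>R (u x - c)) = 0"
proof (cases "I = {}")
  case False
  \<comment> \<open>The hull of finitely many points is compact in any inner product space, so a
    minimiser exists even in infinite dimension.\<close>
  define S where "S = convex hull (u ` I)"
  define q where "q = p/2"
  define f where "f c = (\<Sum>x\<in>I. (dist (u x) c)\<^sup>2 powr q)" for c
  have q: "1 \<le> q" using p by (simp add: q_def)
  have cS: "compact S" unfolding S_def by (intro finite_imp_compact_convex_hull) (use I in auto)
  have "S \<noteq> {}" unfolding S_def using False by auto
  moreover have "continuous_on S f"
    unfolding f_def by (intro continuous_on_sum continuous_on_powr' continuous_intros) (use q in auto)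
  ultimately obtain c where c: "c \<in> S" and min: "\<And>c'. c' \<in> S \<Longrightarrow> f c \<le> f c'"
    using continuous_attains_inf[OF cS] by blast
  define w where "w x = (dist (u x) c)\<^sup>2 powr (q-1)" for x
  \<comment> \<open>For \<open>p = 2\<close> and a point equal to \<open>c\<close> both sides are
    \<open>0 powr 0 = 0\<close>, where the usual convention gives 1; such a point contributes
    nothing to the barycentre condition.\<close>
  have w_eq: "w x = dist (u x) c powr (p-2)" for x
  proof (cases "dist (u x) c = 0")
    case False
    then show ?thesis
      by (simp add: w_def q_def power2_powr right_diff_distrib)
  qed (simp add: w_def)
  define W where "W = sum w I"
  have w0: "0 \<le> w x" for x by (simp add: w_def)
  have "(\<Sum>x\<in>I. w x *\<^sub>R (u x - c)) = 0"
  proof (cases "W = 0")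
    case True
    then have "\<forall>x\<in>I. w x = 0" unfolding W_def using I w0 by (simp add: sum_nonneg_eq_0_iff)
    then show ?thesis by simp
  next
    case W: False
    then have W0: "0 < W" using w0 by (simp add: W_def less_le sum_nonneg)
    define b where "b = (\<Sum>x\<in>I. (w x / W) *\<^sub>R u x)"
    have bS: "b \<in> S"
      unfolding b_def by (rule convex_sum)
        (use I W0 w0 in \<open>auto simp: S_def W_def sum_divide_distrib[symmetric] intro: hull_inc\<close>)
    define v where "v = b - c"
    have sw: "(\<Sum>x\<in>I. w x *\<^sub>R (u x - c)) = W *\<^sub>R v"
    proof -
      have "W *\<^sub>R b = (\<Sum>x\<in>I. w x *\<^sub>R u x)" using W by (simp add: b_def scaleR_sum_right)
      then show ?thesis
        by (simp add: v_def scaleR_diff_right sum_subtractf W_def scaleR_sum_left)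
    qed
    define A where "A t x = (dist (u x) (c + t *\<^sub>R v))\<^sup>2" for t x
    have A_eq: "A t x = A 0 x + t * (t * (v \<bullet> v) - 2 * ((u x - c) \<bullet> v))" for t x
      unfolding A_def dist_norm power2_norm_eq_inner
      by (simp add: inner_add_left inner_add_right inner_diff_left inner_diff_right inner_commute algebra_simps)
    define g where "g t x = q * (A t x powr (q-1) * (t * (v \<bullet> v) - 2 * ((u x - c) \<bullet> v)))" for t x
    have pos: "0 \<le> (\<Sum>x\<in>I. g t x)" if t: "0 < t" "t \<le> 1" for t
    proof -
      have "c + t *\<^sub>R v = (1-t) *\<^sub>R c + t *\<^sub>R b" by (simp add: v_def algebra_simps)
      also have "\<dots> \<in> S" using c bS t by (intro convexD_alt) (auto simp: S_def)
      finally have "f c \<le> f (c + t *\<^sub>R v)" by (rule min)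
      then have "0 \<le> (\<Sum>x\<in>I. A t x powr q - A 0 x powr q)"
        by (simp add: f_def A_def sum_subtractf)
      also have "\<dots> \<le> (\<Sum>x\<in>I. t * g t x)"
      proof (intro sum_mono)
        fix x
        \<comment> \<open>The tangent is taken at the moved point, so that it bounds the increment
          from above.\<close>
        have "q * (A t x powr (q-1) * A 0 x) - (q-1) * A t x powr q \<le> A 0 x powr q"
          by (rule powr_tangent_ge) (use q in \<open>auto simp: A_def\<close>)
        moreover have "A t x powr q = A t x powr (q-1) * A t x"
        proof (cases "A t x = 0")
          case False
          then show ?thesis
            using powr_add[of "A t x" "q-1" 1] by (simp add: A_def)
        qed auto
        ultimately have "A t x powr q - A 0 x powr q \<le> q * (A t x powr (q-1) * (A t x - A 0 x))"
          by (simp add: algebra_simps)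
        also have "\<dots> = t * g t x"
          unfolding g_def by (subst (2) A_eq) (simp add: algebra_simps)
        finally show "A t x powr q - A 0 x powr q \<le> t * g t x" .
      qed
      also have "\<dots> = t * (\<Sum>x\<in>I. g t x)" by (simp add: sum_distrib_left)
      finally show ?thesis using t by (simp add: zero_le_mult_iff)
    qed
    have At: "((\<lambda>t. A t x) \<longlongrightarrow> A 0 x) (at_right 0)" for x
      unfolding A_def by (auto intro!: tendsto_eq_intros)
    have "((\<lambda>t. g t x) \<longlongrightarrow> q * (w x * (0 * (v \<bullet> v) - 2 * ((u x - c) \<bullet> v)))) (at_right 0)" for x
    proof (cases "u x = c")
      case False
      then have "A 0 x \<noteq> 0" by (simp add: A_def)
      then have "((\<lambda>t. A t x powr (q-1)) \<longlongrightarrow> w x) (at_right 0)"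
        using tendsto_powr[OF At tendsto_const, of x "q-1"] by (simp add: w_def A_def)
      then show ?thesis unfolding g_def
        by (intro tendsto_intros)
    next
      case True
      have "\<forall>\<^sub>F t in at_right 0. norm (g t x) \<le> q * ((v \<bullet> v) powr (q-1)) * (v \<bullet> v) * t"
        unfolding eventually_at_right_field
      proof (intro exI[of _ 1] conjI allI impI)
        fix t :: real assume t: "0 < t" "t < 1"
        have "A t x = t\<^sup>2 * (v \<bullet> v)"
          using True by (subst A_eq) (simp add: A_def power2_eq_square)
        also have "\<dots> \<le> 1 * (v \<bullet> v)" using t by (intro mult_right_mono) (auto simp: power_le_one)
        finally have "A t x powr (q-1) \<le> (v \<bullet> v) powr (q-1)"
          using q by (intro powr_mono2) (auto simp: A_def)
        then have "q * t * (v \<bullet> v) * A t x powr (q-1) \<le> q * t * (v \<bullet> v) * (v \<bullet> v) powr (q-1)"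
          using q t by (intro mult_left_mono) auto
        then show "norm (g t x) \<le> q * ((v \<bullet> v) powr (q-1)) * (v \<bullet> v) * t"
          using q t True by (simp add: g_def abs_mult mult_ac)
      qed auto
      moreover have "((\<lambda>t. q * ((v \<bullet> v) powr (q-1)) * (v \<bullet> v) * t) \<longlongrightarrow> 0) (at_right 0)"
        by (auto intro!: tendsto_eq_intros)
      ultimately have "((\<lambda>t. g t x) \<longlongrightarrow> 0) (at_right 0)"
        by (rule Lim_null_comparison)
      then show ?thesis using True by simp
    qed
    then have "((\<lambda>t. \<Sum>x\<in>I. g t x) \<longlongrightarrow> (\<Sum>x\<in>I. q * (w x * (0 * (v \<bullet> v) - 2 * ((u x - c) \<bullet> v))))) (at_right 0)"
      by (intro tendsto_sum)
    moreover have "\<forall>\<^sub>F t in at_right 0. 0 \<le> (\<Sum>x\<in>I. g t x)"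
      unfolding eventually_at_right_field by (intro exI[of _ 1]) (use pos in auto)
    ultimately have "0 \<le> (\<Sum>x\<in>I. q * (w x * (0 * (v \<bullet> v) - 2 * ((u x - c) \<bullet> v))))"
      by (rule tendsto_lowerbound) simp
    also have "\<dots> = - 2 * q * ((\<Sum>x\<in>I. w x *\<^sub>R (u x - c)) \<bullet> v)"
      by (simp add: inner_sum_left sum_distrib_left mult_ac sum_negf)
    \<comment> \<open>The one-sided derivative towards \<open>b\<close> is minus a positive multiple
      of \<open>v \<bullet> v\<close>, so minimality forces \<open>v = 0\<close>.\<close>
    also have "\<dots> = - (2 * q * W * (v \<bullet> v))" by (simp add: sw)
    finally have "v \<bullet> v \<le> 0" using q W0 by (simp add: mult_le_0_iff)
    then have "v = 0" by (metis inner_gt_zero_iff not_le)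
    then show ?thesis by (simp add: sw)
  qed
  then show ?thesis unfolding w_eq by blast
qed simp

text \<open>For \<open>p\<close> at least 2 the power p / 2 is convex, so the cost in
  \<open>v\<close> is bounded below by tangents taken at the squared distances in \<open>u\<close>.
  The weights are thus frozen in \<open>u\<close>, and the stationary centre is the barycentre for
  exactly these weights.\<close>

lemma pcost_transfer_ge2:
  fixes u :: "'i \<Rightarrow> 'a::real_inner" and v :: "'i \<Rightarrow> 'b::real_inner"
  assumes I: "finite I" and p: "2 \<le> p" and \<eta>: "0 \<le> \<eta>" "\<eta> \<le> 1" and \<kappa>: "0 < \<kappa>" "\<kappa> \<le> 1" and L: "0 \<le> L"
    and a: "\<And>x. x \<in> I \<Longrightarrow> 0 \<le> a x" and T: "0 \<le> T"
    and far: "\<And>x y. x \<in> I \<Longrightarrow> y \<in> I \<Longrightarrow> contracted \<eta> u v x y \<Longrightarrow> dist (u x) (u y) \<le> L * a y"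
    and mass: "\<And>x. x \<in> I \<Longrightarrow>
      (\<Sum>y | y \<in> I \<and> contracted \<eta> u v x y. a y powr p) \<le> T"
  shows "(1 - p * \<eta> - p * \<kappa>) * pcost p I u - p * ((L/\<kappa>) powr p * T) \<le> (\<Sum>x\<in>I. dist (v x) c' powr p)"
proof -
  obtain c where c: "(\<Sum>x\<in>I. (dist (u x) c powr (p-2)) *\<^sub>R (u x - c)) = 0"
    using stationary_center_exists[OF I p] by blast
  define w where "w x = dist (u x) c powr (p-2)" for x
  define F where "F = (\<Sum>x\<in>I. dist (u x) c powr p)"
  define V where "V = (\<Sum>x\<in>I. dist (v x) c' powr p)"
  have w2: "w x * (dist (u x) c)\<^sup>2 = dist (u x) c powr p" for x
  proof (cases "dist (u x) c = 0")
    case False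
    then show ?thesis unfolding w_def by (intro powr_mult_power2) simp
  qed (use p in \<open>simp add: w_def\<close>)
  have F0: "0 \<le> F" unfolding F_def by (simp add: sum_nonneg)
  have LT: "0 \<le> (L/\<kappa>) powr p * T" using T by simp
  define b where "b = \<kappa> * F + (L/\<kappa>) powr p * T"
  have main: "(1 - p * \<eta> - p * \<kappa>) * F - p * ((L/\<kappa>) powr p * T) \<le> V"
  proof (cases "sum w I = 0")
    case True
    then have "\<forall>x\<in>I. w x = 0" using I by (simp add: sum_nonneg_eq_0_iff w_def)
    then have "F = 0" unfolding F_def w2[symmetric] by simp
    moreover have "0 \<le> V" unfolding V_def by (simp add: sum_nonneg)
    moreover have "0 \<le> p * ((L/\<kappa>) powr p * T)" using p T by (intro mult_nonneg_nonneg) auto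
    ultimately show ?thesis by simp
  next
    case False
    have key: "(1-\<eta>)\<^sup>2 * ((\<Sum>x\<in>I. w x * (dist (u x) c)\<^sup>2) - b) \<le> (\<Sum>x\<in>I. w x * (dist (v x) c')\<^sup>2)"
    proof (rule weighted_sum_transfer[OF I _ _ \<eta>])
      show "0 < sum w I" using False by (simp add: less_le sum_nonneg w_def)
      show "0 \<le> b" unfolding b_def using \<kappa> F0 LT by (intro add_nonneg_nonneg) auto
      show "(\<Sum>x\<in>I. w x *\<^sub>R (u x - c)) = 0" using c by (simp add: w_def)
    next
      fix x assume x: "x \<in> I"
      let ?N = "{y. y \<in> I \<and> contracted \<eta> u v x y}"
      have "(\<Sum>y\<in>?N. w y * (dist (u x) (u y))\<^sup>2) \<le> (\<Sum>y\<in>?N. \<kappa> * dist (u y) c powr p + (L/\<kappa>) powr p * a y powr p)"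
      proof (intro sum_mono)
        fix y assume y: "y \<in> ?N"
        define d where "d = dist (u x) (u y)"
        have d: "0 \<le> d" "d \<le> L * a y" using far[OF x] y by (auto simp: d_def)
        show "w y * (dist (u x) (u y))\<^sup>2 \<le> \<kappa> * dist (u y) c powr p + (L/\<kappa>) powr p * a y powr p"
        \<comment> \<open>A bad pair that is short relative to \<open>dist (u y) c\<close> is
          charged to the cost of \<open>y\<close>. Otherwise \<open>dist (u y) c\<close> is below
          \<open>d / \<kappa>\<close>, and the term is bounded by a multiple of
          \<open>a y powr p\<close>, whose sum over the bad partners is at most
          \<open>T\<close>.\<close>
        proof (cases "d \<le> \<kappa> * dist (u y) c")
          case True
          have "d\<^sup>2 \<le> (\<kappa> * dist (u y) c)\<^sup>2" using True d by (intro power_mono) auto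
          also have "\<dots> = \<kappa> * (\<kappa> * (dist (u y) c)\<^sup>2)" by (simp add: power2_eq_square)
          also have "\<dots> \<le> \<kappa> * (1 * (dist (u y) c)\<^sup>2)"
            by (intro mult_left_mono mult_right_mono) (use \<kappa> in auto)
          finally have "w y * d\<^sup>2 \<le> w y * (\<kappa> * (dist (u y) c)\<^sup>2)"
            by (intro mult_left_mono) (auto simp: w_def)
          also have "\<dots> = \<kappa> * dist (u y) c powr p" using w2[of y] by simp
          finally show ?thesis by (simp add: d_def add_increasing2)
        next
          case False
          then have lt: "dist (u y) c < d / \<kappa>" using \<kappa> by (simp add: field_simps)
          then have dk: "0 < d / \<kappa>" by (meson le_less_trans zero_le_dist)
          have "w y * d\<^sup>2 \<le> (d/\<kappa>) powr (p-2) * (d/\<kappa>)\<^sup>2"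
          proof (intro mult_mono)
            show "w y \<le> (d/\<kappa>) powr (p-2)" unfolding w_def by (intro powr_mono2) (use lt p in auto)
            show "d\<^sup>2 \<le> (d/\<kappa>)\<^sup>2" using \<kappa> d by (intro power_mono) (auto simp: le_divide_eq mult.commute[of d] mult_left_le_one_le)
          qed auto
          also have "\<dots> = (d/\<kappa>) powr p" using dk by (rule powr_mult_power2)
          also have "\<dots> \<le> (L/\<kappa> * a y) powr p"
            by (intro powr_mono2) (use d p \<kappa> dk in \<open>auto simp: divide_right_mono\<close>)
          also have "\<dots> = (L/\<kappa>) powr p * a y powr p"
            using L \<kappa> a y by (subst powr_mult) auto
          finally show ?thesis using \<kappa> by (simp add: d_def add_increasing)
        qed
      qed
      also have "\<dots> = \<kappa> * (\<Sum>y\<in>?N. dist (u y) c powr p) + (L/\<kappa>) powr p * (\<Sum>y\<in>?N. a y powr p)"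
        by (simp add: sum.distrib sum_distrib_left)
      also have "\<dots> \<le> \<kappa> * F + (L/\<kappa>) powr p * T"
        unfolding F_def by (intro add_mono mult_left_mono sum_mono2 mass x) (use I \<kappa> in auto)
      finally show "(\<Sum>y\<in>?N. w y * (dist (u x) (u y))\<^sup>2) \<le> b" by (simp add: b_def)
    qed (simp add: w_def)
    have "(p/2) * ((1-\<eta>)\<^sup>2 * (F - b)) - (p/2-1) * F \<le> (p/2) * (\<Sum>x\<in>I. w x * (dist (v x) c')\<^sup>2) - (p/2-1) * F"
      using key p unfolding w2 F_def[symmetric] by (intro diff_right_mono mult_left_mono) auto
    also have "\<dots> = (\<Sum>x\<in>I. (p/2) * (((dist (u x) c)\<^sup>2) powr (p/2-1) * (dist (v x) c')\<^sup>2) - (p/2-1) * ((dist (u x) c)\<^sup>2) powr (p/2))"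
    proof -
      have "((dist (u x) c)\<^sup>2) powr (p/2-1) = w x" "((dist (u x) c)\<^sup>2) powr (p/2) = dist (u x) c powr p" for x
        by (simp_all add: w_def power2_powr right_diff_distrib)
      then show ?thesis by (simp add: F_def sum_subtractf sum_distrib_left)
    qed
    also have "\<dots> \<le> (\<Sum>x\<in>I. (dist (v x) c')\<^sup>2 powr (p/2))"
      by (intro sum_mono powr_tangent_ge) (use p in auto)
    also have "\<dots> = V"
    proof -
      have "((dist (v x) c')\<^sup>2) powr (p/2) = dist (v x) c' powr p" for x
        by (simp add: power2_powr)
      then show ?thesis by (simp add: V_def)
    qed
    finally have 1: "(p/2) * ((1-\<eta>)\<^sup>2 * (F - b)) - (p/2-1) * F \<le> V" .
    have "(1-\<eta>)\<^sup>2 * F \<ge> (1 - 2*\<eta>) * F"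
      using F0 by (intro mult_right_mono) (auto simp: power2_eq_square algebra_simps)
    moreover have "(1-\<eta>)\<^sup>2 * b \<le> 1 * b"
      using \<eta> F0 LT \<kappa> by (intro mult_right_mono) (auto simp: power_le_one b_def)
    ultimately have "(1 - 2*\<eta>) * F - b \<le> (1-\<eta>)\<^sup>2 * (F - b)" by (simp add: right_diff_distrib)
    then have "(p/2) * ((1 - 2*\<eta>) * F - b) \<le> (p/2) * ((1-\<eta>)\<^sup>2 * (F - b))"
      using p by (intro mult_left_mono) auto
    then have "(p/2) * ((1 - 2*\<eta>) * F - b) - (p/2-1) * F \<le> V" using 1 by simp
    moreover have "(p/2) * ((1 - 2*\<eta>) * F - b) - (p/2-1) * F = (1 - p*\<eta>) * F - (p/2) * b"
      by (simp add: field_simps)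
    moreover have "(p/2) * b \<le> p * b" using p F0 LT \<kappa> by (intro mult_right_mono) (auto simp: b_def)
    ultimately show ?thesis by (simp add: b_def algebra_simps)
  qed
  show ?thesis
  \<comment> \<open>Replacing \<open>F\<close> by the infimum needs a nonnegative factor; with a
    negative one the left side is at most 0.\<close>
  proof (cases "0 \<le> 1 - p * \<eta> - p * \<kappa>")
    case True
    have "(1 - p * \<eta> - p * \<kappa>) * pcost p I u \<le> (1 - p * \<eta> - p * \<kappa>) * F"
      unfolding F_def by (intro mult_left_mono pcost_le True)
    then show ?thesis using main by (simp add: V_def)
  next
    case False
    have "0 \<le> pcost p I u" by (rule pcost_ge) (simp add: sum_nonneg)
    then have "(1 - p * \<eta> - p * \<kappa>) * pcost p I u \<le> 0"
      using False by (intro mult_nonpos_nonneg) auto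
    moreover have "0 \<le> V" unfolding V_def by (simp add: sum_nonneg)
    moreover have "0 \<le> p * ((L/\<kappa>) powr p * T)" using p T by (intro mult_nonneg_nonneg) auto
    ultimately show ?thesis by (simp add: V_def)
  qed
qed

text \<open>For \<open>p\<close> below 2 the power p / 2 is concave, so tangents bound the cost in
  \<open>u\<close> from above, and their base point \<open>h\<close> has to come from
  \<open>v\<close>. The weights then do not depend on the centre in \<open>u\<close>, which can be
  their explicit barycentre.\<close>

lemma pcost_transfer_lt2:
  fixes u :: "'i \<Rightarrow> 'a::real_inner" and v :: "'i \<Rightarrow> 'b::real_inner"
  assumes I: "finite I" and p: "1 \<le> p" "p < 2" and \<eta>: "0 \<le> \<eta>" "\<eta> \<le> 1" and \<kappa>: "0 < \<kappa>" "\<kappa> \<le> 1"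
    and a: "\<And>x. x \<in> I \<Longrightarrow> 0 \<le> a x" and T: "0 \<le> T"
    and far: "\<And>x y. x \<in> I \<Longrightarrow> y \<in> I \<Longrightarrow> contracted \<eta> u v x y \<Longrightarrow> dist (u x) (u y) \<le> L * a y"
    and mass: "\<And>x. x \<in> I \<Longrightarrow>
      (\<Sum>y | y \<in> I \<and> contracted \<eta> u v x y. a y powr p) \<le> T"
  shows "(1 - 2 * \<eta>) * pcost p I u - \<kappa> * (\<Sum>x\<in>I. a x powr p) - L\<^sup>2 / \<kappa> * T \<le> (\<Sum>x\<in>I. dist (v x) c' powr p)"
proof (cases "I = {}")
  case True
  have "pcost p {} u = 0" by (simp add: pcost_def)
  moreover have "0 \<le> L\<^sup>2 / \<kappa> * T" using \<kappa> T by simp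
  ultimately show ?thesis using True by simp
next
  case False
  define V where "V = (\<Sum>x\<in>I. dist (v x) c' powr p)"
  define M where "M = (\<Sum>x\<in>I. a x powr p)"
  define b where "b = L\<^sup>2 / \<kappa> * T"
  have b0: "0 \<le> b" using \<kappa> T by (simp add: b_def)
  define q where "q = p/2"
  have q: "0 < q" "q \<le> 1" "q - 1 \<le> 0" using p by (auto simp: q_def)
  have *: "(1-2*\<eta>) * pcost p I u - b \<le> V + \<kappa> * M + real (card I) * \<xi>" if \<xi>: "0 < \<xi>" for \<xi>
  proof -
    \<comment> \<open>\<open>\<zeta>\<close> keeps \<open>h\<close> positive where its other two
      summands vanish; it costs \<open>\<xi>\<close> per point, and \<open>\<xi>\<close> tends to 0
      at the end.\<close>
    define \<zeta> where "\<zeta> = \<xi> powr (1/q)"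
    have \<zeta>: "0 < \<zeta>" "\<zeta> powr q = \<xi>" using \<xi> q by (auto simp: \<zeta>_def powr_powr)
    \<comment> \<open>The weight has the negative exponent \<open>q - 1\<close>. The summand
      \<open>(\<kappa> * a x)\<^sup>2\<close> caps it, so that a bad partner close to
      \<open>c'\<close> in \<open>v\<close> cannot dominate; the price is
      \<open>\<kappa> * a x powr p\<close> per point.\<close>
    define h where "h x = (dist (v x) c')\<^sup>2 + (\<kappa> * a x)\<^sup>2 + \<zeta>" for x
    define w where "w x = h x powr (q-1)" for x
    have h: "0 < h x" for x using \<zeta> by (simp add: h_def add_nonneg_pos)
    define W where "W = sum w I"
    have w0: "0 < w x" for x using h[of x] by (simp add: w_def)
    have W0: "0 < W" unfolding W_def by (intro sum_pos) (use I False w0 in auto)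
    define H where "H = (\<Sum>x\<in>I. h x powr q)"
    define c where "c = (1/W) *\<^sub>R (\<Sum>x\<in>I. w x *\<^sub>R u x)"
    have c: "(\<Sum>x\<in>I. w x *\<^sub>R (u x - c)) = 0"
    proof -
      have "(\<Sum>x\<in>I. w x *\<^sub>R (u x - c)) = (\<Sum>x\<in>I. w x *\<^sub>R u x) - W *\<^sub>R c"
        by (simp add: scaleR_diff_right sum_subtractf W_def scaleR_sum_left)
      then show ?thesis using W0 by (simp add: c_def)
    qed
    define F where "F = (\<Sum>x\<in>I. w x * (dist (u x) c)\<^sup>2)"
    have key: "(1-\<eta>)\<^sup>2 * (F - b) \<le> (\<Sum>x\<in>I. w x * (dist (v x) c')\<^sup>2)"
      unfolding F_def
    proof (rule weighted_sum_transfer[OF I _ _ \<eta> _ c b0])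
      show "0 < sum w I" using W0 by (simp add: W_def)
    next
      fix x assume x: "x \<in> I"
      let ?N = "{y. y \<in> I \<and> contracted \<eta> u v x y}"
      have "(\<Sum>y\<in>?N. w y * (dist (u x) (u y))\<^sup>2) \<le> (\<Sum>y\<in>?N. L\<^sup>2 / \<kappa> * a y powr p)"
      proof (intro sum_mono)
        fix y assume y: "y \<in> ?N"
        define d where "d = dist (u x) (u y)"
        have d: "0 \<le> d" "d \<le> L * a y" using far[OF x] y by (auto simp: d_def)
        show "w y * (dist (u x) (u y))\<^sup>2 \<le> L\<^sup>2 / \<kappa> * a y powr p"
        proof (cases "a y = 0")
          case True
          then show ?thesis using d by (simp add: d_def)
        next
          case False
          then have ay: "0 < a y" using a y by (simp add: less_le)
          have "w y \<le> ((\<kappa> * a y)\<^sup>2) powr (q-1)"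
            unfolding w_def by (intro powr_mono2') (use q ay \<kappa> \<zeta> in \<open>auto simp: h_def\<close>)
          also have "\<dots> = \<kappa> powr (p-2) * a y powr (p-2)"
            using ay \<kappa> by (subst power2_powr) (auto simp: powr_mult q_def right_diff_distrib)
          also have "\<dots> \<le> \<kappa> powr (-1) * a y powr (p-2)"
            by (intro mult_right_mono powr_mono') (use p \<kappa> in auto)
          finally have "w y * d\<^sup>2 \<le> (\<kappa> powr (-1) * a y powr (p-2)) * (L * a y)\<^sup>2"
            by (intro mult_mono power_mono) (use d in auto)
          also have "\<dots> = L\<^sup>2 / \<kappa> * (a y powr (p-2) * (a y)\<^sup>2)"
            using \<kappa> by (simp add: powr_minus field_simps)
          also have "a y powr (p-2) * (a y)\<^sup>2 = a y powr p"
            using ay by (rule powr_mult_power2)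
          finally show ?thesis by (simp add: d_def)
        qed
      qed
      also have "\<dots> = L\<^sup>2 / \<kappa> * (\<Sum>y\<in>?N. a y powr p)" by (simp add: sum_distrib_left)
      also have "\<dots> \<le> b" unfolding b_def by (intro mult_left_mono mass x) (use \<kappa> in auto)
      finally show "(\<Sum>y\<in>?N. w y * (dist (u x) (u y))\<^sup>2) \<le> b" .
    qed (use w0 in \<open>simp add: less_imp_le\<close>)
    have wh: "w x * h x = h x powr q" for x
      unfolding w_def using h[of x] powr_add[of "h x" "q-1" 1] by simp
    have "(\<Sum>x\<in>I. w x * (dist (v x) c')\<^sup>2) \<le> (\<Sum>x\<in>I. w x * h x)"
      by (intro sum_mono mult_left_mono) (use w0 \<zeta> in \<open>auto simp: h_def less_imp_le\<close>)
    then have key': "(1-\<eta>)\<^sup>2 * (F - b) \<le> H" using key by (simp add: wh H_def)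
    have "pcost p I u \<le> (\<Sum>x\<in>I. dist (u x) c powr p)" by (rule pcost_le)
    also have "\<dots> = (\<Sum>x\<in>I. ((dist (u x) c)\<^sup>2) powr q)"
    proof -
      have "((dist (u x) c)\<^sup>2) powr q = dist (u x) c powr p" for x
        by (simp add: power2_powr q_def)
      then show ?thesis by simp
    qed
    also have "\<dots> \<le> (\<Sum>x\<in>I. q * (h x powr (q-1) * (dist (u x) c)\<^sup>2) + (1-q) * h x powr q)"
      by (intro sum_mono powr_tangent_le) (use h q in auto)
    also have "\<dots> = q * F + (1-q) * H"
      by (simp add: F_def H_def w_def sum.distrib sum_distrib_left)
    finally have "(1-\<eta>)\<^sup>2 * pcost p I u \<le> (1-\<eta>)\<^sup>2 * (q * F + (1-q) * H)"
      by (intro mult_left_mono) auto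
    also have "\<dots> = q * ((1-\<eta>)\<^sup>2 * (F - b)) + (1-\<eta>)\<^sup>2 * (q * b + (1-q) * H)"
      by (simp add: algebra_simps)
    also have "\<dots> \<le> q * H + 1 * (q * b + (1-q) * H)"
    proof (intro add_mono mult_left_mono mult_right_mono key')
      show "(1-\<eta>)\<^sup>2 \<le> 1" using \<eta> by (simp add: power_le_one)
      show "0 \<le> q * b + (1-q) * H" using q b0 by (auto simp: H_def intro!: add_nonneg_nonneg mult_nonneg_nonneg sum_nonneg)
    qed (use q in auto)
    also have "\<dots> \<le> H + b" using q b0 by (simp add: algebra_simps mult_left_le)
    finally have 1: "(1-\<eta>)\<^sup>2 * pcost p I u \<le> H + b" .
    have "(1-2*\<eta>) * pcost p I u \<le> (1-\<eta>)\<^sup>2 * pcost p I u"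
      by (intro mult_right_mono pcost_ge) (auto simp: power2_eq_square algebra_simps sum_nonneg)
    moreover have "H \<le> (\<Sum>x\<in>I. dist (v x) c' powr p + \<kappa> * a x powr p + \<xi>)"
      unfolding H_def
    proof (intro sum_mono)
      fix x assume x: "x \<in> I"
      have "h x powr q \<le> ((dist (v x) c')\<^sup>2 + (\<kappa> * a x)\<^sup>2) powr q + \<zeta> powr q"
        unfolding h_def by (intro powr_add_le) (use \<zeta> q in auto)
      also have "\<dots> \<le> ((dist (v x) c')\<^sup>2) powr q + ((\<kappa> * a x)\<^sup>2) powr q + \<zeta> powr q"
        by (intro add_right_mono powr_add_le) (use q in auto)
      also have "((dist (v x) c')\<^sup>2) powr q = dist (v x) c' powr p"
        by (simp add: power2_powr q_def)
      also have "((\<kappa> * a x)\<^sup>2) powr q = \<kappa> powr p * a x powr p"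
        using a[OF x] \<kappa> by (subst power2_powr) (auto simp: powr_mult q_def)
      also have "\<kappa> powr p * a x powr p \<le> \<kappa> * a x powr p"
        using powr_mono'[of 1 p \<kappa>] \<kappa> p by (intro mult_right_mono) auto
      finally show "h x powr q \<le> dist (v x) c' powr p + \<kappa> * a x powr p + \<xi>" by (simp add: \<zeta>)
    qed
    ultimately show ?thesis using 1 by (simp add: V_def M_def sum.distrib sum_distrib_left)
  qed
  have "(1-2*\<eta>) * pcost p I u - b \<le> V + \<kappa> * M"
  proof (rule field_le_epsilon)
    fix e :: real assume "0 < e"
    then show "(1-2*\<eta>) * pcost p I u - b \<le> V + \<kappa> * M + e"
      using *[of "e / real (card I)"] I False by (simp add: card_gt_0_iff)
  qed
  then show ?thesis by (simp add: V_def M_def b_def)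
qed

text \<open>A common form of the two regimes. The exponent \<open>p + 1\<close> is chosen to cover
  \<open>L\<^sup>2 / \<kappa>\<close> from the concave case, using \<open>1 \<le> p\<close> and
  \<open>1 \<le> L / \<kappa>\<close>.\<close>

lemma pcost_transfer:
  fixes u :: "'i \<Rightarrow> 'a::real_inner" and v :: "'i \<Rightarrow> 'b::real_inner"
  assumes I: "finite I" and p: "1 \<le> p" and \<eta>: "0 \<le> \<eta>" "\<eta> \<le> 1" and \<kappa>: "0 < \<kappa>" "\<kappa> \<le> 1" and L: "1 \<le> L"
    and a: "\<And>x. x \<in> I \<Longrightarrow> 0 \<le> a x" and T: "0 \<le> T"
    and far: "\<And>x y. x \<in> I \<Longrightarrow> y \<in> I \<Longrightarrow> contracted \<eta> u v x y \<Longrightarrow> dist (u x) (u y) \<le> L * a y"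
    and mass: "\<And>x. x \<in> I \<Longrightarrow>
      (\<Sum>y | y \<in> I \<and> contracted \<eta> u v x y. a y powr p) \<le> T"
  shows "(1 - 2 * p * \<eta> - p * \<kappa>) * pcost p I u - \<kappa> * (\<Sum>x\<in>I. a x powr p) - p * (L/\<kappa>) powr (p+1) * T
     \<le> pcost p I v"
proof (rule pcost_ge)
  fix c'
  have c0: "0 \<le> pcost p I u" by (rule pcost_ge) (simp add: sum_nonneg)
  have M0: "0 \<le> \<kappa> * (\<Sum>x\<in>I. a x powr p)" using \<kappa> by (simp add: sum_nonneg)
  have Lk: "1 \<le> L/\<kappa>" using L \<kappa> by (simp add: le_divide_eq)
  show "(1 - 2 * p * \<eta> - p * \<kappa>) * pcost p I u - \<kappa> * (\<Sum>x\<in>I. a x powr p) - p * (L/\<kappa>) powr (p+1) * T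
     \<le> (\<Sum>x\<in>I. dist (v x) c' powr p)"
  proof (cases "2 \<le> p")
    case True
    have "(1 - 2 * p * \<eta> - p * \<kappa>) * pcost p I u \<le> (1 - p * \<eta> - p * \<kappa>) * pcost p I u"
      using p \<eta> c0 by (intro mult_right_mono) auto
    moreover have "p * ((L/\<kappa>) powr p * T) \<le> p * ((L/\<kappa>) powr (p+1) * T)"
      by (intro mult_left_mono mult_right_mono powr_mono) (use p T Lk in auto)
    ultimately show ?thesis
      using pcost_transfer_ge2[OF I True \<eta> \<kappa> _ a T far mass, of c'] L M0 by (simp add: mult.assoc)
  next
    case False
    have "(1 - 2 * p * \<eta> - p * \<kappa>) * pcost p I u \<le> (1 - 2 * \<eta>) * pcost p I u"
    proof (intro mult_right_mono c0)
      have "2 * (1 * \<eta>) \<le> 2 * (p * \<eta>)" using p \<eta> by (intro mult_left_mono mult_right_mono) auto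
      moreover have "0 \<le> p * \<kappa>" using p \<kappa> by simp
      ultimately show "1 - 2 * p * \<eta> - p * \<kappa> \<le> 1 - 2 * \<eta>" by simp
    qed
    moreover have "L\<^sup>2 / \<kappa> * T \<le> (p * (L/\<kappa>) powr (p+1)) * T"
    proof (intro mult_right_mono T)
      have "L\<^sup>2 / \<kappa> * 1 \<le> L\<^sup>2 / \<kappa> * (1 / \<kappa>)" using \<kappa> by (intro mult_left_mono) auto
      then have "L\<^sup>2 / \<kappa> \<le> (L/\<kappa>)\<^sup>2" by (simp add: power2_eq_square)
      also have "\<dots> = (L/\<kappa>) powr 2" using Lk by (simp add: powr_numeral)
      also have "\<dots> \<le> 1 * (L/\<kappa>) powr (p+1)" using powr_mono[of 2 "p+1" "L/\<kappa>"] p Lk by simp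
      also have "\<dots> \<le> p * (L/\<kappa>) powr (p+1)" using p by (intro mult_right_mono) auto
      finally show "L\<^sup>2 / \<kappa> \<le> p * (L/\<kappa>) powr (p+1)" .
    qed
    ultimately show ?thesis
      using pcost_transfer_lt2[OF I p _ \<eta> \<kappa> a T far mass, of c'] False by simp
  qed
qed

section \<open>Near-isometries and partitions\<close>

definition ccost :: "real \<Rightarrow> nat \<Rightarrow> 'i set \<Rightarrow> ('i \<Rightarrow> nat) \<Rightarrow> ('i \<Rightarrow> 'a::real_inner) \<Rightarrow> real" where
  "ccost p k P \<sigma> u = (\<Sum>i<k. pcost p {x\<in>P. \<sigma> x = i} u)"

lemma pcost_nonneg: "0 \<le> pcost p I u"
  by (rule pcost_ge) (simp add: sum_nonneg)

lemma ccost_nonneg: "0 \<le> ccost p k P \<sigma> u"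
  unfolding ccost_def by (simp add: sum_nonneg pcost_nonneg)

lemma sum_clusters:
  fixes f :: "'i \<Rightarrow> real" and \<sigma> :: "'i \<Rightarrow> nat"
  assumes "finite P" "\<forall>x\<in>P. \<sigma> x < k"
  shows "(\<Sum>i<k. \<Sum>x\<in>{x\<in>P. \<sigma> x = i}. f x) = (\<Sum>x\<in>P. f x)"
  by (rule sum.group) (use assms in auto)

text \<open>Depending on whether \<open>b \<le> t * a\<close>, one of the two summands alone bounds
  the left side.\<close>

lemma powr_add_le_weighted:
  fixes a b t p :: real
  assumes "0 \<le> a" "0 \<le> b" "0 < t" "1 \<le> p"
  shows "(a + b) powr p \<le> (1 + t) powr p * a powr p + (1 + 1/t) powr p * b powr p"
proof (cases "b \<le> t * a")
  case True
  then have "(a + b) powr p \<le> ((1 + t) * a) powr p"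
    using assms by (intro powr_mono2) (auto simp: algebra_simps)
  also have "\<dots> = (1 + t) powr p * a powr p" using assms by (subst powr_mult) auto
  finally show ?thesis by (simp add: add_increasing2)
next
  case False
  then have "a \<le> b / t" using assms by (simp add: field_simps)
  then have "(a + b) powr p \<le> ((1 + 1/t) * b) powr p"
    using assms by (intro powr_mono2) (auto simp: algebra_simps)
  also have "\<dots> = (1 + 1/t) powr p * b powr p" using assms by (subst powr_mult) auto
  finally show ?thesis by (simp add: add_increasing)
qed

text \<open>The relaxed triangle inequality holds at every centre; since the infimum need not be
  attained, the inequality is divided by \<open>(1 + t) powr p\<close> before passing to it.\<close>

lemma pcost_perturb:
  assumes "0 < t" "1 \<le> p"
  shows "pcost p I u \<le> (1 + t) powr p * pcost p I u' + (1 + 1/t) powr p * (\<Sum>x\<in>I. dist (u x) (u' x) powr p)"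
proof -
  let ?X = "(1 + 1/t) powr p * (\<Sum>x\<in>I. dist (u x) (u' x) powr p)"
  have t: "0 < (1 + t) powr p" using assms by simp
  have "(pcost p I u - ?X) / (1 + t) powr p \<le> pcost p I u'"
  proof (rule pcost_ge)
    fix c
    have "pcost p I u \<le> (\<Sum>x\<in>I. dist (u x) c powr p)" by (rule pcost_le)
    also have "\<dots> \<le> (\<Sum>x\<in>I. (dist (u' x) c + dist (u x) (u' x)) powr p)"
      by (intro sum_mono powr_mono2) (use assms dist_triangle[of "u _" c "u' _"] in \<open>auto simp: add.commute\<close>)
    also have "\<dots> \<le> (\<Sum>x\<in>I. (1 + t) powr p * dist (u' x) c powr p + (1 + 1/t) powr p * dist (u x) (u' x) powr p)"
      by (intro sum_mono powr_add_le_weighted) (use assms in auto)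
    also have "\<dots> = (1 + t) powr p * (\<Sum>x\<in>I. dist (u' x) c powr p) + ?X"
      by (simp add: sum.distrib sum_distrib_left)
    finally show "(pcost p I u - ?X) / (1 + t) powr p \<le> (\<Sum>x\<in>I. dist (u' x) c powr p)"
      using t by (simp add: divide_le_eq mult.commute)
  qed
  then show ?thesis using t by (simp add: divide_le_eq mult.commute)
qed

lemma ccost_perturb:
  assumes "0 < t" "1 \<le> p" "finite P" "\<forall>x\<in>P. \<sigma> x < k"
  shows "ccost p k P \<sigma> u \<le> (1 + t) powr p * ccost p k P \<sigma> u' + (1 + 1/t) powr p * (\<Sum>x\<in>P. dist (u x) (u' x) powr p)"
proof -
  have "ccost p k P \<sigma> u \<le> (\<Sum>i<k. (1 + t) powr p * pcost p {x\<in>P. \<sigma> x = i} u' +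
     (1 + 1/t) powr p * (\<Sum>x\<in>{x\<in>P. \<sigma> x = i}. dist (u x) (u' x) powr p))"
    unfolding ccost_def by (intro sum_mono pcost_perturb) (use assms in auto)
  also have "\<dots> = (1 + t) powr p * ccost p k P \<sigma> u' + (1 + 1/t) powr p *
     (\<Sum>i<k. \<Sum>x\<in>{x\<in>P. \<sigma> x = i}. dist (u x) (u' x) powr p)"
    by (simp add: ccost_def sum.distrib sum_distrib_left)
  finally show ?thesis by (simp only: sum_clusters[OF assms(3,4)])
qed

text \<open>The bad mass seen from a point within its cluster is at most that within
  \<open>P\<close>, so every cluster loses at most the same term with \<open>T\<close>. This is the
  source of the factor \<open>k\<close>, which later enters only through its logarithm.\<close>

lemma ccost_transfer:
  fixes u :: "'i \<Rightarrow> 'a::real_inner" and v :: "'i \<Rightarrow> 'b::real_inner"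
  assumes P: "finite P" "\<forall>x\<in>P. \<sigma> x < k"
    and p: "1 \<le> p" and \<eta>: "0 \<le> \<eta>" "\<eta> \<le> 1" and \<kappa>: "0 < \<kappa>" "\<kappa> \<le> 1" and L: "1 \<le> L"
    and a: "\<And>x. x \<in> P \<Longrightarrow> 0 \<le> a x" and T: "0 \<le> T"
    and far: "\<And>x y. x \<in> P \<Longrightarrow> y \<in> P \<Longrightarrow> contracted \<eta> u v x y \<Longrightarrow> dist (u x) (u y) \<le> L * a y"
    and mass: "\<And>x. x \<in> P \<Longrightarrow>
      (\<Sum>y | y \<in> P \<and> contracted \<eta> u v x y. a y powr p) \<le> T"
  shows "(1 - 2 * p * \<eta> - p * \<kappa>) * ccost p k P \<sigma> u - \<kappa> * (\<Sum>x\<in>P. a x powr p) - k * (p * (L/\<kappa>) powr (p+1) * T)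
     \<le> ccost p k P \<sigma> v"
proof -
  let ?I = "\<lambda>i. {x\<in>P. \<sigma> x = i}"
  have "(\<Sum>i<k. (1 - 2 * p * \<eta> - p * \<kappa>) * pcost p (?I i) u - \<kappa> * (\<Sum>x\<in>?I i. a x powr p) - p * (L/\<kappa>) powr (p+1) * T)
    \<le> ccost p k P \<sigma> v"
    unfolding ccost_def
  proof (intro sum_mono pcost_transfer p \<eta> \<kappa> L T)
    fix i x assume x: "x \<in> ?I i"
    have "(\<Sum>y | y \<in> ?I i \<and> contracted \<eta> u v x y. a y powr p) \<le>
      (\<Sum>y | y \<in> P \<and> contracted \<eta> u v x y. a y powr p)"
      by (intro sum_mono2) (use P in auto)
    also have "\<dots> \<le> T" using mass x by auto
    finally show "(\<Sum>y | y \<in> ?I i \<and> contracted \<eta> u v x y. a y powr p) \<le> T" .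
  qed (use P a far in auto)
  moreover have "(\<Sum>i<k. (1 - 2 * p * \<eta> - p * \<kappa>) * pcost p (?I i) u - \<kappa> * (\<Sum>x\<in>?I i. a x powr p) - p * (L/\<kappa>) powr (p+1) * T) =
    (1 - 2 * p * \<eta> - p * \<kappa>) * ccost p k P \<sigma> u - \<kappa> * (\<Sum>i<k. \<Sum>x\<in>?I i. a x powr p) - k * (p * (L/\<kappa>) powr (p+1) * T)"
    by (simp add: ccost_def sum_subtractf sum_distrib_left)
  ultimately show ?thesis by (simp only: sum_clusters[OF P])
qed

text \<open>Invariant under exchanging the two maps, so that a single random event serves the bounds
  in both directions.\<close>

definition quasi_iso :: "real \<Rightarrow> ('i \<Rightarrow> 'a::metric_space) \<Rightarrow> ('i \<Rightarrow> 'b::metric_space) \<Rightarrow> 'i \<Rightarrow> 'i \<Rightarrow> bool" where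
  "quasi_iso \<eta> u v x y \<longleftrightarrow> (1-\<eta>) * dist (u x) (u y) \<le> dist (v x) (v y) \<and> (1-\<eta>) * dist (v x) (v y) \<le> dist (u x) (u y)"

lemma quasi_iso_swap: "quasi_iso \<eta> u v x y \<longleftrightarrow> quasi_iso \<eta> v u x y"
  unfolding quasi_iso_def by auto

lemma quasi_iso_commute: "quasi_iso \<eta> u v x y \<longleftrightarrow> quasi_iso \<eta> u v y x"
  unfolding quasi_iso_def by (simp add: dist_commute)

lemma quasi_iso_le_double:
  assumes "quasi_iso \<eta> u v x y" "0 < \<eta>" "\<eta> \<le> 1/4"
  shows "dist (v x) (v y) \<le> 2 * dist (u x) (u y)"
proof -
  have "(1/2) * dist (v x) (v y) \<le> (1-\<eta>) * dist (v x) (v y)"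
    by (intro mult_right_mono) (use assms in auto)
  then show ?thesis using assms(1) by (simp add: quasi_iso_def)
qed

text \<open>The pairs with \<open>z\<close> lose a factor involving \<eta>, the pair of
  \<open>x\<close> and \<open>y\<close> one involving 2 \<eta>. The excess
  \<open>\<eta> * dist (u x) (u y)\<close> can only be paid for by the detour, that is by
  \<open>dist (u y) (u z)\<close>.\<close>

lemma quasi_iso_third_point:
  assumes xz: "quasi_iso \<eta> u v x z" and yz: "quasi_iso \<eta> u v y z" and \<eta>: "0 < \<eta>" "\<eta> \<le> 1/4"
    and bad: "contracted (2*\<eta>) u v x y"
  shows "dist (u x) (u y) \<le> 3/\<eta> * dist (u y) (u z)"
proof -
  have "(1-\<eta>) * dist (u x) (u y) \<le> (1-\<eta>) * dist (u x) (u z) + (1-\<eta>) * dist (u y) (u z)"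
    using mult_left_mono[OF dist_triangle[of "u x" "u y" "u z"], of "1-\<eta>"] \<eta>
    by (simp add: dist_commute algebra_simps)
  also have "\<dots> \<le> dist (v x) (v z) + 1 * dist (u y) (u z)"
    using xz \<eta> by (intro add_mono mult_right_mono) (auto simp: quasi_iso_def)
  also have "dist (v x) (v z) \<le> dist (v x) (v y) + dist (v y) (v z)" by (rule dist_triangle)
  also have "dist (v y) (v z) \<le> 2 * dist (u y) (u z)" by (rule quasi_iso_le_double[OF yz \<eta>])
  finally have "\<eta> * dist (u x) (u y) \<le> 3 * dist (u y) (u z)"
    using bad by (simp add: contracted_def algebra_simps)
  then show ?thesis using \<eta> by (simp add: field_simps)
qed

lemma powr_one_plus_le:
  fixes p e :: real
  assumes "1 \<le> p" "0 < e" "e \<le> 1"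
  shows "(1 + e / (2*p)) powr p \<le> 1 + e"
proof -
  have "(1 + e / (2*p)) powr p \<le> exp (e / (2*p)) powr p"
    using assms by (intro powr_mono2) (auto simp: exp_ge_add_one_self intro: add_nonneg_nonneg)
  also have "\<dots> = exp (e/2)" using assms by (simp add: exp_powr_real)
  also have "\<dots> \<le> 1 + e/2 + (e/2)\<^sup>2" using assms by (intro exp_bound) auto
  also have "\<dots> \<le> 1 + e/2 + e/2 * 1"
    unfolding power2_eq_square using assms by (intro add_left_mono mult_left_mono) auto
  finally show ?thesis by simp
qed

text \<open>The outlier cost is bounded in both spaces separately, because near-isometry says
  nothing about \<open>dist (v x) (v (s x))\<close> when \<open>x\<close> is an outlier.
  \<open>T\<close> and \<open>Q\<close> will be small multiples of the reference cost and hence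
  negligible for every partition.\<close>

definition outlier_set ::
  "real \<Rightarrow> ('i \<Rightarrow> 'a::metric_space) \<Rightarrow> ('i \<Rightarrow> 'b::metric_space) \<Rightarrow> 'i set \<Rightarrow> 'i set \<Rightarrow> ('i \<Rightarrow> 'i) \<Rightarrow> real \<Rightarrow> real \<Rightarrow> real \<Rightarrow> 'i set \<Rightarrow> bool"
where
  "outlier_set \<eta> u v P S s p T Q Z \<longleftrightarrow> Z \<subseteq> P \<and>
     (\<forall>x\<in>P-Z. \<forall>c\<in>S. quasi_iso \<eta> u v x c) \<and> (\<forall>c\<in>S. \<forall>c'\<in>S. quasi_iso \<eta> u v c c') \<and>
     (\<forall>x\<in>P-Z. (\<Sum>y | y \<in> P \<and> \<not> quasi_iso \<eta> u v x y. dist (u y) (u (s y)) powr p) \<le> T) \<and>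
     (\<Sum>x\<in>Z. dist (u x) (u (s x)) powr p) \<le> Q \<and> (\<Sum>x\<in>Z. dist (v x) (v (s x)) powr p) \<le> Q"

text \<open>The outliers are replaced by their centres; after that every pair which is not
  nearly isometric consists of two non-outliers that are close to each other compared with their
  distances to the centres.\<close>
lemma ccost_close:
  fixes u :: "'i \<Rightarrow> 'a::real_inner" and v :: "'i \<Rightarrow> 'b::real_inner"
  assumes P: "finite P" "\<forall>x\<in>P. \<sigma> x < k" and p: "1 \<le> p" and \<eta>: "0 < \<eta>" "\<eta> \<le> 1/4"
    and \<kappa>: "0 < \<kappa>" "\<kappa> \<le> 1" and e: "0 < e" "e \<le> 1/20" and T: "0 \<le> T"
    and s: "\<And>x. x \<in> P \<Longrightarrow> s x \<in> S" and out: "outlier_set \<eta> u v P S s p T Q Z"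
    and e1: "4 * p * \<eta> + p * \<kappa> \<le> e"
    and e2: "\<kappa> * (\<Sum>x\<in>P. dist (u x) (u (s x)) powr p) \<le> e * ccost p k P \<sigma> u"
    and e3: "k * (p * (6/\<eta>/\<kappa>) powr (p+1) * T) \<le> e * ccost p k P \<sigma> u"
    and e4: "(1 + 2*p/e) powr p * Q \<le> e * ccost p k P \<sigma> u"
  shows "(1 - 20*e) * ccost p k P \<sigma> u \<le> ccost p k P \<sigma> v" "ccost p k P \<sigma> v \<le> (1 + 20*e) * ccost p k P \<sigma> u"
proof -
  note Z = out[unfolded outlier_set_def]
  have ZP: "Z \<subseteq> P" and xS: "\<And>x c. x \<in> P - Z \<Longrightarrow> c \<in> S \<Longrightarrow> quasi_iso \<eta> u v x c"
    and SS: "\<And>c c'. c \<in> S \<Longrightarrow> c' \<in> S \<Longrightarrow> quasi_iso \<eta> u v c c'"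
    and mass: "\<And>x. x \<in> P - Z \<Longrightarrow> (\<Sum>y | y \<in> P \<and> \<not> quasi_iso \<eta> u v x y. dist (u y) (u (s y)) powr p) \<le> T"
    and Qu: "(\<Sum>x\<in>Z. dist (u x) (u (s x)) powr p) \<le> Q" and Qv: "(\<Sum>x\<in>Z. dist (v x) (v (s x)) powr p) \<le> Q"
    using Z by blast+
  define g where "g x = (if x \<in> Z then s x else x)" for x
  define r where "r x = dist (u x) (u (s x))" for x
  have g: "x \<in> P \<Longrightarrow> g x \<in> S \<union> (P - Z)" for x using s by (auto simp: g_def)
  have gS: "quasi_iso \<eta> u v (g x) c" if "x \<in> P" "c \<in> S" for x c
    using g[OF that(1)] that(2) xS SS by auto
  \<comment> \<open>If \<open>x\<close> or \<open>y\<close> were an outlier, its image under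
    \<open>g\<close> would be a centre, and every pair with a centre is nearly isometric.\<close>
  have bad: "x \<notin> Z \<and> y \<notin> Z" if "x \<in> P" "y \<in> P" "\<not> quasi_iso \<eta> u v (g x) (g y)" for x y
    using that gS s by (metis g_def quasi_iso_commute)
  have weaken: "(1-2*\<eta>) * t \<le> (1-\<eta>) * t" if "0 \<le> t" for t using \<eta> that by (intro mult_right_mono) auto
  \<comment> \<open>Contraction is measured with \<open>2 * \<eta>\<close>, twice the accuracy of
    \<open>quasi_iso\<close>, as \<open>quasi_iso_third_point\<close> requires.\<close>
  have not_q1: "\<not> quasi_iso \<eta> u v x y" if "contracted (2*\<eta>) u v x y" for x y
    using that weaken[of "dist (u x) (u y)"] unfolding quasi_iso_def contracted_def by (smt (verit) zero_le_dist)
  have not_q2: "\<not> quasi_iso \<eta> u v x y" if "contracted (2*\<eta>) v u x y" for x y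
    using that weaken[of "dist (v x) (v y)"] unfolding quasi_iso_def contracted_def by (smt (verit) zero_le_dist)
  have far1: "dist (u (g x)) (u (g y)) \<le> 6/\<eta> * r y"
    if x: "x \<in> P" "y \<in> P" and b: "contracted (2*\<eta>) u v (g x) (g y)" for x y
  proof -
    have nO: "y \<notin> Z" using bad[OF x] not_q1[OF b] by blast
    then have gy: "g y = y" by (simp add: g_def)
    have "dist (u (g x)) (u (g y)) \<le> 3/\<eta> * dist (u (g y)) (u (s y))"
      using quasi_iso_third_point[of \<eta> u v "g x" "s y" "g y"] \<eta> b gS x s by blast
    also have "\<dots> \<le> 6/\<eta> * r y" unfolding r_def gy using \<eta> by (intro mult_right_mono divide_right_mono) auto
    finally show ?thesis .
  qed
  have far2: "dist (v (g x)) (v (g y)) \<le> 6/\<eta> * r y"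
    if x: "x \<in> P" "y \<in> P" and b: "contracted (2*\<eta>) v u (g x) (g y)" for x y
  proof -
    have nO: "y \<notin> Z" using bad[OF x] not_q2[OF b] by blast
    then have gy: "g y = y" by (simp add: g_def)
    have "dist (v (g x)) (v (g y)) \<le> 3/\<eta> * dist (v (g y)) (v (s y))"
      using quasi_iso_third_point[of \<eta> v u "g x" "s y" "g y"] \<eta> b gS x s quasi_iso_swap[of \<eta> u v] by blast
    \<comment> \<open>\<open>r\<close> measures in \<open>u\<close>; the passage from
      \<open>v\<close> back to \<open>u\<close> costs a factor 2, which is why the common constant
      is \<open>6/\<eta>\<close>.\<close>
    also have "\<dots> \<le> 3/\<eta> * (2 * r y)"
      unfolding r_def gy using \<eta> quasi_iso_le_double[of \<eta> u v y "s y"] gS[of y "s y"] gy x s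
      by (intro mult_left_mono) auto
    finally show ?thesis by simp
  qed
  have mass1: "(\<Sum>y | y \<in> P \<and> R (g x) (g y). r y powr p) \<le> T"
    if x: "x \<in> P" and R: "\<And>x y. R x y \<Longrightarrow> \<not> quasi_iso \<eta> u v x y" for x and R :: "'i \<Rightarrow> 'i \<Rightarrow> bool"
  proof (cases "x \<in> Z")
    case True
    then have "{y. y \<in> P \<and> R (g x) (g y)} = {}" using bad[OF x] R by blast
    then show ?thesis using T by (simp only: sum.empty)
  next
    case False
    have "{y. y \<in> P \<and> R (g x) (g y)} \<subseteq> {y. y \<in> P \<and> \<not> quasi_iso \<eta> u v x y}"
    proof safe
      fix y assume y: "y \<in> P" "R (g x) (g y)" "quasi_iso \<eta> u v x y"
      then have "y \<notin> Z" using bad[OF x] R by blast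
      then show False using R[OF y(2)] y(3) False by (simp add: g_def)
    qed
    then have "(\<Sum>y | y \<in> P \<and> R (g x) (g y). r y powr p) \<le> (\<Sum>y | y \<in> P \<and> \<not> quasi_iso \<eta> u v x y. r y powr p)"
      by (intro sum_mono2) (use P in auto)
    also have "\<dots> \<le> T" using mass[of x] x False by (simp add: r_def)
    finally show ?thesis .
  qed
  have mass_u: "(\<Sum>y | y \<in> P \<and> contracted (2*\<eta>) u v (g x) (g y). r y powr p) \<le> T"
    if "x \<in> P" for x
    by (rule mass1[OF that, of "contracted (2*\<eta>) u v"]) (rule not_q1)
  have mass_v: "(\<Sum>y | y \<in> P \<and> contracted (2*\<eta>) v u (g x) (g y). r y powr p) \<le> T"
    if "x \<in> P" for x
    by (rule mass1[OF that, of "contracted (2*\<eta>) v u"]) (rule not_q2)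
  define A where "A = ccost p k P \<sigma> u"
  define A' where "A' = ccost p k P \<sigma> v"
  define B where "B = ccost p k P \<sigma> (\<lambda>x. u (g x))"
  define B' where "B' = ccost p k P \<sigma> (\<lambda>x. v (g x))"
  have nn: "0 \<le> A" "0 \<le> A'" "0 \<le> B" "0 \<le> B'" by (simp_all add: A_def A'_def B_def B'_def ccost_nonneg)
  have L: "1 \<le> 6/\<eta>" using \<eta> by (simp add: le_divide_eq)
  have "(1 - 2 * p * (2*\<eta>) - p * \<kappa>) * B - \<kappa> * (\<Sum>x\<in>P. r x powr p) - k * (p * (6/\<eta>/\<kappa>) powr (p+1) * T) \<le> B'"
    unfolding B_def B'_def
    by (rule ccost_transfer[OF P p _ _ \<kappa> L _ T]) (use \<eta> far1 mass_u in \<open>simp_all add: r_def contracted_def\<close>)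
  moreover have "(1 - e) * B \<le> (1 - 2 * p * (2*\<eta>) - p * \<kappa>) * B"
    using e1 nn by (intro mult_right_mono) auto
  ultimately have 1: "(1 - e) * B - 2 * (e * A) \<le> B'" using e2 e3 by (simp add: A_def r_def)
  have "(1 - 2 * p * (2*\<eta>) - p * \<kappa>) * B' - \<kappa> * (\<Sum>x\<in>P. r x powr p) - k * (p * (6/\<eta>/\<kappa>) powr (p+1) * T) \<le> B"
    unfolding B_def B'_def
    by (rule ccost_transfer[OF P p _ _ \<kappa> L _ T]) (use \<eta> far2 mass_v in \<open>simp_all add: r_def contracted_def\<close>)
  moreover have "(1 - e) * B' \<le> (1 - 2 * p * (2*\<eta>) - p * \<kappa>) * B'"
    using e1 nn by (intro mult_right_mono) auto
  ultimately have 2: "(1 - e) * B' - 2 * (e * A) \<le> B" using e2 e3 by (simp add: A_def r_def)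
  \<comment> \<open>This value gives \<open>(1 + t) powr p \<le> 1 + e\<close>, at the price of the
    factor \<open>(1 + 2*p/e) powr p\<close> provided for in \<open>e4\<close>.\<close>
  define t where "t = e / (2*p)"
  have t0: "0 < t" using e p by (simp add: t_def)
  have t1: "(1 + t) powr p \<le> 1 + e" unfolding t_def by (rule powr_one_plus_le) (use e p in auto)
  have t2: "(1 + 1/t) powr p * Q \<le> e * A" using e4 by (simp add: t_def A_def)
  have sumO: "(\<Sum>x\<in>P. dist (f x) (f (g x)) powr p) = (\<Sum>x\<in>Z. dist (f x) (f (s x)) powr p)"
    "(\<Sum>x\<in>P. dist (f (g x)) (f x) powr p) = (\<Sum>x\<in>Z. dist (f x) (f (s x)) powr p)"
    for f :: "'i \<Rightarrow> 'c::metric_space"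
    by (rule sum.mono_neutral_cong_right; use P ZP in \<open>auto simp: g_def dist_commute\<close>)+
  have pert: "X \<le> (1 + e) * Y + e * A"
    if "X \<le> (1 + t) powr p * Y + (1 + 1/t) powr p * q" "q \<le> Q" "0 \<le> Y" for X Y q
  proof -
    have "(1 + t) powr p * Y \<le> (1 + e) * Y" using t1 that by (intro mult_right_mono) auto
    moreover have "(1 + 1/t) powr p * q \<le> (1 + 1/t) powr p * Q" using that by (intro mult_left_mono) auto
    ultimately show ?thesis using that t2 by linarith
  qed
  have 3: "A \<le> (1 + e) * B + e * A"
    using pert[OF _ Qu nn(3)] ccost_perturb[OF t0 p P, of u "\<lambda>x. u (g x)"]
    unfolding sumO A_def[symmetric] B_def[symmetric] by blast
  have 4: "B \<le> (1 + e) * A + e * A"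
    using pert[OF _ Qu nn(1)] ccost_perturb[OF t0 p P, of "\<lambda>x. u (g x)" u]
    unfolding sumO A_def[symmetric] B_def[symmetric] by blast
  have 5: "A' \<le> (1 + e) * B' + e * A"
    using pert[OF _ Qv nn(4)] ccost_perturb[OF t0 p P, of v "\<lambda>x. v (g x)"]
    unfolding sumO A'_def[symmetric] B'_def[symmetric] by blast
  have 6: "B' \<le> (1 + e) * A' + e * A"
    using pert[OF _ Qv nn(2)] ccost_perturb[OF t0 p P, of "\<lambda>x. v (g x)" v]
    unfolding sumO A'_def[symmetric] B'_def[symmetric] by blast
  have eA0: "0 \<le> e * A" using e nn by simp
  \<comment> \<open>With \<open>e \<le> 1/20\<close> the second-order terms are absorbed by the
    generous factor 20 of the conclusion.\<close>
  have eA: "0 \<le> e * A" "e * (e * A) \<le> (1/20) * (e * A)"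
    using eA0 mult_right_mono[OF e(2) eA0] by auto
  have eeA: "0 \<le> e * (e * A)" using e nn by auto
  show "(1 - 20*e) * ccost p k P \<sigma> u \<le> ccost p k P \<sigma> v"
    unfolding A_def[symmetric] A'_def[symmetric]
  proof -
    have "B \<ge> (1 - 2*e) * A"
    proof -
      have "(1 + e) * ((1 - 2*e) * A) \<le> (1 + e) * B" using 3 eA eeA by (simp add: algebra_simps)
      then show ?thesis using e by simp
    qed
    then have "(1 - e) * ((1 - 2*e) * A) \<le> (1 - e) * B" using e by (intro mult_left_mono) auto
    then have "B' \<ge> (1 - 5*e) * A" using 1 eA eeA by (simp add: algebra_simps)
    then have "(1 + e) * A' \<ge> (1 - 6*e) * A" using 6 by (simp add: algebra_simps)
    moreover have "(1 - 6*e) * A \<ge> (1 + e) * ((1 - 20*e) * A)" using eA eeA by (simp add: algebra_simps)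
    ultimately have "(1 + e) * ((1 - 20*e) * A) \<le> (1 + e) * A'" by linarith
    then show "(1 - 20*e) * A \<le> A'" using e by simp
  qed
  show "ccost p k P \<sigma> v \<le> (1 + 20*e) * ccost p k P \<sigma> u"
    unfolding A_def[symmetric] A'_def[symmetric]
  proof -
    have "(1 - e) * B' \<le> (1 + 4*e) * A" using 2 4 by (simp add: algebra_simps)
    also have "\<dots> \<le> (1 - e) * ((1 + 6*e) * A)" using eA by (simp add: algebra_simps)
    finally have "B' \<le> (1 + 6*e) * A" using e by simp
    then have "(1 + e) * B' \<le> (1 + e) * ((1 + 6*e) * A)" using e by (intro mult_left_mono) auto
    then show "A' \<le> (1 + 20*e) * A" using 5 eA by (simp add: algebra_simps)
  qed
qed

section \<open>Exponential moments from analyticity\<close>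

text \<open>Pascal's rule: a difference of order \<open>Suc N\<close> is the difference of order
  \<open>N\<close> of the first difference.\<close>

lemma alternating_binomial_sum_Suc:
  fixes F :: "nat \<Rightarrow> real"
  shows "(\<Sum>j\<le>Suc N. (-1)^j * real (Suc N choose j) * F j) =
    (\<Sum>j\<le>N. (-1)^j * real (N choose j) * (F j - F (Suc j)))"
proof -
  have "(\<Sum>j\<le>N. (-1)^j * real (N choose j) * F j) = (\<Sum>j\<le>Suc N. (-1)^j * real (N choose j) * F j)"
    by (simp add: binomial_eq_0)
  also have "\<dots> = F 0 + (\<Sum>j\<le>N. (-1)^Suc j * real (N choose Suc j) * F (Suc j))"
    by (subst sum.atMost_Suc_shift) simp
  finally have 1: "(\<Sum>j\<le>N. (-1)^j * real (N choose j) * F j) = \<dots>" .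
  have "(\<Sum>j\<le>Suc N. (-1)^j * real (Suc N choose j) * F j) =
     F 0 + (\<Sum>j\<le>N. (-1)^Suc j * real (Suc N choose Suc j) * F (Suc j))"
    by (subst sum.atMost_Suc_shift) simp
  also have "\<dots> = (F 0 + (\<Sum>j\<le>N. (-1)^Suc j * real (N choose Suc j) * F (Suc j))) -
      (\<Sum>j\<le>N. (-1)^j * real (N choose j) * F (Suc j))"
    by (simp add: sum.distrib[symmetric] sum_subtractf[symmetric] sum_negf[symmetric] algebra_simps)
  finally show ?thesis unfolding 1[symmetric] by (simp add: sum_subtractf algebra_simps)
qed

text \<open>A polynomial of degree below \<open>N\<close> is annihilated by \<open>N\<close> finite
  differences, since each of them lowers the degree.\<close>

lemma alternating_binomial_power_sum:
  fixes x :: real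
  assumes "m < N"
  shows "(\<Sum>j\<le>N. (-1)^j * real (N choose j) * (x - real j)^m) = 0"
  using assms
proof (induction N arbitrary: m x)
  case (Suc N)
  have d: "y^m - (y - 1)^m = (\<Sum>l<m. - (real (m choose l) * (-1)^(m-l)) * y^l)" for y :: real
  proof -
    have "(y - 1)^m = (\<Sum>l\<le>m. real (m choose l) * y^l * (-1)^(m-l))"
      using binomial_ring[of y "-1" m] by simp
    also have "\<dots> = (\<Sum>l<m. real (m choose l) * y^l * (-1)^(m-l)) + y^m"
      by (simp flip: lessThan_Suc_atMost)
    finally show ?thesis by (simp add: sum_negf mult_ac)
  qed
  have "(\<Sum>j\<le>Suc N. (-1)^j * real (Suc N choose j) * (x - real j)^m) =
     (\<Sum>j\<le>N. (-1)^j * real (N choose j) * ((x - real j)^m - ((x - real j) - 1)^m))"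
    unfolding alternating_binomial_sum_Suc by (simp add: algebra_simps)
  also have "\<dots> = (\<Sum>j\<le>N. \<Sum>l<m. - (real (m choose l) * (-1)^(m-l)) * ((-1)^j * real (N choose j) * (x - real j)^l))"
    unfolding d by (simp add: sum_distrib_left mult_ac)
  also have "\<dots> = (\<Sum>l<m. - (real (m choose l) * (-1)^(m-l)) * (\<Sum>j\<le>N. (-1)^j * real (N choose j) * (x - real j)^l))"
    by (subst sum.swap) (simp add: sum_distrib_left)
  also have "\<dots> = 0" using Suc by (intro sum.neutral) auto
  finally show ?case .
qed simp

text \<open>With z = exp (i \<theta>) one has (1 - z)^2 = - z (2 - 2 cos \<theta>), so the power is,
  up to sign, the centred binomial expansion of (1 - z)^(2n): a central difference of order 2n of
  the cosine.\<close>

lemma two_minus_two_cos_power: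
  fixes \<theta> :: real
  shows
  "(2 - 2 * cos \<theta>)^n = (-1)^n * (\<Sum>j\<le>2*n. (-1)^j * real (2*n choose j) * cos ((real n - real j) * \<theta>))"
proof -
  let ?z = "cis \<theta>"
  have "(1 - ?z)^2 = - ?z * of_real (2 - 2 * cos \<theta>)"
  proof -
    have "(1 - ?z)^2 = - ?z * (2 - (?z + cis (-\<theta>)))"
      by (simp add: power2_eq_square algebra_simps cis_mult)
    also have "?z + cis (-\<theta>) = of_real (2 * cos \<theta>)" by (simp add: complex_eq_iff)
    finally show ?thesis by simp
  qed
  also have "- ?z * of_real (2 - 2 * cos \<theta>) = (-1) * ?z * of_real (2 - 2 * cos \<theta>)" by simp
  finally have "((1 - ?z)^2)^n = ((-1) * ?z * of_real (2 - 2 * cos \<theta>))^n" by (rule arg_cong)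
  then have 1: "(1 - ?z)^(2*n) = (-1)^n * ?z^n * of_real ((2 - 2 * cos \<theta>)^n)"
    by (simp only: power_mult power_mult_distrib of_real_power)
  have 2: "cis (- (real n * \<theta>)) * ?z^n = 1" by (simp only: Complex.DeMoivre cis_mult) simp
  have 3: "(-1)^n * (-1)^n = (1::complex)" by (simp flip: power_mult_distrib)
  have "(-1)^n * (cis (- (real n * \<theta>)) * (1 - ?z)^(2*n)) =
      ((-1)^n * (-1)^n) * (cis (- (real n * \<theta>)) * ?z^n) * of_real ((2 - 2 * cos \<theta>)^n)"
    unfolding 1 by (simp only: ac_simps)
  then have 4: "of_real ((2 - 2 * cos \<theta>)^n) = (-1)^n * (cis (- (real n * \<theta>)) * (1 - ?z)^(2*n))"
    unfolding 2 3 by simp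
  have 5: "(1 - ?z)^(2*n) = (\<Sum>j\<le>2*n. of_nat (2*n choose j) * (-?z)^j)"
    using binomial_ring[of "-?z" 1 "2*n"] by simp
  have 6: "cis (- (real n * \<theta>)) * (of_nat (2*n choose j) * (-?z)^j) =
      (-1)^j * of_nat (2*n choose j) * cis ((real j - real n) * \<theta>)" for j
  proof -
    have a: "(-?z)^j = (-1)^j * cis (real j * \<theta>)"
      using power_mult_distrib[of "-1" ?z j] by (simp only: Complex.DeMoivre) simp
    have b: "cis (- (real n * \<theta>)) * cis (real j * \<theta>) = cis ((real j - real n) * \<theta>)"
      by (simp add: cis_mult algebra_simps)
    have "cis (- (real n * \<theta>)) * (of_nat (2*n choose j) * (-?z)^j) =
      (-1)^j * of_nat (2*n choose j) * (cis (- (real n * \<theta>)) * cis (real j * \<theta>))"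
      unfolding a by (simp only: ac_simps)
    then show ?thesis unfolding b .
  qed
  have 7: "complex_of_real ((-1)^n) = (-1)^n" "complex_of_real ((-1)^j * real (2*n choose j)) = (-1)^j * of_nat (2*n choose j)" for j
    by simp_all
  have "complex_of_real ((2 - 2 * cos \<theta>)^n) =
     complex_of_real ((-1)^n) * (\<Sum>j\<le>2*n. of_real ((-1)^j * real (2*n choose j)) * cis ((real j - real n) * \<theta>))"
    by (simp only: 4 5 sum_distrib_left 6 7)
  then have "Re (complex_of_real ((2 - 2 * cos \<theta>)^n)) =
     Re (complex_of_real ((-1)^n) * (\<Sum>j\<le>2*n. of_real ((-1)^j * real (2*n choose j)) * cis ((real j - real n) * \<theta>)))"
    by (rule arg_cong)
  then have 8: "(2 - 2 * cos \<theta>)^n = (-1)^n * (\<Sum>j\<le>2*n. (-1)^j * real (2*n choose j) * cos ((real j - real n) * \<theta>))"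
    by (simp only: Re_complex_of_real Im_complex_of_real times_complex.sel Re_sum cis.sel mult_zero_left diff_0_right)
  have "cos ((real j - real n) * \<theta>) = cos ((real n - real j) * \<theta>)" for j
    using cos_minus[of "(real j - real n) * \<theta>"] by (simp add: algebra_simps)
  with 8 show ?thesis by (simp only:)
qed

context prob_space
begin

text \<open>The expectation is, up to sign, a central difference of order \<open>2 * n\<close> of
  the power series. Terms of degree below \<open>2 * n\<close> cancel; the remainder at arguments up
  to \<open>r / 4\<close> is at most \<open>2 * A / 16^n\<close>, and the binomial coefficients sum
  to \<open>4^n\<close>.\<close>

lemma expectation_cos_power_bound:
  fixes X :: "'a \<Rightarrow> real"
  assumes X[measurable]: "X \<in> borel_measurable M" and r: "0 < r"
    and f: "\<And>t. \<bar>t\<bar> \<le> r \<Longrightarrow> (\<lambda>n. a n * t^n) sums expectation (\<lambda>\<omega>. cos (t * X \<omega>))"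
    and A: "\<And>n. \<bar>a n\<bar> * r^n \<le> A"
    and t: "0 \<le> t" "n * t \<le> r / 4"
  shows "expectation (\<lambda>\<omega>. (2 - 2 * cos (t * X \<omega>))^n) \<le> 2 * A / 4^n"
proof -
  define f where "f t = expectation (\<lambda>\<omega>. cos (t * X \<omega>))" for t
  define R where "R x = (\<Sum>m. a (m + 2*n) * x^(m + 2*n))" for x
  have A0: "0 \<le> A" using A[of 0] abs_ge_zero[of "a 0"] by simp
  have f_eq: "f x = R x + (\<Sum>m<2*n. a m * x^m)" and Rb: "\<bar>R x\<bar> \<le> 2 * A / 16^n" if "\<bar>x\<bar> \<le> r/4" for x
  proof -
    have s: "(\<lambda>n. a n * x^n) sums f x" unfolding f_def by (rule f) (use that r in auto)
    show "f x = R x + (\<Sum>m<2*n. a m * x^m)"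
      unfolding R_def using suminf_split_initial_segment[OF sums_summable[OF s], of "2*n"] sums_unique[OF s] by simp
    have b: "\<bar>a (m + 2*n) * x^(m + 2*n)\<bar> \<le> A / 16^n * (1/2)^m" for m
    proof -
      have "\<bar>a (m + 2*n) * x^(m + 2*n)\<bar> \<le> \<bar>a (m + 2*n)\<bar> * (r/4)^(m + 2*n)"
        unfolding abs_mult power_abs by (intro mult_left_mono power_mono) (use that in auto)
      also have "\<dots> = (\<bar>a (m + 2*n)\<bar> * r^(m + 2*n)) * (1/4)^(m + 2*n)" by (simp add: power_divide)
      also have "\<dots> \<le> A * (1/4)^(m + 2*n)" by (intro mult_right_mono A) auto
      also have "\<dots> = A / 16^n * (1/4)^m" by (simp add: power_add power_mult power_divide)
      also have "\<dots> \<le> A / 16^n * (1/2)^m" by (intro mult_left_mono power_mono) (use A0 in auto)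
      finally show ?thesis .
    qed
    have g: "summable (\<lambda>m. A / 16^n * (1/2)^m)" by (intro summable_mult summable_geometric) auto
    have "\<bar>R x\<bar> \<le> (\<Sum>m. A / 16^n * (1/2)^m)"
      unfolding R_def real_norm_def[symmetric] by (rule norm_suminf_le[OF _ g]) (use b in auto)
    also have "\<dots> = 2 * A / 16^n" by (subst suminf_mult) (auto simp: suminf_geometric summable_geometric)
    finally show "\<bar>R x\<bar> \<le> 2 * A / 16^n" .
  qed
  define c where "c j = (-1)^j * real (2*n choose j)" for j :: nat
  define x where "x j = (real n - real j) * t" for j :: nat
  have xb: "\<bar>x j\<bar> \<le> r/4" if "j \<le> 2*n" for j
  proof -
    have "\<bar>x j\<bar> = \<bar>real n - real j\<bar> * t" using t by (simp add: x_def abs_mult)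
    also have "\<dots> \<le> n * t" by (intro mult_right_mono) (use that t in \<open>auto simp: abs_le_iff\<close>)
    finally show ?thesis using t by simp
  qed
  have int: "integrable M (\<lambda>\<omega>. cos (y * X \<omega>))" for y
    by (rule integrable_const_bound[of _ 1]) auto
  have "expectation (\<lambda>\<omega>. (2 - 2 * cos (t * X \<omega>))^n) = expectation (\<lambda>\<omega>. (-1)^n * (\<Sum>j\<le>2*n. c j * cos (x j * X \<omega>)))"
    by (simp add: two_minus_two_cos_power c_def x_def mult.assoc)
  also have "\<dots> = (-1)^n * (\<Sum>j\<le>2*n. c j * f (x j))"
    using int by (simp add: f_def)
  also have "(\<Sum>j\<le>2*n. c j * f (x j)) = (\<Sum>j\<le>2*n. c j * R (x j)) + (\<Sum>j\<le>2*n. \<Sum>m<2*n. c j * (a m * x j^m))"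
    unfolding sum.distrib[symmetric]
    by (intro sum.cong) (auto simp: f_eq[OF xb] distrib_left sum_distrib_left)
  also have "(\<Sum>j\<le>2*n. \<Sum>m<2*n. c j * (a m * x j^m)) = (\<Sum>m<2*n. a m * t^m * (\<Sum>j\<le>2*n. c j * (real n - real j)^m))"
    by (subst sum.swap) (simp add: x_def sum_distrib_left power_mult_distrib mult_ac)
  also have "\<dots> = 0" unfolding c_def by (simp add: alternating_binomial_power_sum)
  finally have "expectation (\<lambda>\<omega>. (2 - 2 * cos (t * X \<omega>))^n) = (-1)^n * (\<Sum>j\<le>2*n. c j * R (x j))"
    by (simp only: add_0_right)
  also have "\<dots> \<le> \<bar>(-1)^n * (\<Sum>j\<le>2*n. c j * R (x j))\<bar>" by simp
  also have "\<dots> = \<bar>\<Sum>j\<le>2*n. c j * R (x j)\<bar>" by (simp add: abs_mult)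
  also have "\<dots> \<le> (\<Sum>j\<le>2*n. real (2*n choose j) * (2 * A / 16^n))"
  proof (intro order_trans[OF sum_abs] sum_mono)
    fix j assume "j \<in> {..2*n}"
    then have "real (2*n choose j) * \<bar>R (x j)\<bar> \<le> real (2*n choose j) * (2 * A / 16^n)"
      by (intro mult_left_mono Rb xb) auto
    then show "\<bar>c j * R (x j)\<bar> \<le> real (2*n choose j) * (2 * A / 16^n)"
      by (simp add: abs_mult c_def)
  qed
  also have "\<dots> = real (\<Sum>j\<le>2*n. 2*n choose j) * (2 * A / 16^n)" unfolding of_nat_sum sum_distrib_right ..
  also have "(\<Sum>j\<le>2*n. 2*n choose j) = 4^n" using choose_row_sum[of "2*n"] by (simp add: power_mult)
  also have "(16::real)^n = 4^n * 4^n" using power_mult_distrib[of "4::real" 4 n] by simp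
  finally show ?thesis by simp
qed

text \<open>\<open>(2 - 2 * cos (t n * X \<omega>))^n\<close> is at least 1 where
  \<open>\<bar>X \<omega>\<bar>\<close> is comparable to \<open>n\<close>, so \<open>2^n\<close>
  times it dominates an exponential there. Its expectation decays like \<open>4^(-n)\<close>, which
  leaves a convergent geometric series.\<close>

lemma exp_moment_of_power_series:
  fixes X :: "'a \<Rightarrow> real"
  assumes X[measurable]: "X \<in> borel_measurable M" and e: "0 < e"
    and f: "\<And>t. \<bar>t\<bar> < e \<Longrightarrow> (\<lambda>n. a n * t^n) sums expectation (\<lambda>\<omega>. cos (t * X \<omega>))"
  shows "\<exists>s>0. integrable M (\<lambda>\<omega>. exp (s * \<bar>X \<omega>\<bar>))"
proof -
  \<comment> \<open>Strictly inside the interval of convergence, where the terms of the series are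
    bounded.\<close>
  define r where "r = e / 2"
  have r: "0 < r" using e by (simp add: r_def)
  have "summable (\<lambda>n. a n * r^n)" using f[of r] e by (auto simp: r_def sums_iff)
  then have "Bseq (\<lambda>n. a n * r^n)" by (rule summable_imp_Bseq)
  then obtain A0 where A0: "\<And>n. norm (a n * r^n) \<le> A0" by (auto simp: Bseq_def)
  define A where "A = max A0 1"
  have A: "\<bar>a n\<bar> * r^n \<le> A" for n using A0[of n] r by (simp add: A_def abs_mult)
  define t where "t n = r / (4 * real n)" for n :: nat
  define H where "H n \<omega> = 2^n * (2 - 2 * cos (t n * X \<omega>))^n" for n \<omega>
  have H0: "0 \<le> H n \<omega>" for n \<omega> by (simp add: H_def)
  have intH: "integrable M (H n)" for n
  proof (rule integrable_const_bound[of _ "2^n * 4^n"])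
    have "\<bar>2 - 2 * cos x\<bar> \<le> 4" for x :: real using cos_ge_minus_one[of x] cos_le_one[of x] by linarith
    then show "AE \<omega> in M. norm (H n \<omega>) \<le> 2^n * 4^n"
      by (auto simp: H_def abs_mult power_abs intro!: mult_left_mono power_mono)
  qed (unfold H_def, measurable)
  have EH: "expectation (H n) \<le> 2 * A * (1/2)^n" for n
  proof -
    have "expectation (H n) = 2^n * expectation (\<lambda>\<omega>. (2 - 2 * cos (t n * X \<omega>))^n)"
      by (simp add: H_def[abs_def])
    also have "\<dots> \<le> 2^n * (2 * A / 4^n)"
      by (intro mult_left_mono expectation_cos_power_bound[OF X r _ A])
        (use f e r in \<open>auto simp: t_def r_def\<close>)
    also have "(4::real)^n = 2^n * 2^n" using power_mult_distrib[of "2::real" 2 n] by simp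
    also have "2^n * (2 * A / (2^n * 2^n)) = 2 * A * (1/2)^n" by (simp add: power_one_over field_simps)
    finally show ?thesis .
  qed
  \<comment> \<open>Chosen so that \<open>t n * (n * u) = pi / 3\<close> for positive
    \<open>n\<close>. If \<open>n\<close> is the integer part of
    \<open>\<bar>X \<omega>\<bar> / u\<close> and not 0, then
    \<open>t n * \<bar>X \<omega>\<bar>\<close> lies between \<open>pi / 3\<close> and
    \<open>pi\<close>, where the cosine is at most 1/2.\<close>
  define u where "u = 4 * pi / (3 * r)"
  have u: "0 < u" using r by (simp add: u_def)
  define s where "s = ln 2 / u"
  have s: "0 < s" using u by (simp add: s_def)
  have point: "ennreal (exp (s * \<bar>X \<omega>\<bar>)) \<le> 2 * (\<Sum>n. ennreal (H n \<omega>))" for \<omega>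
  proof -
    define n where "n = nat \<lfloor>\<bar>X \<omega>\<bar> / u\<rfloor>"
    have n1: "real n \<le> \<bar>X \<omega>\<bar> / u" and n2: "\<bar>X \<omega>\<bar> / u \<le> real n + 1"
      using u by (auto simp: n_def)
    have "exp (s * \<bar>X \<omega>\<bar>) = 2 powr (\<bar>X \<omega>\<bar> / u)" by (simp add: powr_def s_def)
    also have "\<dots> \<le> 2 powr (real (Suc n))" using n2 by (intro powr_mono) auto
    also have "\<dots> = 2 * 2^n" by (simp only: powr_realpow) simp
    also have "\<dots> \<le> 2 * H n \<omega>"
    proof (cases "n = 0")
      case False
      have tX: "t n * \<bar>X \<omega>\<bar> = (pi/3) * (\<bar>X \<omega>\<bar> / u) / n"
        using r u False by (simp add: t_def u_def field_simps)
      have "pi/3 \<le> t n * \<bar>X \<omega>\<bar>"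
        unfolding tX by (subst pos_le_divide_eq) (use False n1 in \<open>auto intro!: mult_left_mono simp del: times_divide_eq_right times_divide_eq_left\<close>)
      moreover have "t n * \<bar>X \<omega>\<bar> \<le> pi"
      proof -
        have "\<bar>X \<omega>\<bar> / u \<le> 3 * real n" using n2 False by simp
        then have "(pi/3) * (\<bar>X \<omega>\<bar> / u) \<le> (pi/3) * (3 * real n)" by (intro mult_left_mono) auto
        also have "\<dots> = pi * real n" by simp
        finally have le: "(pi/3) * (\<bar>X \<omega>\<bar> / u) \<le> pi * real n" .
        show ?thesis unfolding tX
          by (subst pos_divide_le_eq) (use False in simp, rule le)
      qed
      ultimately have "cos (t n * \<bar>X \<omega>\<bar>) \<le> cos (pi/3)" by (intro cos_monotone_0_pi_le) auto
      moreover have "cos (t n * \<bar>X \<omega>\<bar>) = cos (t n * X \<omega>)" by (cases "X \<omega> \<ge> 0") auto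
      ultimately have "1 \<le> 2 - 2 * cos (t n * X \<omega>)" by (simp add: cos_60)
      then have "1 \<le> (2 - 2 * cos (t n * X \<omega>))^n" by (rule one_le_power)
      then show ?thesis by (simp add: H_def)
    qed (simp add: H_def)
    finally have "ennreal (exp (s * \<bar>X \<omega>\<bar>)) \<le> 2 * ennreal (H n \<omega>)"
      by (metis ennreal_leI ennreal_mult' ennreal_numeral zero_le_numeral)
    also have "ennreal (H n \<omega>) \<le> (\<Sum>n. ennreal (H n \<omega>))"
      using sum_le_suminf[of "\<lambda>n. ennreal (H n \<omega>)" "{n}"] by simp
    finally show ?thesis by (simp add: mult_left_mono)
  qed
  have "(\<integral>\<^sup>+ \<omega>. ennreal (exp (s * \<bar>X \<omega>\<bar>)) \<partial>M) \<le> (\<integral>\<^sup>+ \<omega>. 2 * (\<Sum>n. ennreal (H n \<omega>)) \<partial>M)"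
    by (intro nn_integral_mono point)
  also have "\<dots> = 2 * (\<Sum>n. \<integral>\<^sup>+ \<omega>. ennreal (H n \<omega>) \<partial>M)"
    by (simp add: nn_integral_cmult nn_integral_suminf H_def)
  also have "(\<Sum>n. \<integral>\<^sup>+ \<omega>. ennreal (H n \<omega>) \<partial>M) = (\<Sum>n. ennreal (expectation (H n)))"
    by (intro suminf_cong nn_integral_eq_integral intH) (use H0 in auto)
  also have "\<dots> \<le> (\<Sum>n. ennreal (2 * A * (1/2)^n))"
    by (intro suminf_le ennreal_leI EH) auto
  also have "\<dots> = ennreal (\<Sum>n. 2 * A * (1/2)^n)"
    by (intro suminf_ennreal2 summable_mult summable_geometric) (auto simp: A_def)
  finally have "(\<integral>\<^sup>+ \<omega>. ennreal (exp (s * \<bar>X \<omega>\<bar>)) \<partial>M) \<le> 2 * ennreal (\<Sum>n. 2 * A * (1/2)^n)"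
    by (simp add: mult_left_mono)
  also have "\<dots> < \<infinity>" by (simp add: ennreal_mult_less_top)
  finally have "integrable M (\<lambda>\<omega>. exp (s * \<bar>X \<omega>\<bar>))"
    by (intro integrableI_nonneg) auto
  with s show ?thesis by blast
qed

end

text \<open>On a coordinate axis all monomials that involve another coordinate vanish, so the
  unordered sum over multi-indices collapses to an ordinary power series. Series along the axes are
  enough, because the norm is controlled by the components.\<close>

lemma analytic_at_origin_axis:
  fixes K :: "real^'d \<Rightarrow> real"
  assumes "analytic_at_origin K"
  shows "\<exists>e>0. \<exists>a. \<forall>t. \<bar>t\<bar> < e \<longrightarrow> (\<lambda>n. a n * t^n) sums K (t *\<^sub>R axis i 1)"
proof -
  obtain r where r: "0 < r" "real_analytic_on K {x. (\<Sum>i\<in>UNIV. \<bar>x$i\<bar>) < r}"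
    using assms by (auto simp: analytic_at_origin_def)
  then have "\<exists>e>0. \<exists>c::('d \<Rightarrow> nat) \<Rightarrow> real. \<forall>x::real^'d. (\<Sum>i\<in>UNIV. \<bar>x$i - 0$i\<bar>) < e \<longrightarrow>
     ((\<lambda>\<alpha>. c \<alpha> * (\<Prod>i\<in>UNIV. (x$i - 0$i) ^ \<alpha> i)) has_sum K x) UNIV"
    unfolding real_analytic_on_def by (elim ballE[of _ _ 0]) auto
  then obtain e and c :: "('d \<Rightarrow> nat) \<Rightarrow> real" where e: "0 < e" and
    c: "\<And>x::real^'d. (\<Sum>i\<in>UNIV. \<bar>x$i\<bar>) < e \<Longrightarrow> ((\<lambda>\<alpha>. c \<alpha> * (\<Prod>i\<in>UNIV. (x$i) ^ \<alpha> i)) has_sum K x) UNIV"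
    by auto
  define h where "h n = (\<lambda>j. if j = i then n else 0)" for n :: nat
  have h: "inj h" by (intro injI) (metis h_def)
  have "(\<lambda>n. c (h n) * t^n) sums K (t *\<^sub>R axis i 1)" if t: "\<bar>t\<bar> < e" for t
  proof -
    define x where "x = t *\<^sub>R axis i (1::real)"
    have x: "x $ j = (if j = i then t else 0)" for j by (simp add: x_def axis_def)
    have "(\<Sum>j\<in>UNIV. \<bar>x$j\<bar>) = (\<Sum>j\<in>UNIV. if j = i then \<bar>t\<bar> else 0)" by (intro sum.cong) (auto simp: x)
    then have "(\<Sum>j\<in>UNIV. \<bar>x$j\<bar>) < e" using t by simp
    from c[OF this] have "((\<lambda>\<alpha>. c \<alpha> * (\<Prod>j\<in>UNIV. (x$j) ^ \<alpha> j)) has_sum K x) UNIV" .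
    moreover have "c \<alpha> * (\<Prod>j\<in>UNIV. (x$j) ^ \<alpha> j) = 0" if "\<alpha> \<notin> range h" for \<alpha>
    proof -
      have "\<exists>j. j \<noteq> i \<and> \<alpha> j \<noteq> 0"
      proof (rule ccontr)
        assume "\<not> ?thesis"
        then have "\<alpha> = h (\<alpha> i)" by (intro ext) (auto simp: h_def)
        then show False using that by blast
      qed
      then obtain j where "j \<noteq> i" "\<alpha> j \<noteq> 0" by blast
      then have "(\<Prod>j\<in>UNIV. (x$j) ^ \<alpha> j) = 0" by (intro prod_zero bexI[of _ j]) (auto simp: x)
      then show ?thesis by simp
    qed
    ultimately have "((\<lambda>\<alpha>. c \<alpha> * (\<Prod>j\<in>UNIV. (x$j) ^ \<alpha> j)) has_sum K x) (range h)"
      using has_sum_cong_neutral[of "range h" UNIV "\<lambda>\<alpha>. c \<alpha> * (\<Prod>j\<in>UNIV. (x$j) ^ \<alpha> j)" "\<lambda>\<alpha>. c \<alpha> * (\<Prod>j\<in>UNIV. (x$j) ^ \<alpha> j)" "K x"]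
      by simp
    then have "((\<lambda>\<alpha>. c \<alpha> * (\<Prod>j\<in>UNIV. (x$j) ^ \<alpha> j)) \<circ> h has_sum K x) UNIV"
      by (simp add: has_sum_reindex[OF h])
    moreover have "(\<Prod>j\<in>UNIV. (x$j) ^ h n j) = t^n" for n
    proof -
      have "(\<Prod>j\<in>UNIV. (x$j) ^ h n j) = (\<Prod>j\<in>UNIV. if j = i then t^n else 1)"
        by (intro prod.cong) (auto simp: x h_def)
      then show ?thesis by simp
    qed
    ultimately have "((\<lambda>n. c (h n) * t^n) has_sum K x) UNIV" by (simp add: o_def)
    then show ?thesis unfolding x_def by (rule has_sum_imp_sums)
  qed
  then show ?thesis using e by (intro exI[of _ e] conjI exI[of _ "\<lambda>n. c (h n)"] allI impI)
qed

section \<open>Lower bound on the kernel distance\<close>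

text \<open>The factor 4 is that of \<open>(norm z)\<^sup>2\<close> when \<open>z\<close> is
  doubled, which lets a quadratic lower bound propagate towards 0.\<close>

lemma one_minus_cos_double_le: "1 - cos (2 * x) \<le> 4 * (1 - cos x)" for x :: real
proof -
  have "1 - cos (2 * x) = 2 * ((1 - cos x) * (1 + cos x))"
    using cos_double_cos[of x] by (simp add: algebra_simps power2_eq_square)
  also have "\<dots> \<le> 2 * ((1 - cos x) * 2)"
    using cos_le_one[of x] by (intro mult_left_mono) auto
  finally show ?thesis by simp
qed

lemma one_minus_cos_le: "1 - cos x \<le> x\<^sup>2 / 2" for x :: real
proof -
  have "1 - cos x = 2 * (sin (x/2))\<^sup>2" using cos_double_sin[of "x/2"] by simp
  also have "(sin (x/2))\<^sup>2 = \<bar>sin (x/2)\<bar>\<^sup>2" by simp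
  also have "\<dots> \<le> \<bar>x/2\<bar>\<^sup>2" by (intro power_mono abs_sin_x_le_abs_x) auto
  finally show ?thesis by (simp add: power2_eq_square)
qed

section \<open>Distant points: translates of a set of positive measure\<close>

lemma superlevel_compact_exists:
  fixes g :: "'a::euclidean_space \<Rightarrow> real"
  assumes g: "g \<in> borel_measurable lborel" "\<And>x. 0 \<le> g x" and nz: "integral\<^sup>L lborel g \<noteq> 0"
  shows "\<exists>C a. compact C \<and> 0 < measure lborel C \<and> 0 < a \<and> (\<forall>x\<in>C. a \<le> g x)"
proof -
  have [measurable]: "g \<in> borel_measurable borel" using g(1) by simp
  define A where "A n = {x. 1 / real (Suc n) \<le> g x \<and> norm x \<le> real n}" for n
  have A[measurable]: "A n \<in> sets borel" for n unfolding A_def by measurable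
  have "\<exists>n. emeasure lborel (A n) \<noteq> 0"
  proof (rule ccontr)
    assume "\<not> ?thesis"
    then have "\<And>n. A n \<in> null_sets lborel" using A by auto
    then have "(\<Union>n. A n) \<in> null_sets lborel" by (rule null_sets_UN)
    moreover have "{x \<in> space lborel. g x \<noteq> 0} \<subseteq> (\<Union>n. A n)"
    proof
      fix x assume "x \<in> {x \<in> space lborel. g x \<noteq> 0}"
      then have x: "0 < g x" using g(2)[of x] by simp
      obtain k where k: "1 / real (Suc k) < g x" using x reals_Archimedean by (metis inverse_eq_divide)
      obtain l where l: "norm x \<le> real l" using real_arch_simple by blast
      have "1 / real (Suc (max k l)) \<le> 1 / real (Suc k)" by (intro divide_left_mono) auto
      then have "x \<in> A (max k l)" using k l unfolding A_def by simp
      then show "x \<in> (\<Union>n. A n)" by blast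
    qed
    ultimately have "AE x in lborel. g x = 0" by (intro AE_I') auto
    then have "integral\<^sup>L lborel g = 0" by (simp add: integral_eq_zero_AE)
    then show False using nz by simp
  qed
  then obtain n where n: "emeasure lborel (A n) \<noteq> 0" by blast
  have bA: "bounded (A n)" by (intro boundedI[of _ "real n"]) (auto simp: A_def)
  then have fin: "emeasure lborel (A n) < \<infinity>" by (rule emeasure_bounded_finite)
  define m where "m = measure lborel (A n)"
  have em: "emeasure lborel (A n) = ennreal m" using fin by (simp add: m_def emeasure_eq_ennreal_measure less_top)
  then have m: "0 < m" using n by (metis ennreal_eq_0_iff not_le)
  \<comment> \<open>Inner regularity replaces the superlevel set by a compact subset, losing less
    than the whole measure.\<close>
  obtain C where C: "closed C" "C \<subseteq> A n" "emeasure lebesgue (A n - C) < ennreal m"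
    using sets_lebesgue_inner_closed[of "A n" m] m by (metis A sets_completionI_sets sets_lborel)
  have "compact C" using C bA by (auto simp: compact_eq_bounded_closed intro: bounded_subset)
  have Cm[measurable]: "C \<in> sets borel" using C by simp
  have "0 < measure lborel C"
  proof (rule ccontr)
    assume "\<not> ?thesis"
    then have "measure lborel C = 0" by (simp add: not_less measure_le_0_iff)
    moreover have "emeasure lborel C < \<infinity>" using \<open>compact C\<close> by (intro emeasure_bounded_finite compact_imp_bounded)
    ultimately have "emeasure lborel C = 0" by (simp add: emeasure_eq_ennreal_measure less_top)
    then have "emeasure lborel (A n - C) = emeasure lborel (A n)"
      using emeasure_Diff_null_set[of C lborel "A n"] by (auto simp: null_sets_def)
    then show False using C(3) em by (simp add: emeasure_completion)
  qed
  moreover have "0 < 1 / real (Suc n)" by simp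
  moreover have "\<forall>x\<in>C. 1 / real (Suc n) \<le> g x" using C(2) by (auto simp: A_def)
  ultimately show ?thesis using \<open>compact C\<close> by blast
qed

lemma measure_lborel_translation_vimage:
  fixes S :: "'a::euclidean_space set"
  assumes [measurable]: "S \<in> sets borel"
  shows "measure lborel {x. x - h \<in> S} = measure lborel S"
proof -
  have "measure lborel S = measure (distr lborel borel ((+) (-h))) S" by (simp add: lborel_distr_plus)
  also have "\<dots> = measure lborel {x. x - h \<in> S}"
    by (subst measure_distr) (auto simp: vimage_def algebra_simps)
  finally show ?thesis ..
qed

text \<open>An open \<open>U\<close> of measure at most 3/2 times that of \<open>C\<close> contains
  \<open>C\<close> and, by compactness, all its small translates. Two subsets of equal measure
  \<open>m\<close> in \<open>U\<close> overlap in at least \<open>m / 2\<close>. This is a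
  quantitative form of Steinhaus' theorem.\<close>

lemma compact_translate_overlap:
  fixes C :: "'a::euclidean_space set"
  assumes C: "compact C" "0 < measure lborel C"
  shows "\<exists>r>0. \<forall>h. norm h \<le> r \<longrightarrow> measure lborel C / 2 \<le> measure lborel (C \<inter> {x. x - h \<in> C})"
proof -
  define m where "m = measure lborel C"
  have [measurable]: "C \<in> sets borel" using C by (simp add: borel_compact)
  have fC: "emeasure lborel C < \<infinity>" using C by (intro emeasure_bounded_finite compact_imp_bounded)
  have fmC: "C \<in> fmeasurable lborel" using fC by (intro fmeasurableI) auto
  obtain U where U: "open U" "C \<subseteq> U" "emeasure lborel (U - C) < ennreal (m/2)"
    using outer_regular_lborel[of C "m/2"] C by (auto simp: m_def)
  have [measurable]: "U \<in> sets borel" using U by simp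
  have fmUC: "U - C \<in> fmeasurable lborel" using U(3) by (intro fmeasurableI) (auto intro: less_trans[OF _ ennreal_less_top])
  have fmU: "U \<in> fmeasurable lborel"
    using fmeasurable.Un[OF fmUC fmC] U(2) by (simp add: Un_absorb2)
  have "measure lborel (U - C) \<le> m/2"
    using U(3) fmUC C by (metis emeasure_eq_measure2 ennreal_le_iff fmeasurableD2 less_imp_le m_def measure_nonneg half_gt_zero emeasure_eq_ennreal_measure)
  then have mU: "measure lborel U \<le> 3/2 * m"
    using measure_Un_le[of "U - C" lborel C] U(2) by (simp add: Un_absorb2 m_def)
  have "C \<noteq> {}" using C by auto
  then obtain r where r: "0 < r" "{x. infdist x C \<le> r} \<subseteq> U"
    using compact_in_open_separated[OF _ C(1) U(1,2)] by blast
  have "m / 2 \<le> measure lborel (C \<inter> {x. x - h \<in> C})" if h: "norm h \<le> r" for h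
  proof -
    let ?T = "{x. x - h \<in> C}"
    have T[measurable]: "?T \<in> sets borel" by measurable
    have "?T \<subseteq> U"
    proof
      fix x assume "x \<in> ?T"
      then have "infdist x C \<le> dist x (x - h)" by (intro infdist_le) auto
      then show "x \<in> U" using h r(2) by (auto simp: dist_norm)
    qed
    then have sub: "C \<union> ?T \<subseteq> U" using U by auto
    have fmT: "?T \<in> fmeasurable lborel" by (rule fmeasurableI2[OF fmU]) (use \<open>?T \<subseteq> U\<close> in auto)
    have "measure lborel C + measure lborel ?T = measure lborel (C \<union> ?T) + measure lborel (C \<inter> ?T)"
      using measure_Un3[OF fmC fmT] by simp
    moreover have "measure lborel (C \<union> ?T) \<le> measure lborel U"
      by (intro measure_mono_fmeasurable sub fmU) auto
    ultimately show ?thesis using mU measure_lborel_translation_vimage[of C h] by (simp add: m_def)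
  qed
  then show ?thesis using r(1) by (auto simp: m_def)
qed

text \<open>A substitute for the Riemann-Lebesgue lemma. A shift by \<open>h\<close> with
  \<open>h \<bullet> z = pi\<close> reverses the sign of the cosine, so the values of one minus
  cosine at \<open>x\<close> and \<open>x - h\<close> add up to 2. For large \<open>z\<close> this
  shift is short, and a set where \<open>g\<close> is bounded below overlaps its translate.\<close>

lemma integral_one_minus_cos_far:
  fixes g :: "'a::euclidean_space \<Rightarrow> real"
  assumes g: "integrable lborel g" "\<And>x. 0 \<le> g x" and nz: "integral\<^sup>L lborel g \<noteq> 0"
  shows "\<exists>R c. 0 < R \<and> 0 < c \<and> (\<forall>z. R \<le> norm z \<longrightarrow> c \<le> (LINT x|lborel. g x * (1 - cos (x \<bullet> z))))"
proof -
  obtain C a where C: "compact C" "0 < measure lborel C" and a: "0 < a" "\<And>x. x \<in> C \<Longrightarrow> a \<le> g x"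
    using superlevel_compact_exists[OF _ g(2) nz] borel_measurable_integrable[OF g(1)] by blast
  obtain r where r: "0 < r" "\<And>h. norm h \<le> r \<Longrightarrow> measure lborel C / 2 \<le> measure lborel (C \<inter> {x. x - h \<in> C})"
    using compact_translate_overlap[OF C] by blast
  have [measurable]: "C \<in> sets borel" using C by (simp add: borel_compact)
  have fC: "emeasure lborel C < \<infinity>" using C by (intro emeasure_bounded_finite compact_imp_bounded)
  define m where "m = measure lborel C"
  have "a * m / 2 \<le> (LINT x|lborel. g x * (1 - cos (x \<bullet> z)))" if z: "pi / r \<le> norm z" for z
  proof -
    have z0: "0 < norm z" using z r by (smt (verit) divide_pos_pos pi_gt_zero)
    define h where "h = (pi / (norm z)\<^sup>2) *\<^sub>R z"
    have "norm h = pi / norm z" using z0 by (simp add: h_def power2_eq_square)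
    also have "\<dots> \<le> r" using z r z0 by (simp add: field_simps)
    finally have hr: "norm h \<le> r" .
    have hz: "h \<bullet> z = pi" using z0 by (simp add: h_def power2_norm_eq_inner)
    define k where "k x = 1 - cos (x \<bullet> z)" for x
    have k0: "0 \<le> k x" "k x \<le> 2" for x
      using cos_le_one[of "x \<bullet> z"] cos_ge_minus_one[of "x \<bullet> z"] unfolding k_def by linarith+
    have [measurable]: "k \<in> borel_measurable borel" unfolding k_def by measurable
    have gk: "g x * k x \<le> 2 * g x" for x using mult_left_mono[OF k0(2) g(2)] by (simp add: mult.commute)
    have kk: "k x + k (x - h) = 2" for x
      by (simp add: k_def inner_diff_left hz)
    let ?B = "C \<inter> {x. x - h \<in> C}"
    have intC: "integrable lborel (\<lambda>x. indicator S x * k (x - t))" if "S \<in> sets borel" "S \<subseteq> {x. x - s \<in> C}" for S t s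
    proof (rule Bochner_Integration.integrable_bound[where f="\<lambda>x. 2 * indicator {x. x - s \<in> C} x :: real"])
      have "emeasure lborel {x. x - s \<in> C} = emeasure (distr lborel borel ((+) (-s))) C"
        by (subst emeasure_distr) (auto simp: vimage_def algebra_simps)
      then have "emeasure lborel {x. x - s \<in> C} < \<infinity>" using fC by (simp add: lborel_distr_plus)
      then show "integrable lborel (\<lambda>x. 2 * indicator {x. x - s \<in> C} x :: real)" by simp
    qed (use that k0 in \<open>auto simp: indicator_def\<close>)
    have "2 * measure lborel ?B = (LINT x|lborel. indicator ?B x * k (x - 0) + indicator ?B x * k (x - h))"
    proof -
      have "(LINT x|lborel. indicator ?B x * k (x - 0) + indicator ?B x * k (x - h)) = (LINT x|lborel. 2 * indicator ?B x)"
        by (intro Bochner_Integration.integral_cong) (auto simp: kk simp flip: distrib_left)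
      then show ?thesis by simp
    qed
    also have "\<dots> = (LINT x|lborel. indicator ?B x * k (x - 0)) + (LINT x|lborel. indicator ?B x * k (x - h))"
      by (intro Bochner_Integration.integral_add intC[where s=0]) auto
    also have "(LINT x|lborel. indicator ?B x * k (x - 0)) \<le> (LINT x|lborel. indicator C x * k (x - 0))"
      by (intro integral_mono intC[where s=0]) (use k0 in \<open>auto simp: indicator_def\<close>)
    also have "(LINT x|lborel. indicator ?B x * k (x - h)) \<le> (LINT x|lborel. indicator {x. x - h \<in> C} x * k (x - h))"
      by (intro integral_mono intC[where s=h]) (use k0 in \<open>auto simp: indicator_def\<close>)
    also have "(LINT x|lborel. indicator {x. x - h \<in> C} x * k (x - h)) = (LINT x|lborel. indicator C x * k x)"
    proof -
      have "(LINT x|lborel. indicator C x * k x) = (LINT x|distr lborel borel ((+) (-h)). indicator C x * k x)"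
        by (simp add: lborel_distr_plus)
      also have "\<dots> = (LINT x|lborel. indicator {x. x - h \<in> C} x * k (x - h))"
        by (subst integral_distr) (auto simp: indicator_def algebra_simps intro!: Bochner_Integration.integral_cong)
      finally show ?thesis ..
    qed
    finally have "measure lborel ?B \<le> (LINT x|lborel. indicator C x * k x)" by simp
    then have "a * (m/2) \<le> a * (LINT x|lborel. indicator C x * k x)"
      using r(2)[OF hr] a by (intro mult_left_mono) (auto simp: m_def)
    also have "\<dots> = (LINT x|lborel. a * (indicator C x * k x))" by simp
    also have "\<dots> \<le> (LINT x|lborel. g x * k x)"
    proof (intro integral_mono)
      show "integrable lborel (\<lambda>x. a * (indicator C x * k x))" using intC[of C 0 0] by simp
      show "integrable lborel (\<lambda>x. g x * k x)"
        by (rule Bochner_Integration.integrable_bound[where f="\<lambda>x. 2 * g x"])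
          (use g k0 gk in \<open>auto simp: abs_mult\<close>)
      show "a * (indicator C x * k x) \<le> g x * k x" for x
        using a(2)[of x] k0[of x] g(2)[of x] by (auto simp: indicator_def intro!: mult_right_mono)
    qed
    finally show ?thesis by (simp add: k_def)
  qed
  moreover have "0 < pi / r" "0 < a * m / 2" using r a C by (auto simp: m_def)
  ultimately show ?thesis by blast
qed

text \<open>By doubling, the bound for distant points propagates to all \<open>z \<noteq> 0\<close>.\<close>
lemma integral_one_minus_cos_ge:
  fixes g :: "'a::euclidean_space \<Rightarrow> real"
  assumes g: "integrable lborel g" "\<And>x. 0 \<le> g x" and nz: "integral\<^sup>L lborel g \<noteq> 0"
  shows "\<exists>C>0. \<forall>z. z \<noteq> 0 \<longrightarrow> 0 < (LINT x|lborel. g x * (1 - cos (x \<bullet> z))) \<and>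
    (\<forall>x. 1 - cos (x \<bullet> z) \<le> C * (1 + norm x)\<^sup>2 * (LINT x|lborel. g x * (1 - cos (x \<bullet> z))))"
proof -
  obtain R c where R: "0 < R" and c: "0 < c" and
    far: "\<And>z. R \<le> norm z \<Longrightarrow> c \<le> (LINT x|lborel. g x * (1 - cos (x \<bullet> z)))"
    using integral_one_minus_cos_far[OF g nz] by blast
  define q where "q z = (LINT x|lborel. g x * (1 - cos (x \<bullet> z)))" for z
  have cos2: "1 - cos t \<le> 2" "0 \<le> 1 - cos t" for t :: real
    using cos_le_one[of t] cos_ge_minus_one[of t] by linarith+
  have int: "integrable lborel (\<lambda>x. g x * (1 - cos (x \<bullet> z)))" for z
    by (rule Bochner_Integration.integrable_bound[where f="\<lambda>x. 2 * g x"])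
      (use g cos2 in \<open>auto simp: abs_mult mult.commute intro!: mult_left_mono\<close>)
  have dbl: "q (2 *\<^sub>R z) \<le> 4 * q z" for z
  proof -
    have "q (2 *\<^sub>R z) \<le> (LINT x|lborel. 4 * (g x * (1 - cos (x \<bullet> z))))"
      unfolding q_def
    proof (intro integral_mono int)
      fix x
      have "g x * (1 - cos (2 * (x \<bullet> z))) \<le> g x * (4 * (1 - cos (x \<bullet> z)))"
        by (intro mult_left_mono one_minus_cos_double_le g)
      then show "g x * (1 - cos (x \<bullet> 2 *\<^sub>R z)) \<le> 4 * (g x * (1 - cos (x \<bullet> z)))" by (simp add: mult_ac)
    qed (use int in simp)
    then show ?thesis by (simp add: q_def)
  qed
  have dbl_n: "q (2^n *\<^sub>R z) \<le> 4^n * q z" for n z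
  proof (induction n)
    case (Suc n)
    have "q (2^Suc n *\<^sub>R z) \<le> 4 * q (2^n *\<^sub>R z)" using dbl[of "2^n *\<^sub>R z"] by simp
    then show ?case using Suc by simp
  qed simp
  have near: "c * (norm z)\<^sup>2 \<le> 4 * R\<^sup>2 * q z" if z: "z \<noteq> 0" "norm z < R" for z
  proof -
    have ex: "\<exists>n. R \<le> 2^n * norm z"
      using real_arch_pow[of 2 "R / norm z"] z by (auto simp: field_simps intro: less_imp_le)
    \<comment> \<open>The first doubling that reaches norm \<open>R\<close> stays below
      \<open>2 * R\<close>, hence \<open>4^n * (norm z)\<^sup>2 \<le> 4 * R\<^sup>2\<close>.\<close>
    define n where "n = (LEAST n. R \<le> 2^n * norm z)"
    have n: "R \<le> 2^n * norm z"
      unfolding n_def by (rule LeastI_ex[OF ex])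
    have least: "\<not> R \<le> 2^m * norm z" if "m < n" for m
      using not_less_Least[OF that[unfolded n_def]] .
    have "n \<noteq> 0"
    proof
      assume "n = 0"
      then show False using n z by simp
    qed
    then obtain m where m: "n = Suc m" using not0_implies_Suc by blast
    have "2^n * norm z \<le> 2 * R" using least[of m] by (simp add: m)
    then have "(2^n * norm z)\<^sup>2 \<le> (2 * R)\<^sup>2" by (intro power_mono) auto
    moreover have "(2^n * norm z)\<^sup>2 = 4^n * (norm z)\<^sup>2"
      using power_mult_distrib[of "2::real" 2 n] by (simp add: power_mult_distrib power2_eq_square)
    ultimately have 1: "4^n * (norm z)\<^sup>2 \<le> 4 * R\<^sup>2" using z by (auto simp: power_mult_distrib)
    have "c \<le> q (2^n *\<^sub>R z)" unfolding q_def by (rule far) (use n in simp)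
    also have "\<dots> \<le> 4^n * q z" by (rule dbl_n)
    finally have "c * (norm z)\<^sup>2 \<le> (4^n * q z) * (norm z)\<^sup>2" by (intro mult_right_mono) auto
    also have "\<dots> = (4^n * (norm z)\<^sup>2) * q z" by simp
    also have "\<dots> \<le> (4 * R\<^sup>2) * q z"
    proof (intro mult_right_mono 1)
      have "0 < 4^n * q z" using \<open>c \<le> q (2^n *\<^sub>R z)\<close> dbl_n[of n z] c by linarith
      then show "0 \<le> q z" by (simp add: zero_less_mult_iff)
    qed
    finally show ?thesis .
  qed
  \<comment> \<open>The summand 2 serves distant points, where one minus cosine is at most 2; the
    summand \<open>2 * R\<^sup>2\<close> comes from the near ones.\<close>
  define C where "C = (2 + 2 * R\<^sup>2) / c"
  have "0 < q z \<and> (\<forall>x. 1 - cos (x \<bullet> z) \<le> C * (1 + norm x)\<^sup>2 * q z)" if z: "z \<noteq> 0" for z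
  proof (cases "R \<le> norm z")
    case True
    then have q: "c \<le> q z" unfolding q_def by (rule far)
    have "1 - cos (x \<bullet> z) \<le> C * (1 + norm x)\<^sup>2 * q z" for x
    proof -
      have "2 * 1 * c \<le> (2 + 2 * R\<^sup>2) * (1 + norm x)\<^sup>2 * q z"
        using q c by (intro mult_mono) (auto simp: one_le_power)
      then have "2 \<le> C * (1 + norm x)\<^sup>2 * q z" using c by (simp add: C_def field_simps)
      then show ?thesis using cos2[of "x \<bullet> z"] by linarith
    qed
    then show ?thesis using q c by auto
  next
    case False
    then have n: "c * (norm z)\<^sup>2 \<le> 4 * R\<^sup>2 * q z" using near z by simp
    have "0 < c * (norm z)\<^sup>2" using c z by simp
    then have "0 < 4 * R\<^sup>2 * q z" using n by linarith
    then have q: "0 < q z" using R by (simp add: zero_less_mult_iff)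
    have "1 - cos (x \<bullet> z) \<le> C * (1 + norm x)\<^sup>2 * q z" for x
    proof -
      have "(x \<bullet> z)\<^sup>2 \<le> (norm x * norm z)\<^sup>2"
        using Cauchy_Schwarz_ineq2[of x z] by (metis abs_ge_zero power2_abs power_mono)
      then have "1 - cos (x \<bullet> z) \<le> (norm x)\<^sup>2 * (norm z)\<^sup>2 / 2"
        using one_minus_cos_le[of "x \<bullet> z"] by (simp add: power_mult_distrib)
      then have "c * (1 - cos (x \<bullet> z)) \<le> c * ((norm x)\<^sup>2 * (norm z)\<^sup>2 / 2)"
        using c by (intro mult_left_mono) auto
      also have "\<dots> = (norm x)\<^sup>2 / 2 * (c * (norm z)\<^sup>2)" by simp
      also have "\<dots> \<le> (norm x)\<^sup>2 / 2 * (4 * R\<^sup>2 * q z)" by (intro mult_left_mono n) auto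
      also have "\<dots> = (2 * R\<^sup>2) * (norm x)\<^sup>2 * q z" by simp
      also have "\<dots> \<le> (2 + 2 * R\<^sup>2) * (1 + norm x)\<^sup>2 * q z"
        using q by (intro mult_mono power_mono) auto
      finally show ?thesis using c by (simp add: C_def field_simps)
    qed
    then show ?thesis using q by auto
  qed
  moreover have "0 < C" using c by (auto simp: C_def intro!: divide_pos_pos add_pos_nonneg)
  ultimately show ?thesis unfolding q_def by blast
qed

section \<open>Averages of independent variables\<close>

lemma power_le_fact_mult_exp:
  fixes x :: real
  assumes "0 \<le> x" "0 < s"
  shows "x^n \<le> fact n / s^n * exp (s * x)"
proof -
  have "(s * x)^n / fact n \<le> exp (s * x)"
  proof -
    have "(s * x)^n /\<^sub>R fact n \<le> (\<Sum>k. (s * x)^k /\<^sub>R fact k)"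
      using sum_le_suminf[OF summable_exp_generic[of "s * x"], of "{n}"] assms by auto
    then show ?thesis by (simp add: exp_def divide_inverse_commute)
  qed
  then show ?thesis using assms by (simp add: field_simps power_mult_distrib)
qed

text \<open>A rescaled form of \<open>t \<le> exp t\<close> at \<open>t = s * x / q\<close>; the
  constant gives the later moment bound its growth in \<open>p\<close>.\<close>

lemma powr_le_powr_mult_exp:
  fixes x :: real
  assumes "0 \<le> x" "0 < s" "0 < q"
  shows "x powr q \<le> (q/s) powr q * exp (s * x)"
proof -
  define t where "t = s * x / q"
  have x: "x = q / s * t" using assms by (simp add: t_def)
  have t: "0 \<le> t" using assms by (simp add: t_def)
  have "x powr q = (q/s) powr q * t powr q" unfolding x using assms t by (subst powr_mult) auto
  also have "t powr q \<le> exp t powr q"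
  proof (intro powr_mono2)
    show "t \<le> exp t" using exp_ge_add_one_self[of t] by linarith
  qed (use assms t in auto)
  also have "\<dots> = exp (s * x)" using assms by (simp add: exp_powr_real t_def)
  finally show ?thesis by (simp add: mult_left_mono)
qed

lemma exp_le_quadratic_nonneg:
  fixes x :: real
  assumes "0 \<le> x"
  shows "exp x \<le> 1 + x + x\<^sup>2 * exp x"
proof (cases "x = 0")
  case False
  obtain t where t: "\<bar>t\<bar> \<le> \<bar>x\<bar>" "exp x = (\<Sum>m<2. x^m / fact m) + exp t / fact 2 * x^2"
    using Maclaurin_exp_le[of x 2] by blast
  have "exp x = 1 + x + exp t / 2 * x\<^sup>2" using t(2) by (simp add: numeral_2_eq_2)
  also have "exp t / 2 * x\<^sup>2 \<le> exp x * x\<^sup>2"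
  proof (intro mult_right_mono)
    have "exp t \<le> exp x" using t(1) assms by (simp only: exp_le_cancel_iff)
    then show "exp t / 2 \<le> exp x" using exp_gt_zero[of t] by linarith
  qed auto
  finally show ?thesis by (simp add: mult.commute)
qed simp

text \<open>Follows from exp x \<ge> 1 + x, because (1 - x + x^2) (1 + x) = 1 + x^3.\<close>

lemma exp_minus_le_quadratic:
  fixes x :: real
  assumes "0 \<le> x"
  shows "exp (- x) \<le> 1 - x + x\<^sup>2"
proof -
  have "exp (-x) * (1 + x) \<le> 1"
    using exp_ge_add_one_self[of x] assms by (simp add: exp_minus field_simps)
  also have "1 \<le> (1 - x + x\<^sup>2) * (1 + x)"
    using assms by (simp add: algebra_simps power2_eq_square)
  finally show ?thesis using assms by simp
qed

text \<open>Jensen's inequality, from the tangent at the mean \<open>h\<close>: the linear parts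
  average out.\<close>

lemma mean_powr_le:
  fixes y :: "'i \<Rightarrow> real"
  assumes "finite I" "I \<noteq> {}" "\<And>i. i \<in> I \<Longrightarrow> 0 \<le> y i" "1 \<le> p"
  shows "((\<Sum>i\<in>I. y i) / card I) powr p \<le> (\<Sum>i\<in>I. y i powr p) / card I"
proof -
  define h where "h = (\<Sum>i\<in>I. y i) / card I"
  have D: "0 < real (card I)" using assms by (simp add: card_gt_0_iff)
  have h: "0 \<le> h" unfolding h_def using assms by (simp add: sum_nonneg)
  have hp: "h powr (p-1) * h = h powr p"
    using powr_add[of h "p-1" 1] h by (cases "h = 0") auto
  have "real (card I) * h powr p = (\<Sum>i\<in>I. p * (h powr (p-1) * y i) - (p-1) * h powr p)"
  proof -
    have "(\<Sum>i\<in>I. p * (h powr (p-1) * y i) - (p-1) * h powr p) = p * (h powr (p-1) * (card I * h)) - card I * ((p-1) * h powr p)"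
      using D by (simp add: sum_subtractf sum_distrib_left[symmetric] h_def)
    also have "\<dots> = card I * (p * (h powr (p-1) * h) - (p-1) * h powr p)" by (simp add: algebra_simps)
    also have "\<dots> = card I * h powr p" unfolding hp by (simp add: algebra_simps)
    finally show ?thesis ..
  qed
  also have "\<dots> \<le> (\<Sum>i\<in>I. y i powr p)"
    by (intro sum_mono powr_tangent_ge) (use assms h in auto)
  finally show ?thesis using D by (simp add: h_def field_simps)
qed

context prob_space
begin

abbreviation iid :: "nat \<Rightarrow> (nat \<Rightarrow> 'a) measure" where
  "iid D \<equiv> PiM {..<D} (\<lambda>_. M)"

lemma prob_space_iid: "prob_space (iid D)"
  by (intro prob_space_PiM) (rule prob_space_axioms)

lemma integral_iid_component:
  fixes f :: "'a \<Rightarrow> real"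
  assumes [measurable]: "f \<in> borel_measurable M" and j: "j < D"
  shows "(LINT W|iid D. f (W j)) = expectation f"
proof -
  have "expectation f = (LINT x|distr (iid D) M (\<lambda>W. W j). f x)"
    using j by (subst distr_PiM_component) (auto intro: prob_space_axioms)
  also have "\<dots> = (LINT W|iid D. f (W j))" using j by (intro integral_distr) auto
  finally show ?thesis ..
qed

lemma integrable_iid_component:
  fixes f :: "'a \<Rightarrow> real"
  assumes f: "integrable M f" and j: "j < D"
  shows "integrable (iid D) (\<lambda>W. f (W j))"
proof -
  have "integrable (distr (iid D) M (\<lambda>W. W j)) f"
    using j f by (subst distr_PiM_component) (auto intro: prob_space_axioms)
  then show ?thesis using j f by (subst (asm) integrable_distr_eq) auto
qed

text \<open>The exponential Markov inequality with independence. The usual Chernoff parameter is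
  contained in \<open>g\<close>.\<close>

lemma chernoff_iid:
  fixes g :: "'a \<Rightarrow> real"
  assumes g[measurable]: "g \<in> borel_measurable M" and int: "integrable M (\<lambda>x. exp (g x))"
    and b: "expectation (\<lambda>x. exp (g x)) \<le> exp b"
  shows "measure (iid D) {W \<in> space (iid D). a \<le> (\<Sum>j<D. g (W j))} \<le> exp (D * b - a)"
proof -
  interpret PS: product_sigma_finite "\<lambda>_::nat. M"
    by (simp add: product_sigma_finite_def sigma_finite_measure_axioms)
  interpret N: prob_space "iid D" by (rule prob_space_iid)
  let ?u = "\<lambda>W. \<Prod>j<D. exp (g (W j))"
  have intu: "integrable (iid D) ?u"
    by (intro PS.product_integrable_prod) (use int in auto)
  have "{W \<in> space (iid D). a \<le> (\<Sum>j<D. g (W j))} = {W \<in> space (iid D). exp a \<le> ?u W}"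
    by (simp flip: exp_sum)
  also have "measure (iid D) \<dots> \<le> (LINT W|iid D. ?u W) / exp a"
    by (rule integral_Markov_inequality_measure[where A="{}"]) (use intu in \<open>auto intro!: prod_nonneg\<close>)
  also have "(LINT W|iid D. ?u W) = (expectation (\<lambda>x. exp (g x)))^D"
    by (subst PS.product_integral_prod) (use int in auto)
  also have "\<dots> \<le> (exp b)^D" by (intro power_mono b) auto
  also have "(exp b)^D / exp a = exp (D * b - a)" by (simp add: exp_diff exp_of_nat_mult)
  finally show ?thesis by (simp add: divide_right_mono)
qed

end

text \<open>The comparisons match the three exponents of the tail estimate:
  \<open>D * \<eta>\<^sup>2\<close> for small deviations, \<open>D powr (1/3)\<close> for the
  truncation, and \<open>D powr (2/3) * \<eta>\<close> when the Chernoff parameter is limited by the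
  truncation. The cube root is the common lower bound.\<close>

lemma cube_root_bounds:
  fixes D :: nat and \<eta> :: real
  assumes \<eta>: "0 < \<eta>" "\<eta> \<le> 1" and N: "1 \<le> D * \<eta>\<^sup>2"
  shows "(D * \<eta>\<^sup>2) powr (1/3) \<le> D * \<eta>\<^sup>2" "(D * \<eta>\<^sup>2) powr (1/3) \<le> D powr (1/3)"
    "(D * \<eta>\<^sup>2) powr (1/3) \<le> D powr (2/3) * \<eta>" "1 \<le> real D"
proof -
  have "\<eta>\<^sup>2 \<le> 1" using \<eta> by (simp add: power_le_one)
  moreover have "\<eta>\<^sup>2 \<le> \<eta>" using mult_left_mono[OF \<eta>(2), of \<eta>] \<eta> by (simp add: power2_eq_square)
  ultimately have e2: "\<eta>\<^sup>2 \<le> 1" "\<eta>\<^sup>2 \<le> \<eta>" by auto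
  have ND: "D * \<eta>\<^sup>2 \<le> D" using e2 by (simp add: mult_left_le)
  then show D: "1 \<le> real D" using N by linarith
  show "(D * \<eta>\<^sup>2) powr (1/3) \<le> D * \<eta>\<^sup>2" using powr_mono[of "1/3" 1 "D * \<eta>\<^sup>2"] N by simp
  show "(D * \<eta>\<^sup>2) powr (1/3) \<le> D powr (1/3)" using ND by (intro powr_mono2) auto
  have De: "1 \<le> D * \<eta>" using N e2 mult_left_mono[OF e2(2), of "real D"] by simp
  have "(D * \<eta>\<^sup>2) powr (1/3) = D powr (1/3) * \<eta> powr (2/3) * 1"
    using \<eta> by (simp add: powr_mult power2_powr)
  also have "\<dots> \<le> D powr (1/3) * \<eta> powr (2/3) * (D * \<eta>) powr (1/3)"
    by (intro mult_left_mono) (use De in \<open>auto simp: ge_one_powr_ge_zero\<close>)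
  also have "\<dots> = (D powr (1/3) * D powr (1/3)) * (\<eta> powr (2/3) * \<eta> powr (1/3))"
    using \<eta> by (simp add: powr_mult)
  also have "D powr (1/3) * D powr (1/3) = D powr (2/3)" by (simp flip: powr_add)
  also have "\<eta> powr (2/3) * \<eta> powr (1/3) = \<eta>" using \<eta> by (simp flip: powr_add)
  finally show "(D * \<eta>\<^sup>2) powr (1/3) \<le> D powr (2/3) * \<eta>" .
qed

context prob_space
begin

text \<open>The upper tail is truncated at \<open>D\<^sup>2\<^sup>/\<^sup>3\<close>, where \<open>Y \<le> H\<^sup>2\<close> has an exponential
  moment along \<open>\<lambda> \<le> s / (2 D\<^sup>1\<^sup>/\<^sup>3)\<close>; Chernoff's bound then applies.\<close>
lemma iid_average_tail:
  fixes H :: "'a \<Rightarrow> real"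
  assumes H[measurable]: "H \<in> borel_measurable M" and H0: "\<And>x. 0 \<le> H x" and s: "0 < s"
    and intH: "integrable M (\<lambda>x. exp (s * H x))"
  shows "\<exists>c>0. \<exists>B>0. \<forall>Y D \<eta>. Y \<in> borel_measurable M \<and> (\<forall>x. 0 \<le> Y x \<and> Y x \<le> (H x)\<^sup>2) \<and> expectation Y = 1 \<and>
     0 < \<eta> \<and> \<eta> \<le> 1 \<and> 1 \<le> real D * \<eta>\<^sup>2 \<longrightarrow>
     measure (iid D) {W \<in> space (iid D). \<eta> < \<bar>(\<Sum>j<D. Y (W j)) / D - 1\<bar>} \<le> B * exp (- c * (D * \<eta>\<^sup>2) powr (1/3))"
proof -
  define A where "A = expectation (\<lambda>x. exp (s * H x))"
  have A: "1 \<le> A"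
  proof -
    have "expectation (\<lambda>_. 1) \<le> A" unfolding A_def
      by (intro integral_mono intH) (use s H0 in auto)
    then show ?thesis by (simp add: prob_space)
  qed
  \<comment> \<open>Bounds the second-order term of the exponential moments;
    \<open>384 = 4! * 2^4\<close> comes from absorbing \<open>(H x)^4\<close> into
    \<open>exp (s/2 * H x)\<close>.\<close>
  define V where "V = 384 * A / s^4"
  have V: "0 < V" using A s by (simp add: V_def)
  define c where "c = min (1 / (4*V)) (s/4)"
  have c: "0 < c" "c \<le> 1 / (4*V)" "c \<le> s/4" using V s by (auto simp: c_def)
  \<comment> \<open>Two Chernoff bounds contribute 2; the union bound over the samples above the
    truncation level contributes the rest, with \<open>48 = 3! * 2^3\<close>.\<close>
  define B where "B = 2 + 48 * A / s^3"
  have B: "0 < B" using A s by (auto simp: B_def intro!: add_pos_nonneg)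
  have H4: "(H x)^4 * exp (s/2 * H x) \<le> 384 / s^4 * exp (s * H x)" for x
  proof -
    have "(H x)^4 * exp (s/2 * H x) \<le> (fact 4 / (s/2)^4 * exp (s/2 * H x)) * exp (s/2 * H x)"
      by (intro mult_right_mono power_le_fact_mult_exp H0) (use s in auto)
    also have "\<dots> = 384 / s^4 * exp (s * H x)"
      by (simp add: fact_numeral power_divide flip: exp_add)
    finally show ?thesis .
  qed
  have "measure (iid D) {W \<in> space (iid D). \<eta> < \<bar>(\<Sum>j<D. Y (W j)) / D - 1\<bar>} \<le> B * exp (- c * (D * \<eta>\<^sup>2) powr (1/3))"
    if Y[measurable]: "Y \<in> borel_measurable M" and Y0: "\<And>x. 0 \<le> Y x" and YH: "\<And>x. Y x \<le> (H x)\<^sup>2"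
      and EY: "expectation Y = 1" and \<eta>: "0 < \<eta>" "\<eta> \<le> 1" and N: "1 \<le> real D * \<eta>\<^sup>2" for Y D \<eta>
  proof -
    interpret N: prob_space "iid D" by (rule prob_space_iid)
    define L where "L = (D * \<eta>\<^sup>2) powr (1/3)"
    note L = cube_root_bounds[OF \<eta> N, folded L_def]
    \<comment> \<open>A non-integrable function has integral 0 by convention, so expectation 1
      implies integrability.\<close>
    have intY: "integrable M Y" using EY by (metis not_integrable_integral_eq zero_neq_one)
    have Y2: "(Y x)\<^sup>2 \<le> (H x)^4" for x
      using power_mono[OF YH Y0, of x 2] by simp
    define b where "b = real D powr (1/3)"
    have b: "1 \<le> b" using L(4) by (simp add: b_def ge_one_powr_ge_zero)
    have b3: "b^3 = D" using L(4) by (simp add: b_def powr_power)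
    have b2: "D / b = D powr (2/3)"
    proof -
      have "D powr (2/3) * b = D" using L(4) by (simp add: b_def flip: powr_add)
      then show ?thesis using b by (simp add: field_simps)
    qed
    \<comment> \<open>Common to both tails: \<open>t\<close> is \<open>l\<close> for the upper and
      \<open>- l\<close> for the lower one.\<close>
    have quad: "measure (iid D) {W \<in> space (iid D). a \<le> (\<Sum>j<D. g (W j))} \<le> exp (D * (t + l\<^sup>2 * V) - a)"
      if g[measurable]: "g \<in> borel_measurable M" and bnd: "\<And>x. exp (g x) \<le> 1 + t * Y x + l\<^sup>2 * (384 / s^4 * exp (s * H x))"
      for g a t l
    proof (rule chernoff_iid[OF g])
      have int: "integrable M (\<lambda>x. 1 + t * Y x + l\<^sup>2 * (384 / s^4 * exp (s * H x)))"
        using intY intH by simp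
      show intg: "integrable M (\<lambda>x. exp (g x))"
        by (rule Bochner_Integration.integrable_bound[OF int]) (use bnd in \<open>auto intro: order_trans[OF _ abs_ge_self]\<close>)
      have "expectation (\<lambda>x. exp (g x)) \<le> expectation (\<lambda>x. 1 + t * Y x + l\<^sup>2 * (384 / s^4 * exp (s * H x)))"
        by (intro integral_mono intg int bnd)
      also have "\<dots> = 1 + (t + l\<^sup>2 * V)"
        using intY intH by (simp add: EY prob_space V_def A_def)
      also have "\<dots> \<le> exp (t + l\<^sup>2 * V)" by (rule exp_ge_add_one_self)
      finally show "expectation (\<lambda>x. exp (g x)) \<le> exp (t + l\<^sup>2 * V)" .
    qed
    have up: "measure (iid D) {W \<in> space (iid D). l * (D * (1 + \<eta>)) \<le> (\<Sum>j<D. l * (if Y (W j) \<le> b\<^sup>2 then Y (W j) else 0))}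
      \<le> exp (- (D * l * \<eta> / 2))" if l: "0 < l" "l * b \<le> s/2" "l * V \<le> \<eta>/2" for l :: real
    proof -
      define g where "g x = l * (if Y x \<le> b\<^sup>2 then Y x else 0)" for x
      have g[measurable]: "g \<in> borel_measurable M" unfolding g_def by measurable
      have bnd: "exp (g x) \<le> 1 + l * Y x + l\<^sup>2 * (384 / s^4 * exp (s * H x))" for x
      proof (cases "Y x \<le> b\<^sup>2")
        case True
        \<comment> \<open>Below the truncation level \<open>Y\<close> is at most the geometric mean
          \<open>b * H x\<close> of its two bounds; this reduces the square of \<open>H\<close> in
          the exponent to the first power.\<close>
        have "sqrt (Y x) \<le> b" using True b by (intro real_le_lsqrt) auto
        moreover have "sqrt (Y x) \<le> H x" using YH H0 by (intro real_le_lsqrt) auto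
        ultimately have "sqrt (Y x) * sqrt (Y x) \<le> b * H x" using Y0 b by (intro mult_mono) auto
        then have "l * Y x \<le> l * (b * H x)" using l Y0 by (intro mult_left_mono) auto
        also have "\<dots> \<le> s/2 * H x" using mult_right_mono[OF l(2) H0[of x]] by (simp add: mult.assoc)
        finally have lY: "l * Y x \<le> s/2 * H x" .
        have "exp (g x) \<le> 1 + l * Y x + (l * Y x)\<^sup>2 * exp (l * Y x)"
          using True exp_le_quadratic_nonneg[of "l * Y x"] l Y0[of x] by (simp add: g_def)
        also have "(l * Y x)\<^sup>2 * exp (l * Y x) \<le> (l\<^sup>2 * (H x)^4) * exp (s/2 * H x)"
          unfolding power_mult_distrib by (intro mult_mono mult_left_mono Y2) (use lY in auto)
        also have "\<dots> \<le> l\<^sup>2 * (384 / s^4 * exp (s * H x))"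
          using mult_left_mono[OF H4, of "l\<^sup>2" x] by (simp add: mult_ac)
        finally show ?thesis by simp
      next
        case False
        then show ?thesis using l Y0[of x] s by (simp add: g_def)
      qed
      have "measure (iid D) {W \<in> space (iid D). l * (D * (1 + \<eta>)) \<le> (\<Sum>j<D. g (W j))}
        \<le> exp (D * (l + l\<^sup>2 * V) - l * (D * (1 + \<eta>)))"
        by (rule quad[OF g bnd])
      also have "D * (l + l\<^sup>2 * V) - l * (D * (1 + \<eta>)) = D * l * (l * V - \<eta>)"
        by (simp add: algebra_simps power2_eq_square)
      also have "D * l * (l * V - \<eta>) \<le> D * l * (- \<eta>/2)"
        using l by (intro mult_left_mono) auto
      finally show ?thesis by (simp add: g_def)
    qed
    have up': "measure (iid D) {W \<in> space (iid D). D * (1 + \<eta>) \<le> (\<Sum>j<D. (if Y (W j) \<le> b\<^sup>2 then Y (W j) else 0))}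
      \<le> exp (- c * L)"
    proof -
      \<comment> \<open>The optimal parameter for small deviations, capped so that
        \<open>l * b\<close> stays within the exponential moment of \<open>H\<close>.\<close>
      define l where "l = min (\<eta> / (2*V)) (s / (2*b))"
      have l: "0 < l" using \<eta> V s b by (simp add: l_def)
      have "l * b \<le> s / (2*b) * b" using b by (intro mult_right_mono) (auto simp: l_def)
      then have l1: "l * b \<le> s/2" using b by simp
      have "l * V \<le> \<eta> / (2*V) * V" using V by (intro mult_right_mono) (auto simp: l_def)
      then have l2: "l * V \<le> \<eta>/2" using V by simp
      have "c * L \<le> D * l * \<eta> / 2"
      proof (cases "\<eta> / (2*V) \<le> s / (2*b)")
        case True
        have "c * L \<le> 1 / (4*V) * (D * \<eta>\<^sup>2)" using c L V by (intro mult_mono) (auto simp: L_def)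
        also have "\<dots> = D * (\<eta> / (2*V)) * \<eta> / 2" by (simp add: power2_eq_square)
        finally show ?thesis using True by (simp add: l_def min_def)
      next
        case False
        have "c * L \<le> s/4 * (D powr (2/3) * \<eta>)" using c L s by (intro mult_mono) (auto simp: L_def)
        also have "\<dots> = D * (s / (2*b)) * \<eta> / 2" by (simp flip: b2)
        finally show ?thesis using False by (simp add: l_def min_def)
      qed
      then have le: "exp (- (D * l * \<eta> / 2)) \<le> exp (- c * L)" by simp
      have eq: "(\<Sum>j<D. l * (if Y (W j) \<le> b\<^sup>2 then Y (W j) else 0)) = l * (\<Sum>j<D. (if Y (W j) \<le> b\<^sup>2 then Y (W j) else 0))" for W
        by (simp add: sum_distrib_left)
      have "measure (iid D) {W \<in> space (iid D). D * (1 + \<eta>) \<le> (\<Sum>j<D. (if Y (W j) \<le> b\<^sup>2 then Y (W j) else 0))}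
        \<le> exp (- (D * l * \<eta> / 2))"
        using up[OF l l1 l2] l unfolding eq by simp
      then show ?thesis using le by (rule order_trans)
    qed
    have low: "measure (iid D) {W \<in> space (iid D). - (D * (1 - \<eta>)) \<le> (\<Sum>j<D. - Y (W j))} \<le> exp (- c * L)"
    proof -
      \<comment> \<open>The lower tail does without truncation: for nonnegative \<open>Y\<close> the
        exponential of \<open>- (l * Y x)\<close> has a quadratic bound for every positive
        \<open>l\<close>.\<close>
      define l where "l = \<eta> / (2*V)"
      have l: "0 < l" using \<eta> V by (simp add: l_def)
      have lV: "l * V = \<eta>/2" using V by (simp add: l_def)
      define g where "g x = - (l * Y x)" for x
      have g[measurable]: "g \<in> borel_measurable M" unfolding g_def by measurable
      have bnd: "exp (g x) \<le> 1 - l * Y x + l\<^sup>2 * (384 / s^4 * exp (s * H x))" for x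
      proof -
        have "exp (g x) \<le> 1 - l * Y x + (l * Y x)\<^sup>2"
          unfolding g_def using l Y0[of x] by (intro exp_minus_le_quadratic) auto
        also have "(l * Y x)\<^sup>2 \<le> l\<^sup>2 * ((H x)^4 * 1)"
          unfolding power_mult_distrib using Y2[of x] by (intro mult_left_mono) auto
        also have "\<dots> \<le> l\<^sup>2 * ((H x)^4 * exp (s/2 * H x))"
          using s H0[of x] by (intro mult_left_mono) auto
        also have "\<dots> \<le> l\<^sup>2 * (384 / s^4 * exp (s * H x))" by (intro mult_left_mono H4) auto
        finally show ?thesis by simp
      qed
      have "measure (iid D) {W \<in> space (iid D). - (l * (D * (1 - \<eta>))) \<le> (\<Sum>j<D. g (W j))}
        \<le> exp (D * (- l + l\<^sup>2 * V) - - (l * (D * (1 - \<eta>))))"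
        by (rule quad[OF g]) (use bnd in simp)
      also have "D * (- l + l\<^sup>2 * V) - - (l * (D * (1 - \<eta>))) = D * l * (l * V - \<eta>)"
        by (simp add: algebra_simps power2_eq_square)
      also have "\<dots> = - (1 / (4*V) * (D * \<eta>\<^sup>2))" unfolding lV by (simp add: l_def power2_eq_square)
      also have "\<dots> \<le> - (c * L)" using c L V by (intro le_imp_neg_le mult_mono) (auto simp: L_def)
      also have "(\<lambda>W. \<Sum>j<D. g (W j)) = (\<lambda>W. l * (\<Sum>j<D. - Y (W j)))"
        by (simp add: g_def sum_distrib_left)
      finally have "measure (iid D) {W \<in> space (iid D). - (l * (D * (1 - \<eta>))) \<le> l * (\<Sum>j<D. - Y (W j))} \<le> exp (- c * L)"
        by simp
      moreover have "- (l * (D * (1 - \<eta>))) \<le> l * t \<longleftrightarrow> - (D * (1 - \<eta>)) \<le> t" for t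
        using l mult_le_cancel_left_pos[of l "- (D * (1 - \<eta>))" t] by simp
      ultimately show ?thesis by simp
    qed
    have trunc: "measure (iid D) {W \<in> space (iid D). b\<^sup>2 < Y (W j)} \<le> A * exp (- s * b)" if j: "j < D" for j
    proof -
      have "measure (iid D) {W \<in> space (iid D). b\<^sup>2 < Y (W j)} \<le> measure (iid D) {W \<in> space (iid D). exp (s * b) \<le> exp (s * H (W j))}"
      proof (intro N.finite_measure_mono subsetI)
        fix W assume W: "W \<in> {W \<in> space (iid D). b\<^sup>2 < Y (W j)}"
        then have "b\<^sup>2 < (H (W j))\<^sup>2" using YH[of "W j"] by auto
        then have "b < H (W j)" using H0 power_less_imp_less_base by blast
        then show "W \<in> {W \<in> space (iid D). exp (s * b) \<le> exp (s * H (W j))}" using W s by simp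
      qed (measurable, use j in simp)
      also have "\<dots> \<le> (LINT W|iid D. exp (s * H (W j))) / exp (s * b)"
        by (rule integral_Markov_inequality_measure[where A="{}"])
          (use integrable_iid_component[OF intH j] in auto)
      also have "(LINT W|iid D. exp (s * H (W j))) = A"
        unfolding A_def by (rule integral_iid_component[OF _ j]) measurable
      finally show ?thesis by (simp add: exp_minus field_simps)
    qed
    have truncs: "measure (iid D) (\<Union>j<D. {W \<in> space (iid D). b\<^sup>2 < Y (W j)}) \<le> 48 * A / s^3 * exp (- c * L)"
    proof -
      have "measure (iid D) (\<Union>j<D. {W \<in> space (iid D). b\<^sup>2 < Y (W j)}) \<le> (\<Sum>j<D. measure (iid D) {W \<in> space (iid D). b\<^sup>2 < Y (W j)})"
        by (intro N.finite_measure_subadditive_finite) auto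
      also have "\<dots> \<le> (\<Sum>j<D. A * exp (- s * b))" by (intro sum_mono trunc) auto
      also have "\<dots> = A * (b^3 * exp (- s * b))" by (simp add: b3)
      \<comment> \<open>The number \<open>D = b^3\<close> of samples in the union bound is paid for
        with half of the exponent.\<close>
      also have "b^3 * exp (- s * b) \<le> (fact 3 / (s/2)^3 * exp (s/2 * b)) * exp (- s * b)"
        by (intro mult_right_mono power_le_fact_mult_exp) (use s b in auto)
      also have "\<dots> = 48 / s^3 * exp (- (s/2) * b)"
        by (simp add: fact_numeral power_divide field_simps flip: exp_add)
      also have "exp (- (s/2) * b) \<le> exp (- c * L)"
      proof -
        have "c * L \<le> s/2 * b" using c L s by (intro mult_mono) (auto simp: L_def b_def)
        then show ?thesis by simp
      qed
      finally show ?thesis using A s by (simp add: mult_left_mono divide_right_mono mult_ac)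
    qed
    let ?E1 = "{W \<in> space (iid D). D * (1 + \<eta>) \<le> (\<Sum>j<D. (if Y (W j) \<le> b\<^sup>2 then Y (W j) else 0))}"
    let ?E2 = "{W \<in> space (iid D). - (D * (1 - \<eta>)) \<le> (\<Sum>j<D. - Y (W j))}"
    let ?E3 = "\<Union>j<D. {W \<in> space (iid D). b\<^sup>2 < Y (W j)}"
    have ms: "?E1 \<in> sets (iid D)" "?E2 \<in> sets (iid D)" "?E3 \<in> sets (iid D)" by measurable
    have "{W \<in> space (iid D). \<eta> < \<bar>(\<Sum>j<D. Y (W j)) / D - 1\<bar>} \<subseteq> (?E1 \<union> ?E2) \<union> ?E3"
    proof
      fix W assume W: "W \<in> {W \<in> space (iid D). \<eta> < \<bar>(\<Sum>j<D. Y (W j)) / D - 1\<bar>}"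
      show "W \<in> (?E1 \<union> ?E2) \<union> ?E3"
      proof (cases "W \<in> ?E3")
        case False
        then have "(\<Sum>j<D. (if Y (W j) \<le> b\<^sup>2 then Y (W j) else 0)) = (\<Sum>j<D. Y (W j))"
          using W by (intro sum.cong) (auto simp: not_less)
        moreover have "1 + \<eta> \<le> (\<Sum>j<D. Y (W j)) / D \<or> (\<Sum>j<D. Y (W j)) / D \<le> 1 - \<eta>"
          using W by (auto simp: abs_if split: if_splits)
        then have "D * (1 + \<eta>) \<le> (\<Sum>j<D. Y (W j)) \<or> (\<Sum>j<D. Y (W j)) \<le> D * (1 - \<eta>)"
          using L(4) by (simp add: le_divide_eq divide_le_eq mult.commute)
        ultimately show ?thesis using W by (auto simp: sum_negf)
      qed simp
    qed
    then have "measure (iid D) {W \<in> space (iid D). \<eta> < \<bar>(\<Sum>j<D. Y (W j)) / D - 1\<bar>} \<le> measure (iid D) ((?E1 \<union> ?E2) \<union> ?E3)"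
      using ms by (intro N.finite_measure_mono) auto
    also have "\<dots> \<le> measure (iid D) ?E1 + measure (iid D) ?E2 + measure (iid D) ?E3"
      using ms by (intro order_trans[OF measure_Un_le] add_right_mono measure_Un_le) auto
    also have "\<dots> \<le> exp (- c * L) + exp (- c * L) + 48 * A / s^3 * exp (- c * L)"
      by (intro add_mono up' low truncs)
    also have "\<dots> = B * exp (- c * L)" by (simp add: B_def algebra_simps)
    finally show ?thesis by (simp add: L_def)
  qed
  then show ?thesis using c B by (intro exI[of _ c] exI[of _ B] conjI allI impI) auto
qed

text \<open>Jensen's inequality moves the power inside the average, where
  \<open>H x powr (2*p)\<close> is absorbed by the exponential moment; hence the bound is uniform in
  \<open>D\<close>.\<close>

lemma iid_average_moment:
  fixes H Y :: "'a \<Rightarrow> real"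
  assumes H[measurable]: "H \<in> borel_measurable M" and H0: "\<And>x. 0 \<le> H x" and s: "0 < s"
    and intH: "integrable M (\<lambda>x. exp (s * H x))" and Y[measurable]: "Y \<in> borel_measurable M"
    and Y0: "\<And>x. 0 \<le> Y x" and YH: "\<And>x. Y x \<le> (H x)\<^sup>2" and p: "1 \<le> p" and D: "0 < D"
  shows "integrable (iid D) (\<lambda>W. ((\<Sum>j<D. Y (W j)) / D) powr p)"
    and "(LINT W|iid D. ((\<Sum>j<D. Y (W j)) / D) powr p) \<le> (2*p/s) powr (2*p) * expectation (\<lambda>x. exp (s * H x))"
proof -
  define G where "G x = (2*p/s) powr (2*p) * exp (s * H x)" for x
  have intG: "integrable M G" using intH by (simp add: G_def[abs_def])
  have YG: "Y x powr p \<le> G x" for x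
  proof -
    have "Y x powr p \<le> ((H x)\<^sup>2) powr p" using p Y0 YH by (intro powr_mono2) auto
    also have "\<dots> = H x powr (2*p)" using H0 by (rule power2_powr)
    also have "\<dots> \<le> G x" unfolding G_def using powr_le_powr_mult_exp[OF H0 s, of "2*p"] p by simp
    finally show ?thesis .
  qed
  have le: "((\<Sum>j<D. Y (W j)) / D) powr p \<le> (\<Sum>j<D. G (W j)) / D" for W
  proof -
    have "((\<Sum>j<D. Y (W j)) / D) powr p \<le> (\<Sum>j<D. Y (W j) powr p) / D"
      using mean_powr_le[of "{..<D}" "\<lambda>j. Y (W j)" p] Y0 p D by auto
    also have "\<dots> \<le> (\<Sum>j<D. G (W j)) / D" by (intro divide_right_mono sum_mono YG) auto
    finally show ?thesis .
  qed
  have int: "integrable (iid D) (\<lambda>W. (\<Sum>j<D. G (W j)) / D)"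
    using intG by (intro integrable_divide Bochner_Integration.integrable_sum integrable_iid_component) auto
  show 1: "integrable (iid D) (\<lambda>W. ((\<Sum>j<D. Y (W j)) / D) powr p)"
    by (rule Bochner_Integration.integrable_bound[OF int])
      (use order_trans[OF le divide_right_mono[OF abs_ge_self]] in auto)
  have "(LINT W|iid D. ((\<Sum>j<D. Y (W j)) / D) powr p) \<le> (LINT W|iid D. (\<Sum>j<D. G (W j)) / D)"
    by (intro integral_mono 1 int le)
  also have "\<dots> = (\<Sum>j<D. expectation G) / D"
    using intG by (simp add: Bochner_Integration.integral_sum integrable_iid_component integral_iid_component)
  also have "\<dots> = expectation G" using D by simp
  finally show "(LINT W|iid D. ((\<Sum>j<D. Y (W j)) / D) powr p) \<le> (2*p/s) powr (2*p) * expectation (\<lambda>x. exp (s * H x))"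
    by (simp add: G_def[abs_def])
qed

end

section \<open>The good event for a random map\<close>

text \<open>With a suitable scale \<open>a\<close> this takes the place of the Cauchy-Schwarz
  inequality when a random distance is integrated over an event that depends on it.\<close>

lemma le_mult_square_plus_inverse:
  fixes t a :: real
  assumes "0 \<le> t" "0 < a"
  shows "t \<le> a * t\<^sup>2 + 1 / a"
proof -
  have "2 * (a * t) \<le> (a * t)\<^sup>2 + 1"
    using zero_le_power2[of "a * t - 1"] by (simp add: power2_diff)
  moreover have "0 \<le> a * t" using assms by simp
  ultimately have "a * t \<le> (a * t)\<^sup>2 + 1" by linarith
  also have "\<dots> = a * (a * t\<^sup>2 + 1 / a)" using assms by (simp add: power2_eq_square algebra_simps)
  finally show ?thesis using assms by simp
qed

context prob_space
begin

lemma markov_strict: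
  fixes f :: "'a \<Rightarrow> real"
  assumes f: "integrable M f" and f0: "\<And>x. 0 \<le> f x" and c: "0 < c" and b: "expectation f \<le> b * c"
  shows "prob {x \<in> space M. c < f x} \<le> b"
proof -
  have [measurable]: "f \<in> borel_measurable M" using f by simp
  have "prob {x \<in> space M. c < f x} \<le> prob {x \<in> space M. c \<le> f x}"
    by (intro finite_measure_mono) auto
  also have "\<dots> \<le> expectation f / c"
    by (rule integral_Markov_inequality_measure[where A="{}"]) (use f f0 c in auto)
  also have "\<dots> \<le> b" using b c by (simp add: divide_le_eq)
  finally show ?thesis .
qed

text \<open>A point is an outlier with probability at most \<open>q\<close>, so the expected outlier
  cost in \<open>u\<close> is at most \<open>q * R\<close>. In \<open>v\<close> the distance and the
  event are correlated; the moment of order \<open>2*p\<close> is used, and only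
  \<open>sqrt q\<close> remains. Markov's inequality then gives an event whose probability does not
  see the number of points.\<close>

lemma random_map_good_event:
  fixes u :: "'i \<Rightarrow> 'b::metric_space" and v :: "'a \<Rightarrow> 'i \<Rightarrow> 'c::metric_space"
  assumes P: "finite P" and u: "inj_on u P"
    and dv[measurable]: "\<And>x y. x \<in> P \<Longrightarrow> y \<in> P \<Longrightarrow> (\<lambda>W. dist (v W x) (v W y)) \<in> borel_measurable M"
    and S: "S \<subseteq> P" "card S \<le> k" and s: "\<And>x. x \<in> P \<Longrightarrow> s x \<in> S"
    and pr: "\<And>x y. x \<in> P \<Longrightarrow> y \<in> P \<Longrightarrow> prob {W \<in> space M. \<not> quasi_iso \<eta> u (v W) x y} \<le> \<delta>"
    and m: "0 \<le> m"
    and mom: "\<And>x y. x \<in> P \<Longrightarrow> y \<in> P \<Longrightarrow> integrable M (\<lambda>W. dist (v W x) (v W y) powr (2*p))"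
      "\<And>x y. x \<in> P \<Longrightarrow> y \<in> P \<Longrightarrow> expectation (\<lambda>W. dist (v W x) (v W y) powr (2*p)) \<le> m * dist (u x) (u y) powr (2*p)"
    and \<theta>: "0 < \<theta>" "0 < \<theta>'" and \<delta>: "0 < \<delta>"
    and R: "R = (\<Sum>x\<in>P. dist (u x) (u (s x)) powr p)" and q: "q = k * \<delta> + \<delta> / \<theta>"
  shows "\<exists>E \<in> events. 1 - ((real k)\<^sup>2 * \<delta> + q / \<theta>' + sqrt q * (m + 1) / \<theta>') \<le> prob E \<and>
    (\<forall>W\<in>E. \<exists>Z. outlier_set \<eta> u (v W) P S s p (\<theta> * R) (\<theta>' * R) Z)"
proof -
  define r where "r x = dist (u x) (u (s x)) powr p" for x
  have R_def: "R = (\<Sum>x\<in>P. r x)" by (simp add: R r_def)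
  have r0: "0 \<le> r x" for x by (simp add: r_def)
  have R0: "0 \<le> R" unfolding R_def by (simp add: sum_nonneg r0)
  have fS: "finite S" using S P finite_subset by blast
  define BS where "BS x y = {W \<in> space M. \<not> quasi_iso \<eta> u (v W) x y}" for x y
  have BS[measurable]: "BS x y \<in> events" if "x \<in> P" "y \<in> P" for x y
    unfolding BS_def quasi_iso_def using that by measurable
  have PB: "prob (BS x y) \<le> \<delta>" if "x \<in> P" "y \<in> P" for x y
    unfolding BS_def using pr that by auto
  have BS_space[simp]: "BS x y \<inter> space M = BS x y" for x y by (auto simp: BS_def)
  define n where "n x W = (\<Sum>y\<in>P. r y * indicator (BS x y) W)" for x W
  have n_eq: "n x W = (\<Sum>y | y \<in> P \<and> \<not> quasi_iso \<eta> u (v W) x y. r y)" if "W \<in> space M" for x W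
    unfolding n_def using that P
    by (intro sum.mono_neutral_cong_right) (auto simp: BS_def indicator_def)
  have n_meas[measurable]: "n x \<in> borel_measurable M" if "x \<in> P" for x
    unfolding n_def[abs_def] using that by measurable
  have n_int: "integrable M (n x)" and n_exp: "expectation (n x) \<le> \<delta> * R" if "x \<in> P" for x
  proof -
    have i: "integrable M (\<lambda>W. r y * indicator (BS x y) W)" if "y \<in> P" for y
      using BS[OF \<open>x \<in> P\<close> that] by (intro integrable_mult_right) (auto simp: less_top[symmetric])
    then show "integrable M (n x)" unfolding n_def[abs_def] by (rule Bochner_Integration.integrable_sum)
    have "expectation (n x) = (\<Sum>y\<in>P. expectation (\<lambda>W. r y * indicator (BS x y) W))"
      unfolding n_def[abs_def] by (intro Bochner_Integration.integral_sum i)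
    also have "\<dots> = (\<Sum>y\<in>P. r y * prob (BS x y))" by simp
    also have "\<dots> \<le> (\<Sum>y\<in>P. r y * \<delta>)" by (intro sum_mono mult_left_mono PB that r0)
    finally show "expectation (n x) \<le> \<delta> * R" by (simp add: R_def sum_distrib_left mult.commute)
  qed
  have n0: "0 \<le> n x W" for x W unfolding n_def by (intro sum_nonneg) (simp add: r0)
  define OS where "OS x = (\<Union>c\<in>S. BS x c) \<union> {W \<in> space M. \<theta> * R < n x W}" for x
  have OS[measurable]: "OS x \<in> events" if x: "x \<in> P" for x
  proof -
    have "(\<Union>c\<in>S. BS x c) \<in> events" by (intro sets.finite_UN fS BS) (use x S in auto)
    then show ?thesis unfolding OS_def using n_meas[OF x] by measurable
  qed
  have OS_space[simp]: "OS x \<inter> space M = OS x" for x by (auto simp: OS_def BS_def)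
  have P_n: "prob {W \<in> space M. \<theta> * R < n x W} \<le> \<delta> / \<theta>" if x: "x \<in> P" for x
  \<comment> \<open>Markov's inequality needs a positive threshold; for \<open>R = 0\<close> all
    costs vanish.\<close>
  proof (cases "R = 0")
    case True
    then have "r y = 0" if "y \<in> P" for y using that P r0 by (simp add: R_def sum_nonneg_eq_0_iff)
    then have "{W \<in> space M. \<theta> * R < n x W} = {}" unfolding n_def using True by auto
    then have "prob {W \<in> space M. \<theta> * R < n x W} = 0" by (simp only: measure_empty)
    then show ?thesis using \<delta> \<theta> by simp
  next
    case False
    then show ?thesis using n_exp[OF x] \<theta> R0
      by (intro markov_strict[OF n_int[OF x] n0]) auto
  qed
  have P_O: "prob (OS x) \<le> q" if x: "x \<in> P" for x
  proof -
    have ev: "BS x c \<in> events" if "c \<in> S" for c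
      using BS[of x c] x that S by auto
    have "prob (OS x) \<le> prob (\<Union>c\<in>S. BS x c) + prob {W \<in> space M. \<theta> * R < n x W}"
      unfolding OS_def using ev n_meas[OF x] fS by (intro measure_Un_le) auto
    also have "prob (\<Union>c\<in>S. BS x c) \<le> (\<Sum>c\<in>S. prob (BS x c))"
      using ev fS by (intro finite_measure_subadditive_finite) auto
    also have "\<dots> \<le> (\<Sum>c\<in>S. \<delta>)" using x S by (intro sum_mono PB) auto
    also have "\<dots> \<le> k * \<delta>" using S \<delta> by simp
    finally show ?thesis using P_n[OF x] by (simp add: q)
  qed
  define f1 where "f1 W = (\<Sum>x\<in>P. r x * indicator (OS x) W)" for W
  define f2 where "f2 W = (\<Sum>x\<in>P. dist (v W x) (v W (s x)) powr p * indicator (OS x) W)" for W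
  have sP: "s x \<in> P" if "x \<in> P" for x using s S that by blast
  have f0: "0 \<le> f1 W" "0 \<le> f2 W" for W unfolding f1_def f2_def by (auto intro!: sum_nonneg simp: r0)
  have i1: "integrable M (\<lambda>W. indicator (OS x) W :: real)" if "x \<in> P" for x
    using OS[OF that] by (auto simp: less_top[symmetric])
  have q0: "0 < q" unfolding q using \<delta> \<theta> by (auto intro!: add_nonneg_pos)
  have f1_int: "integrable M f1" unfolding f1_def[abs_def]
    by (intro Bochner_Integration.integrable_sum integrable_mult_right i1)
  have f1_exp: "expectation f1 \<le> q * R"
  proof -
    have "expectation f1 = (\<Sum>x\<in>P. expectation (\<lambda>W. r x * indicator (OS x) W))"
      unfolding f1_def[abs_def] by (intro Bochner_Integration.integral_sum integrable_mult_right i1)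
    also have "\<dots> = (\<Sum>x\<in>P. r x * prob (OS x))" by simp
    also have "\<dots> \<le> (\<Sum>x\<in>P. r x * q)" by (intro sum_mono mult_left_mono P_O r0)
    finally show ?thesis by (simp add: R_def sum_distrib_left mult.commute)
  qed
  have f2_x: "integrable M (\<lambda>W. dist (v W x) (v W (s x)) powr p * indicator (OS x) W) \<and>
     expectation (\<lambda>W. dist (v W x) (v W (s x)) powr p * indicator (OS x) W) \<le> (sqrt q * (m + 1)) * r x" if x: "x \<in> P" for x
  proof (cases "r x = 0")
    case True
    then have "u x = u (s x)" by (simp add: r_def)
    \<comment> \<open>\<open>r x = 0\<close> must make the distance in \<open>v\<close> vanish for
      every \<open>W\<close>; injectivity of \<open>u\<close> gives this, as \<open>x\<close> is
      then its own centre.\<close>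
    then have "x = s x" using u x sP[OF x] by (auto dest: inj_onD)
    then have "dist (v W x) (v W (s x)) = 0" for W by simp
    then show ?thesis using True by simp
  next
    case False
    then have rx: "0 < r x" using r0[of x] by simp
    let ?I = "indicator (OS x) :: 'a \<Rightarrow> real"
    let ?t = "\<lambda>W. dist (v W x) (v W (s x)) powr p"
    let ?b = "\<lambda>W. (sqrt q / r x) * dist (v W x) (v W (s x)) powr (2*p) + (r x / sqrt q) * ?I W"
    have t2: "(?t W)\<^sup>2 = dist (v W x) (v W (s x)) powr (2*p)" for W
      by (simp add: power2_eq_square flip: powr_add)
    have bnd: "?t W * ?I W \<le> ?b W" for W
    proof (cases "?I W = 0")
      case False
      then have I: "?I W = 1" by (simp add: indicator_def split: if_splits)
      \<comment> \<open>The scale \<open>sqrt q / r x\<close> balances the moment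
        \<open>m * (r x)\<^sup>2\<close> against the probability \<open>q\<close>: both terms become
        multiples of \<open>sqrt q * r x\<close>.\<close>
      have "?t W \<le> (sqrt q / r x) * (?t W)\<^sup>2 + 1 / (sqrt q / r x)"
        by (rule le_mult_square_plus_inverse) (use rx q0 in auto)
      then show ?thesis unfolding I t2 by simp
    qed (use rx q0 in simp)
    have ib: "integrable M ?b"
      by (intro Bochner_Integration.integrable_add integrable_mult_right mom i1 x sP)
    have tm[measurable]: "?t \<in> borel_measurable M" "?I \<in> borel_measurable M" using x sP OS by measurable
    have it: "integrable M (\<lambda>W. ?t W * ?I W)"
      by (rule Bochner_Integration.integrable_bound[OF ib])
        (use order_trans[OF bnd abs_ge_self] in \<open>auto simp: abs_mult\<close>)
    have "expectation (\<lambda>W. ?t W * ?I W) \<le> expectation ?b" by (intro integral_mono it ib bnd)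
    also have "\<dots> = (sqrt q / r x) * expectation (\<lambda>W. dist (v W x) (v W (s x)) powr (2*p)) + (r x / sqrt q) * prob (OS x)"
      using mom(1)[OF x sP[OF x]] i1[OF x] by simp
    also have "\<dots> \<le> (sqrt q / r x) * (m * (r x)\<^sup>2) + (r x / sqrt q) * q"
    proof (intro add_mono mult_left_mono P_O x)
      have "(r x)\<^sup>2 = dist (u x) (u (s x)) powr (2*p)"
        unfolding r_def by (simp add: power2_eq_square flip: powr_add)
      then show "expectation (\<lambda>W. dist (v W x) (v W (s x)) powr (2*p)) \<le> m * (r x)\<^sup>2"
        using mom(2)[OF x sP[OF x]] by simp
    qed (use rx q0 in auto)
    also have "\<dots> = sqrt q * (m + 1) * r x"
      using rx q0 real_sqrt_mult_self[of q] by (simp add: field_simps power2_eq_square)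
    finally show ?thesis using it by simp
  qed
  have f2_int: "integrable M f2" unfolding f2_def[abs_def]
    by (intro Bochner_Integration.integrable_sum) (use f2_x in blast)
  have f2_exp: "expectation f2 \<le> (sqrt q * (m + 1)) * R"
  proof -
    have "expectation f2 = (\<Sum>x\<in>P. expectation (\<lambda>W. dist (v W x) (v W (s x)) powr p * indicator (OS x) W))"
      unfolding f2_def[abs_def] by (intro Bochner_Integration.integral_sum) (use f2_x in blast)
    also have "\<dots> \<le> (\<Sum>x\<in>P. (sqrt q * (m + 1)) * r x)" by (intro sum_mono) (use f2_x in blast)
    finally show ?thesis by (simp add: R_def sum_distrib_left)
  qed
  have R_zero: "f1 W = 0 \<and> f2 W = 0" if "R = 0" for W
  proof -
    have "r x = 0" if "x \<in> P" for x using that \<open>R = 0\<close> P r0 by (simp add: R_def sum_nonneg_eq_0_iff)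
    moreover have "dist (v W x) (v W (s x)) = 0" if "x \<in> P" "r x = 0" for x
    proof -
      have "u x = u (s x)" using that by (simp add: r_def)
      then have "x = s x" using u that(1) sP[OF that(1)] by (auto dest: inj_onD)
      then show ?thesis by simp
    qed
    ultimately show ?thesis by (simp add: f1_def f2_def)
  qed
  have P1: "prob {W \<in> space M. \<theta>' * R < f1 W} \<le> q / \<theta>'"
  proof (cases "R = 0")
    case True
    then show ?thesis using R_zero q0 \<theta> by simp
  next
    case False
    then show ?thesis using f1_exp \<theta> R0 by (intro markov_strict[OF f1_int f0(1)]) auto
  qed
  have P2: "prob {W \<in> space M. \<theta>' * R < f2 W} \<le> sqrt q * (m + 1) / \<theta>'"
  proof (cases "R = 0")
    case True
    then show ?thesis using R_zero q0 \<theta> m by simp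
  next
    case False
    then show ?thesis using f2_exp \<theta> R0 by (intro markov_strict[OF f2_int f0(2)]) auto
  qed
  define E3 where "E3 = (\<Union>c\<in>S. \<Union>c'\<in>S. BS c c')"
  have ev: "BS c c' \<in> events" if "c \<in> S" "c' \<in> S" for c c'
    by (rule BS) (use that S in auto)
  have E3: "E3 \<in> events" unfolding E3_def using ev fS by auto
  have P3: "prob E3 \<le> (real k)\<^sup>2 * \<delta>"
  proof -
    have "prob E3 \<le> (\<Sum>c\<in>S. prob (\<Union>c'\<in>S. BS c c'))"
      unfolding E3_def using ev fS by (intro finite_measure_subadditive_finite) auto
    also have "\<dots> \<le> (\<Sum>c\<in>S. \<Sum>c'\<in>S. prob (BS c c'))"
      using ev fS by (intro sum_mono finite_measure_subadditive_finite) auto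
    also have "\<dots> \<le> (\<Sum>c\<in>S. \<Sum>c'\<in>S. \<delta>)" using S by (intro sum_mono PB) auto
    also have "\<dots> = real (card S * card S) * \<delta>" by simp
    also have "\<dots> \<le> real (k * k) * \<delta>"
      using S \<delta> by (intro mult_right_mono of_nat_mono mult_mono) auto
    finally show ?thesis by (simp add: power2_eq_square)
  qed
  define Bad where "Bad = E3 \<union> {W \<in> space M. \<theta>' * R < f1 W} \<union> {W \<in> space M. \<theta>' * R < f2 W}"
  have [measurable]: "f1 \<in> borel_measurable M" "f2 \<in> borel_measurable M" using f1_int f2_int by auto
  have m12: "{W \<in> space M. \<theta>' * R < f1 W} \<in> events" "{W \<in> space M. \<theta>' * R < f2 W} \<in> events"
    by measurable
  have Bad: "Bad \<in> events" unfolding Bad_def using E3 m12 by auto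
  have "prob Bad \<le> prob E3 + prob {W \<in> space M. \<theta>' * R < f1 W} + prob {W \<in> space M. \<theta>' * R < f2 W}"
    unfolding Bad_def using E3 m12 by (intro order_trans[OF measure_Un_le] add_right_mono measure_Un_le) auto
  also have "\<dots> \<le> (real k)\<^sup>2 * \<delta> + q / \<theta>' + sqrt q * (m + 1) / \<theta>'" using P1 P2 P3 by linarith
  finally have "1 - ((real k)\<^sup>2 * \<delta> + q / \<theta>' + sqrt q * (m + 1) / \<theta>') \<le> prob (space M - Bad)"
    using prob_compl[OF Bad] by simp
  moreover have "space M - Bad \<in> events" using Bad by auto
  moreover have "\<exists>Z. outlier_set \<eta> u (v W) P S s p (\<theta> * R) (\<theta>' * R) Z" if W: "W \<in> space M - Bad" for W
    unfolding outlier_set_def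
  proof (intro exI[of _ "{x\<in>P. W \<in> OS x}"] conjI ballI)
    have sW: "W \<in> space M" using W by simp
    show "(\<Sum>x\<in>{x\<in>P. W \<in> OS x}. dist (u x) (u (s x)) powr p) \<le> \<theta>' * R"
    proof -
      have "(\<Sum>x\<in>{x\<in>P. W \<in> OS x}. dist (u x) (u (s x)) powr p) = f1 W"
        unfolding f1_def using P sW by (intro sum.mono_neutral_cong_left) (auto simp: r_def indicator_def)
      then show ?thesis using W by (auto simp: Bad_def not_less)
    qed
    show "(\<Sum>x\<in>{x\<in>P. W \<in> OS x}. dist (v W x) (v W (s x)) powr p) \<le> \<theta>' * R"
    proof -
      have "(\<Sum>x\<in>{x\<in>P. W \<in> OS x}. dist (v W x) (v W (s x)) powr p) = f2 W"
        unfolding f2_def using P sW by (intro sum.mono_neutral_cong_left) (auto simp: indicator_def)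
      then show ?thesis using W by (auto simp: Bad_def not_less)
    qed
    fix x assume x: "x \<in> P - {x\<in>P. W \<in> OS x}"
    then have nO: "W \<notin> OS x" by auto
    show "(\<Sum>y | y \<in> P \<and> \<not> quasi_iso \<eta> u (v W) x y. dist (u y) (u (s y)) powr p) \<le> \<theta> * R"
      using nO n_eq[OF sW, of x] sW unfolding OS_def r_def by auto
    show "quasi_iso \<eta> u (v W) x c" if "c \<in> S" for c using nO that sW by (auto simp: OS_def BS_def)
  next
    fix c c' assume "c \<in> S" "c' \<in> S"
    then show "quasi_iso \<eta> u (v W) c c'" using W by (auto simp: Bad_def E3_def BS_def)
  qed auto
  ultimately show ?thesis by blast
qed

end

section \<open>Random Fourier features as a map into an inner product space\<close>

text \<open>Finitely supported sequences form a single inner product type that holds the images for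
  all dimensions, since \<open>2*D\<close> is a value and not a type. \<open>euclid_dist m\<close>
  on arbitrary sequences is only a pseudometric.\<close>

typedef fseq = "{f :: nat \<Rightarrow> real. finite {i. f i \<noteq> 0}}"
  morphisms coord Fseq
  by (rule exI[of _ "\<lambda>_. 0"]) simp

setup_lifting type_definition_fseq

instantiation fseq :: real_vector
begin
lift_definition zero_fseq :: fseq is "\<lambda>_. 0" by simp
lift_definition plus_fseq :: "fseq \<Rightarrow> fseq \<Rightarrow> fseq" is "\<lambda>f g i. f i + g i"
  subgoal for f g by (rule finite_subset[of _ "{i. f i \<noteq> 0} \<union> {i. g i \<noteq> 0}"]) auto
  done
lift_definition minus_fseq :: "fseq \<Rightarrow> fseq \<Rightarrow> fseq" is "\<lambda>f g i. f i - g i"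
  subgoal for f g by (rule finite_subset[of _ "{i. f i \<noteq> 0} \<union> {i. g i \<noteq> 0}"]) auto
  done
lift_definition uminus_fseq :: "fseq \<Rightarrow> fseq" is "\<lambda>f i. - f i" by simp
lift_definition scaleR_fseq :: "real \<Rightarrow> fseq \<Rightarrow> fseq" is "\<lambda>r f i. r * f i"
  subgoal for r f by (rule finite_subset[of _ "{i. f i \<noteq> 0}"]) auto
  done
instance
  by standard (transfer; auto simp: algebra_simps)+
end

instantiation fseq :: real_inner
begin
definition inner_fseq :: "fseq \<Rightarrow> fseq \<Rightarrow> real" where
  "inner_fseq x y = (\<Sum>i | coord x i \<noteq> 0. coord x i * coord y i)"
definition norm_fseq :: "fseq \<Rightarrow> real" where
  "norm_fseq x = sqrt (inner x x)"
definition sgn_fseq :: "fseq \<Rightarrow> fseq" where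
  "sgn_fseq x = x /\<^sub>R norm x"
definition dist_fseq :: "fseq \<Rightarrow> fseq \<Rightarrow> real" where
  "dist_fseq x y = norm (x - y)"
definition uniformity_fseq :: "(fseq \<times> fseq) filter" where
  "uniformity_fseq = (INF e\<in>{0 <..}. principal {(x, y). dist x y < e})"
definition open_fseq :: "fseq set \<Rightarrow> bool" where
  "open_fseq U \<longleftrightarrow> (\<forall>x\<in>U. \<forall>\<^sub>F (x', y) in uniformity. x' = x \<longrightarrow> y \<in> U)"

lemma finite_coord: "finite {i. coord x i \<noteq> 0}"
  using coord[of x] by simp

lemma inner_fseq_superset:
  assumes "finite A" "{i. coord x i \<noteq> 0} \<subseteq> A"
  shows "inner x y = (\<Sum>i\<in>A. coord x i * coord y i)"
  unfolding inner_fseq_def by (rule sum.mono_neutral_left) (use assms in auto)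

instance
proof
  fix x y z :: fseq and r :: real
  let ?A = "{i. coord x i \<noteq> 0} \<union> {i. coord y i \<noteq> 0}"
  have A: "finite ?A" by (simp add: finite_coord)
  show "inner x y = inner y x"
    using inner_fseq_superset[OF A, of x y] inner_fseq_superset[OF A, of y x] by (simp add: mult.commute)
  have "inner (x + y) z = (\<Sum>i\<in>?A. coord (x + y) i * coord z i)"
    by (rule inner_fseq_superset[OF A]) (auto simp: plus_fseq.rep_eq)
  also have "\<dots> = inner x z + inner y z"
    using inner_fseq_superset[OF A, of x z] inner_fseq_superset[OF A, of y z]
    by (simp add: plus_fseq.rep_eq distrib_right sum.distrib)
  finally show "inner (x + y) z = inner x z + inner y z" .
  have "inner (r *\<^sub>R x) y = (\<Sum>i | coord x i \<noteq> 0. coord (r *\<^sub>R x) i * coord y i)"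
    by (rule inner_fseq_superset[OF finite_coord]) (auto simp: scaleR_fseq.rep_eq)
  then show "inner (r *\<^sub>R x) y = r * inner x y"
    by (simp add: scaleR_fseq.rep_eq inner_fseq_def sum_distrib_left mult.assoc)
  show "0 \<le> inner x x" unfolding inner_fseq_def by (intro sum_nonneg) simp
  show "inner x x = 0 \<longleftrightarrow> x = 0"
  proof
    assume "inner x x = 0"
    then have "\<forall>i\<in>{i. coord x i \<noteq> 0}. coord x i * coord x i = 0"
      unfolding inner_fseq_def by (subst (asm) sum_nonneg_eq_0_iff) (auto simp: finite_coord)
    then have "coord x = coord 0" by (auto simp: zero_fseq.rep_eq)
    then show "x = 0" by (simp add: coord_inject)
  qed (simp add: inner_fseq_def zero_fseq.rep_eq)
qed (simp_all add: norm_fseq_def sgn_fseq_def dist_fseq_def uniformity_fseq_def open_fseq_def)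
end

lift_definition ftrunc :: "nat \<Rightarrow> (nat \<Rightarrow> real) \<Rightarrow> fseq" is "\<lambda>m f i. if i < m then f i else 0"
  by (rule finite_subset[of _ "{..<_}"]) (auto split: if_splits)

lemma dist_fseq_ftrunc: "dist (ftrunc m f) (ftrunc m g) = euclid_dist m f g"
proof -
  have "inner (ftrunc m f - ftrunc m g) (ftrunc m f - ftrunc m g) =
     (\<Sum>i<m. coord (ftrunc m f - ftrunc m g) i * coord (ftrunc m f - ftrunc m g) i)"
    by (rule inner_fseq_superset) (auto simp: minus_fseq.rep_eq ftrunc.rep_eq split: if_splits)
  also have "\<dots> = (\<Sum>i<m. (f i - g i)\<^sup>2)"
    by (intro sum.cong) (auto simp: minus_fseq.rep_eq ftrunc.rep_eq power2_eq_square)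
  finally show ?thesis by (simp add: dist_fseq_def norm_fseq_def euclid_dist_def)
qed

lemma euclid_dist_coord_le: "euclid_dist m f (coord c) \<le> dist (ftrunc m f) c"
proof -
  let ?x = "ftrunc m f - c"
  let ?A = "{i. coord ?x i \<noteq> 0} \<union> {..<m}"
  have "(\<Sum>i<m. (f i - coord c i)\<^sup>2) = (\<Sum>i<m. coord ?x i * coord ?x i)"
    by (intro sum.cong) (auto simp: minus_fseq.rep_eq ftrunc.rep_eq power2_eq_square)
  also have "\<dots> \<le> (\<Sum>i\<in>?A. coord ?x i * coord ?x i)"
    by (intro sum_mono2) (auto simp: finite_coord)
  also have "\<dots> = inner ?x ?x"
    by (rule inner_fseq_superset[symmetric]) (auto simp: finite_coord)
  finally show ?thesis by (simp add: dist_fseq_def norm_fseq_def euclid_dist_def)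
qed

lemma euclid_dist_nonneg: "0 \<le> euclid_dist m f g"
  by (simp add: euclid_dist_def sum_nonneg)

lemma clust_cost_dist: "clust_cost dist p \<phi> P k \<sigma> = ccost p k P \<sigma> \<phi>"
  by (simp add: clust_cost_def ccost_def pcost_def)

text \<open>Centres are exchanged in both directions: \<open>coord\<close> does not increase
  distances, as coordinates from \<open>m\<close> on are ignored, and \<open>ftrunc m\<close>
  preserves them. Hence the two infima agree.\<close>

lemma clust_cost_euclid_dist:
  assumes "0 \<le> p"
  shows "clust_cost (euclid_dist m) p f P k \<sigma> = ccost p k P \<sigma> (\<lambda>x. ftrunc m (f x))"
  unfolding clust_cost_def ccost_def
proof (intro sum.cong refl antisym)
  fix i
  let ?I = "{x\<in>P. \<sigma> x = i}"
  have bdd: "bdd_below (range (\<lambda>c. \<Sum>x\<in>?I. euclid_dist m (f x) c powr p))"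
    by (intro bdd_belowI2[where m=0] sum_nonneg) simp
  show "(INF c. \<Sum>x\<in>?I. euclid_dist m (f x) c powr p) \<le> pcost p ?I (\<lambda>x. ftrunc m (f x))"
  proof (rule pcost_ge)
    fix c
    have "(INF c. \<Sum>x\<in>?I. euclid_dist m (f x) c powr p) \<le> (\<Sum>x\<in>?I. euclid_dist m (f x) (coord c) powr p)"
      by (rule cINF_lower[OF bdd]) simp
    also have "\<dots> \<le> (\<Sum>x\<in>?I. dist (ftrunc m (f x)) c powr p)"
      by (intro sum_mono powr_mono2 euclid_dist_coord_le euclid_dist_nonneg assms)
    finally show "(INF c. \<Sum>x\<in>?I. euclid_dist m (f x) c powr p) \<le> (\<Sum>x\<in>?I. dist (ftrunc m (f x)) c powr p)" .
  qed
  show "pcost p ?I (\<lambda>x. ftrunc m (f x)) \<le> (INF c. \<Sum>x\<in>?I. euclid_dist m (f x) c powr p)"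
  proof (rule cINF_greatest)
    fix c
    show "pcost p ?I (\<lambda>x. ftrunc m (f x)) \<le> (\<Sum>x\<in>?I. euclid_dist m (f x) c powr p)"
      using pcost_le[of p ?I "\<lambda>x. ftrunc m (f x)" "ftrunc m c"] by (simp add: dist_fseq_ftrunc)
  qed simp
qed

definition rff_map :: "nat \<Rightarrow> (nat \<Rightarrow> real^'d) \<Rightarrow> real^'d \<Rightarrow> fseq" where
  "rff_map D W x = ftrunc (2*D) (rff D W x)"

text \<open>Coordinates \<open>j\<close> and \<open>D + j\<close> together give the squared chord of
  the unit circle between the angles \<open>W j \<bullet> x\<close> and
  \<open>W j \<bullet> y\<close>, divided by \<open>D\<close>.\<close>

lemma dist_rff_map:
  shows "(dist (rff_map D W x) (rff_map D W y))\<^sup>2 = (\<Sum>j<D. 2 - 2 * cos (W j \<bullet> (x - y))) / D"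
proof -
  let ?g = "\<lambda>j. (rff D W x j - rff D W y j)\<^sup>2"
  have "(dist (rff_map D W x) (rff_map D W y))\<^sup>2 = (\<Sum>j<2*D. ?g j)"
    by (simp add: rff_map_def dist_fseq_ftrunc euclid_dist_def sum_nonneg)
  also have "\<dots> = (\<Sum>j<D. ?g j) + (\<Sum>j\<in>{D..<2*D}. ?g j)"
    by (subst sum.union_disjoint[symmetric]) (auto intro!: sum.cong)
  also have "(\<Sum>j\<in>{D..<2*D}. ?g j) = (\<Sum>j<D. ?g (D + j))"
    by (rule sum.reindex_bij_witness[where i="\<lambda>j. D + j" and j="\<lambda>j. j - D"]) auto
  also have "(\<Sum>j<D. ?g j) + (\<Sum>j<D. ?g (D + j)) = (\<Sum>j<D. (2 - 2 * cos (W j \<bullet> (x - y))) / D)"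
    unfolding sum.distrib[symmetric]
  proof (intro sum.cong refl)
    fix j assume j: "j \<in> {..<D}"
    define a b where "a = W j \<bullet> x" and "b = W j \<bullet> y"
    have "?g j = (sin a - sin b)\<^sup>2 / D" "?g (D + j) = (cos a - cos b)\<^sup>2 / D"
      using j by (auto simp: rff_def a_def b_def power_divide simp flip: diff_divide_distrib)
    then have "?g j + ?g (D + j) = ((sin a - sin b)\<^sup>2 + (cos a - cos b)\<^sup>2) / D" by (simp add: add_divide_distrib)
    also have "(sin a - sin b)\<^sup>2 + (cos a - cos b)\<^sup>2 =
        (sin a)\<^sup>2 + (cos a)\<^sup>2 + ((sin b)\<^sup>2 + (cos b)\<^sup>2) - 2 * (cos a * cos b + sin a * sin b)"
      by algebra
    also have "\<dots> = 2 - 2 * cos (a - b)"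
      using sin_cos_squared_add[of a] sin_cos_squared_add[of b] unfolding cos_diff by linarith
    also have "a - b = W j \<bullet> (x - y)" by (simp add: a_def b_def inner_diff_right)
    finally show "?g j + ?g (D + j) = (2 - 2 * cos (W j \<bullet> (x - y))) / D" .
  qed
  finally show ?thesis by (simp add: sum_divide_distrib)
qed

section \<open>Measurability of the event over all partitions\<close>

lemma borel_measurable_INF_continuous:
  fixes F :: "'c \<Rightarrow> 'a::topological_space \<Rightarrow> real"
  assumes "\<And>c. continuous_on UNIV (F c)" "\<And>c x. 0 \<le> F c x"
  shows "(\<lambda>x. INF c. F c x) \<in> borel_measurable borel"
proof (rule borel_measurableI_less)
  fix a
  \<comment> \<open>The infimum may run over uncountably many centres, but a strict sublevel set is
    still a union of open sets.\<close>
  have "{x \<in> space borel. (INF c. F c x) < a} = (\<Union>c. {x. F c x < a})"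
    using assms(2) by (auto simp: cINF_less_iff bdd_belowI2[where m=0])
  moreover have "open (\<Union>c. {x. F c x < a})"
    by (intro open_UN ballI open_Collect_less assms continuous_on_const)
  ultimately show "{x \<in> space borel. (INF c. F c x) < a} \<in> sets borel" by simp
qed

lemma clust_cost_rff_measurable:
  fixes P :: "(real^'d) set"
  assumes p: "1 \<le> p"
  shows "(\<lambda>W. clust_cost (euclid_dist (2*D)) p (rff D W) P k \<sigma>) \<in> borel_measurable (PiM {..<D} (\<lambda>_. borel))"
proof -
  have *: "(\<lambda>W. clust_cost (euclid_dist (2*D)) p (rff D W) P k \<sigma>) \<in> borel_measurable (borel :: (nat \<Rightarrow> real^'d) measure)"
    unfolding clust_cost_def
  proof (intro borel_measurable_sum borel_measurable_INF_continuous)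
    fix i and c :: "nat \<Rightarrow> real"
    have 1: "continuous_on UNIV (\<lambda>W :: nat \<Rightarrow> real^'d. W j \<bullet> x)" for j x
      by (intro continuous_intros continuous_on_product_coordinates)
    have 2: "continuous_on UNIV (\<lambda>W :: nat \<Rightarrow> real^'d. rff D W x j)" for x j
      by (cases "j < D"; cases "j < 2*D"; simp add: rff_def divide_inverse;
          intro continuous_on_mult continuous_on_sin continuous_on_cos continuous_on_const 1)
    show "continuous_on UNIV (\<lambda>W :: nat \<Rightarrow> real^'d. \<Sum>x\<in>{x \<in> P. \<sigma> x = i}. euclid_dist (2*D) (rff D W x) c powr p)"
      unfolding euclid_dist_def
      by (intro continuous_on_sum continuous_on_powr' continuous_intros 2) (use p in \<open>auto simp: sum_nonneg\<close>)
  qed (simp add: sum_nonneg)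
  \<comment> \<open>Continuity is available on all sequences, whereas the product space has only the
    components below \<open>D\<close>; extending by 0 changes nothing, since \<open>rff D\<close>
    reads no others.\<close>
  define ext where "ext W = (\<lambda>j. if j < D then W j else 0)" for W :: "nat \<Rightarrow> real^'d"
  have "ext \<in> PiM {..<D} (\<lambda>_. borel) \<rightarrow>\<^sub>M PiM UNIV (\<lambda>_. borel)"
    unfolding ext_def[abs_def]   proof (rule measurable_PiM_single')
    fix j
    show "(\<lambda>W :: nat \<Rightarrow> real^'d. if j < D then W j else 0) \<in> PiM {..<D} (\<lambda>_. borel) \<rightarrow>\<^sub>M borel"
      by (cases "j < D") simp_all
  qed (auto simp: space_PiM)
  then have "ext \<in> PiM {..<D} (\<lambda>_. borel) \<rightarrow>\<^sub>M borel"
    by (simp add: measurable_cong_sets[OF refl sets_PiM_equal_borel])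
  then have "(\<lambda>W. clust_cost (euclid_dist (2*D)) p (rff D (ext W)) P k \<sigma>) \<in> borel_measurable (PiM {..<D} (\<lambda>_. borel))"
    by (rule measurable_compose[OF _ *])
  moreover have "rff D (ext W) = rff D W" for W
    by (intro ext) (auto simp: rff_def ext_def fun_eq_iff)
  ultimately show ?thesis by simp
qed

text \<open>Only the values of an assignment on \<open>P\<close> matter, so the quantifier over all
  assignments reduces to a finite set of extensional maps.\<close>

lemma all_clusterings_measurable:
  fixes P :: "'i set" and f :: "'a \<Rightarrow> ('i \<Rightarrow> nat) \<Rightarrow> real"
  assumes P: "finite P"
    and m: "\<And>\<sigma>. (\<lambda>W. f W \<sigma>) \<in> borel_measurable N"
    and cong: "\<And>W \<sigma> \<sigma>'. (\<And>x. x \<in> P \<Longrightarrow> \<sigma> x = \<sigma>' x) \<Longrightarrow> f W \<sigma> = f W \<sigma>' \<and> a \<sigma> = a \<sigma>' \<and> b \<sigma> = b \<sigma>'"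
  shows "{W \<in> space N. \<forall>\<sigma>. (\<forall>x\<in>P. \<sigma> x < k) \<longrightarrow> f W \<sigma> \<in> {a \<sigma> .. b \<sigma> :: real}} \<in> sets N"
proof -
  have "(\<forall>\<sigma>. (\<forall>x\<in>P. \<sigma> x < k) \<longrightarrow> f W \<sigma> \<in> {a \<sigma> .. b \<sigma>}) \<longleftrightarrow> (\<forall>\<sigma>\<in>PiE P (\<lambda>_. {..<k}). f W \<sigma> \<in> {a \<sigma> .. b \<sigma>})" for W
  proof safe
    fix \<sigma> :: "'i \<Rightarrow> nat"
    assume h: "\<forall>\<sigma>\<in>PiE P (\<lambda>_. {..<k}). f W \<sigma> \<in> {a \<sigma> .. b \<sigma>}" and s: "\<forall>x\<in>P. \<sigma> x < k"
    have "restrict \<sigma> P \<in> PiE P (\<lambda>_. {..<k})" using s by auto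
    then show "f W \<sigma> \<in> {a \<sigma> .. b \<sigma>}" using h cong[of \<sigma> "restrict \<sigma> P" W] by auto
  next
    fix \<sigma> assume h: "\<forall>\<sigma>. (\<forall>x\<in>P. \<sigma> x < k) \<longrightarrow> f W \<sigma> \<in> {a \<sigma> .. b \<sigma>}" and "\<sigma> \<in> PiE P (\<lambda>_. {..<k})"
    then have "\<forall>x\<in>P. \<sigma> x < k" by auto
    then show "f W \<sigma> \<in> {a \<sigma> .. b \<sigma>}" using h by blast
  qed
  moreover have "{W \<in> space N. \<forall>\<sigma>\<in>PiE P (\<lambda>_. {..<k}). f W \<sigma> \<in> {a \<sigma> .. b \<sigma>}} \<in> sets N"
    using m by (intro sets.sets_Collect_finite_All finite_PiE P) auto
  ultimately show ?thesis by simp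
qed

section \<open>Pairs of points under random Fourier features\<close>

lemma finite_minimizer_exists:
  fixes f :: "'i \<Rightarrow> real"
  assumes "finite I" "I \<noteq> {}"
  shows "\<exists>y\<in>I. \<forall>z\<in>I. f y \<le> f z"
  using arg_min_if_finite[OF assms, of f] by (intro bexI[of _ "arg_min_on f I"]) (auto simp: not_less)

text \<open>Replacing an arbitrary centre \<open>c\<close> by the data point nearest to it at most
  doubles all distances, and the best data point is no worse.\<close>

lemma center_selection_cluster:
  fixes u :: "'i \<Rightarrow> 'a::real_inner"
  assumes I: "finite I" "I \<noteq> {}" and p: "1 \<le> p"
  shows "\<exists>y\<in>I. (\<Sum>x\<in>I. dist (u x) (u y) powr p) \<le> 2 powr p * pcost p I u"
proof -
  let ?f = "\<lambda>y. \<Sum>x\<in>I. dist (u x) (u y) powr p"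
  obtain y where y: "y \<in> I" and min: "\<And>z. z \<in> I \<Longrightarrow> ?f y \<le> ?f z"
    using finite_minimizer_exists[OF I, of ?f] by blast
  have "?f y / 2 powr p \<le> pcost p I u"
  proof (rule pcost_ge)
    fix c
    obtain z where z: "z \<in> I" and zmin: "\<And>x. x \<in> I \<Longrightarrow> dist (u z) c \<le> dist (u x) c"
      using finite_minimizer_exists[OF I, of "\<lambda>x. dist (u x) c"] by blast
    have "?f y \<le> ?f z" by (rule min[OF z])
    also have "\<dots> \<le> (\<Sum>x\<in>I. (2 * dist (u x) c) powr p)"
    proof (intro sum_mono powr_mono2)
      fix x assume "x \<in> I"
      then show "dist (u x) (u z) \<le> 2 * dist (u x) c"
        using dist_triangle2[of "u x" "u z" c] zmin[of x] by linarith
    qed (use p in auto)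
    also have "\<dots> = 2 powr p * (\<Sum>x\<in>I. dist (u x) c powr p)"
      by (simp add: powr_mult sum_distrib_left)
    finally show "?f y / 2 powr p \<le> (\<Sum>x\<in>I. dist (u x) c powr p)" by (simp add: divide_le_eq mult.commute)
  qed
  then show ?thesis using y by (auto simp: divide_le_eq mult.commute)
qed

text \<open>The centres come from an optimal partition, whose cost bounds that of every other from
  below. They depend on \<open>u\<close> alone, so they can be fixed before the random map is drawn
  and serve all partitions at once.\<close>

lemma center_selection:
  fixes u :: "'i \<Rightarrow> 'a::real_inner"
  assumes P: "finite P" and p: "1 \<le> p" and k: "1 \<le> k"
  shows "\<exists>s S. S \<subseteq> P \<and> card S \<le> k \<and> (\<forall>x\<in>P. s x \<in> S) \<and>
    (\<forall>\<sigma>. (\<forall>x\<in>P. \<sigma> x < k) \<longrightarrow> (\<Sum>x\<in>P. dist (u x) (u (s x)) powr p) \<le> 2 powr p * ccost p k P \<sigma> u)"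
proof -
  let ?F = "PiE P (\<lambda>_. {..<k})"
  have F: "finite ?F" by (intro finite_PiE P) simp
  have "{..<k} \<noteq> {}" using k by (auto simp: lessThan_empty_iff)
  then have "?F \<noteq> {}" by (simp add: PiE_eq_empty_iff)
  then obtain \<tau> where \<tau>: "\<tau> \<in> ?F" and min: "\<And>\<sigma>. \<sigma> \<in> ?F \<Longrightarrow> ccost p k P \<tau> u \<le> ccost p k P \<sigma> u"
    using finite_minimizer_exists[OF F, of "\<lambda>\<sigma>. ccost p k P \<sigma> u"] by blast
  let ?I = "\<lambda>i. {x\<in>P. \<tau> x = i}"
  have "\<forall>i\<in>\<tau> ` P. \<exists>y. y \<in> ?I i \<and> (\<Sum>x\<in>?I i. dist (u x) (u y) powr p) \<le> 2 powr p * pcost p (?I i) u"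
  proof
    fix i assume "i \<in> \<tau> ` P"
    then have "?I i \<noteq> {}" by auto
    moreover have "finite (?I i)" using P by simp
    ultimately show "\<exists>y. y \<in> ?I i \<and> (\<Sum>x\<in>?I i. dist (u x) (u y) powr p) \<le> 2 powr p * pcost p (?I i) u"
      using center_selection_cluster[of "?I i" p u] p by blast
  qed
  from bchoice[OF this] obtain y where
    "\<forall>i\<in>\<tau> ` P. y i \<in> ?I i \<and> (\<Sum>x\<in>?I i. dist (u x) (u (y i)) powr p) \<le> 2 powr p * pcost p (?I i) u" ..
  then have y: "\<And>i. i \<in> \<tau> ` P \<Longrightarrow> y i \<in> ?I i"
    "\<And>i. i \<in> \<tau> ` P \<Longrightarrow> (\<Sum>x\<in>?I i. dist (u x) (u (y i)) powr p) \<le> 2 powr p * pcost p (?I i) u"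
    by blast+
  have \<tau>k: "\<forall>x\<in>P. \<tau> x < k" using \<tau> by auto
  define s where "s x = y (\<tau> x)" for x
  have "card (s ` P) \<le> k"
  proof -
    have "s ` P = y ` (\<tau> ` P)" by (auto simp: s_def)
    then have "card (s ` P) \<le> card (\<tau> ` P)" using P by (simp add: card_image_le)
    also have "\<dots> \<le> card {..<k}" using \<tau>k by (intro card_mono) auto
    finally show ?thesis by simp
  qed
  moreover have "s ` P \<subseteq> P" using y(1) by (auto simp: s_def)
  moreover have "(\<Sum>x\<in>P. dist (u x) (u (s x)) powr p) \<le> 2 powr p * ccost p k P \<sigma> u" if \<sigma>: "\<forall>x\<in>P. \<sigma> x < k" for \<sigma>
  proof -
    have "(\<Sum>x\<in>P. dist (u x) (u (s x)) powr p) = (\<Sum>i<k. \<Sum>x\<in>?I i. dist (u x) (u (s x)) powr p)"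
      by (rule sum_clusters[OF P \<tau>k, symmetric])
    also have "\<dots> \<le> (\<Sum>i<k. 2 powr p * pcost p (?I i) u)"
    proof (rule sum_mono)
      fix i
      show "(\<Sum>x\<in>?I i. dist (u x) (u (s x)) powr p) \<le> 2 powr p * pcost p (?I i) u"
      proof (cases "i \<in> \<tau> ` P")
        case True
        then show ?thesis using y(2)[of i] by (simp add: s_def)
      next
        case False
        then have "?I i = {}" by auto
        then show ?thesis by (simp only: sum.empty) (simp add: pcost_nonneg)
      qed
    qed
    also have "\<dots> = 2 powr p * ccost p k P \<tau> u" by (simp add: ccost_def sum_distrib_left)
    also have "ccost p k P \<tau> u \<le> ccost p k P (restrict \<sigma> P) u" using \<sigma> by (intro min) auto
    also have "ccost p k P (restrict \<sigma> P) u = ccost p k P \<sigma> u"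
      unfolding ccost_def by (intro sum.cong arg_cong[where f="\<lambda>I. pcost p I u"]) auto
    finally show ?thesis by (simp add: mult_left_mono)
  qed
  ultimately show ?thesis by (intro exI[of _ s] exI[of _ "s ` P"]) auto
qed

section \<open>Moments of the spectral measure and estimates for one pair\<close>

lemma exp_moment_norm:
  fixes M :: "(real^'d) measure"
  assumes M: "prob_space M" "sets M = sets borel"
    and comp: "\<And>i. \<exists>s>0. integrable M (\<lambda>\<omega>. exp (s * \<bar>\<omega> $ i\<bar>))" and b: "0 < b"
  shows "\<exists>s>0. integrable M (\<lambda>\<omega>. exp (s * (b * (1 + norm \<omega>))))"
proof -
  interpret prob_space M by fact
  note [measurable_cong] = M(2)
  obtain t where t: "\<And>i. 0 < t i" "\<And>i. integrable M (\<lambda>\<omega>. exp (t i * \<bar>\<omega> $ i\<bar>))" using comp by metis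
  define m where "m = Min (range t)"
  have m: "0 < m" "\<And>i. m \<le> t i" using t(1) by (auto simp: m_def)
  \<comment> \<open>The norm is at most \<open>CARD('d)\<close> times the largest component; with
    this scaling the exponential of the norm is dominated by a sum of exponentials of single
    components.\<close>
  define s where "s = m / (b * CARD('d))"
  have s: "0 < s" using m b by (simp add: s_def)
  have sb: "s * b * CARD('d) = m" using b by (simp add: s_def)
  let ?g = "\<lambda>\<omega>::real^'d. exp (s * b) * (\<Sum>i\<in>UNIV. exp (t i * \<bar>\<omega> $ i\<bar>))"
  have int: "integrable M ?g" using t(2) by (intro integrable_mult_right Bochner_Integration.integrable_sum) auto
  have bnd: "exp (s * (b * (1 + norm \<omega>))) \<le> ?g \<omega>" for \<omega> :: "real^'d"
  proof -
    obtain i where i: "\<And>j. \<bar>\<omega> $ j\<bar> \<le> \<bar>\<omega> $ i\<bar>"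
    proof -
      have "Max (range (\<lambda>j. \<bar>\<omega> $ j\<bar>)) \<in> range (\<lambda>j. \<bar>\<omega> $ j\<bar>)" by (intro Max_in) auto
      then obtain i where "Max (range (\<lambda>j. \<bar>\<omega> $ j\<bar>)) = \<bar>\<omega> $ i\<bar>" by (rule imageE)
      then have "\<bar>\<omega> $ j\<bar> \<le> \<bar>\<omega> $ i\<bar>" for j by (metis Max_ge finite finite_imageI rangeI)
      then show ?thesis using that by blast
    qed
    have "norm \<omega> \<le> (\<Sum>j\<in>UNIV. \<bar>\<omega> $ j\<bar>)" by (rule norm_le_l1_cart)
    also have "\<dots> \<le> (\<Sum>j\<in>(UNIV::'d set). \<bar>\<omega> $ i\<bar>)" by (intro sum_mono i)
    also have "\<dots> = CARD('d) * \<bar>\<omega> $ i\<bar>" by simp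
    finally have "(s * b) * norm \<omega> \<le> (s * b) * (CARD('d) * \<bar>\<omega> $ i\<bar>)" using s b by (intro mult_left_mono) auto
    also have "\<dots> = m * \<bar>\<omega> $ i\<bar>" unfolding sb[symmetric] by simp
    also have "\<dots> \<le> t i * \<bar>\<omega> $ i\<bar>" by (intro mult_right_mono m) auto
    finally have "exp (s * b * norm \<omega>) \<le> exp (t i * \<bar>\<omega> $ i\<bar>)" by simp
    also have "\<dots> \<le> (\<Sum>i\<in>UNIV. exp (t i * \<bar>\<omega> $ i\<bar>))"
      by (rule member_le_sum) auto
    finally have "exp (s * b) * exp (s * b * norm \<omega>) \<le> ?g \<omega>" by (intro mult_left_mono) auto
    then show ?thesis by (simp add: distrib_left mult.assoc flip: exp_add)
  qed
  have "integrable M (\<lambda>\<omega>. exp (s * (b * (1 + norm \<omega>))))"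
    by (rule Bochner_Integration.integrable_bound[OF int]) (use order_trans[OF bnd abs_ge_self] in auto)
  then show ?thesis using s by blast
qed

lemma spectral_measure_facts:
  fixes K :: "real^'d \<Rightarrow> real" and pK :: "real^'d \<Rightarrow> real"
  assumes K0: "K 0 = 1" and an: "analytic_at_origin K" and pos: "\<forall>\<omega>. pK \<omega> \<ge> 0"
    and m: "pK \<in> borel_measurable lborel" and int: "integrable lborel pK"
    and K: "\<forall>x. complex_of_real (K x) = (LINT \<omega>|lborel. complex_of_real (pK \<omega>) * cis (\<omega> \<bullet> x))"
  defines "M \<equiv> density lborel (\<lambda>\<omega>. ennreal (pK \<omega>))"
  shows "prob_space M" "sets M = sets borel" "\<And>z. (LINT \<omega>|M. cos (\<omega> \<bullet> z)) = K z"
    "\<exists>H s. H \<in> borel_measurable borel \<and> (\<forall>\<omega>. 0 \<le> H \<omega>) \<and> 0 < s \<and> integrable M (\<lambda>\<omega>. exp (s * H \<omega>)) \<and>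
      (\<forall>z. z \<noteq> 0 \<longrightarrow> 0 < 1 - K z \<and> (\<forall>\<omega>. 1 - cos (\<omega> \<bullet> z) \<le> (H \<omega>)\<^sup>2 * (1 - K z)))"
proof -
  have [measurable]: "pK \<in> borel_measurable borel" using m by simp
  have Kcos: "K z = (LINT \<omega>|lborel. pK \<omega> * cos (\<omega> \<bullet> z))" for z
  proof -
    have i: "integrable lborel (\<lambda>\<omega>. complex_of_real (pK \<omega>) * cis (\<omega> \<bullet> z))"
      by (rule Bochner_Integration.integrable_bound[OF int]) (auto simp: norm_mult cis_conv_exp)
    have "K z = Re (LINT \<omega>|lborel. complex_of_real (pK \<omega>) * cis (\<omega> \<bullet> z))" using K by (metis Re_complex_of_real)
    also have "\<dots> = (LINT \<omega>|lborel. Re (complex_of_real (pK \<omega>) * cis (\<omega> \<bullet> z)))"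
      using i by (rule integral_Re[symmetric])
    finally show ?thesis by simp
  qed
  \<comment> \<open>The normalisation \<open>K 0 = 1\<close> makes \<open>pK\<close> a probability
    density.\<close>
  have int1: "integral\<^sup>L lborel pK = 1" using Kcos[of 0] K0 by simp
  show P: "prob_space M"
  proof
    have "emeasure M (space M) = (\<integral>\<^sup>+ \<omega>. ennreal (pK \<omega>) \<partial>lborel)"
      by (simp add: M_def emeasure_density)
    also have "\<dots> = 1" using int pos int1 by (subst nn_integral_eq_integral) auto
    finally show "emeasure M (space M) = 1" .
  qed
  show sM: "sets M = sets borel" by (simp add: M_def)
  note [measurable_cong] = sM
  interpret prob_space M by fact
  show EK: "(LINT \<omega>|M. cos (\<omega> \<bullet> z)) = K z" for z
    unfolding M_def Kcos using pos by (subst integral_density) auto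
  have nz: "integral\<^sup>L lborel pK \<noteq> 0" using int1 by simp
  obtain C where C: "0 < C" and z0: "\<forall>z. z \<noteq> 0 \<longrightarrow> 0 < (LINT x|lborel. pK x * (1 - cos (x \<bullet> z))) \<and>
    (\<forall>x. 1 - cos (x \<bullet> z) \<le> C * (1 + norm x)\<^sup>2 * (LINT x|lborel. pK x * (1 - cos (x \<bullet> z))))"
    using integral_one_minus_cos_ge[OF int _ nz] pos by auto
  have z: "0 < (LINT x|lborel. pK x * (1 - cos (x \<bullet> z)))"
    "1 - cos (x \<bullet> z) \<le> C * (1 + norm x)\<^sup>2 * (LINT x|lborel. pK x * (1 - cos (x \<bullet> z)))" if "z \<noteq> 0" for z x
    using z0 that by blast+
  have K1: "(LINT x|lborel. pK x * (1 - cos (x \<bullet> z))) = 1 - K z" for z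
  proof -
    have "integrable lborel (\<lambda>\<omega>. pK \<omega> * cos (\<omega> \<bullet> z))"
      by (rule Bochner_Integration.integrable_bound[OF int]) (auto simp: abs_mult mult_left_le)
    then show ?thesis using int by (simp add: right_diff_distrib Kcos[of z] int1)
  qed
  have "\<exists>s>0. integrable M (\<lambda>\<omega>. exp (s * \<bar>\<omega> $ i\<bar>))" for i
  proof -
    obtain e a where e: "0 < e" and a: "\<And>t. \<bar>t\<bar> < e \<Longrightarrow> (\<lambda>n. a n * t^n) sums K (t *\<^sub>R axis i 1)"
      using analytic_at_origin_axis[OF an, of i] by blast
    have "(\<lambda>n. a n * t^n) sums expectation (\<lambda>\<omega>. cos (t * (\<omega> $ i)))" if "\<bar>t\<bar> < e" for t
    proof -
      have "expectation (\<lambda>\<omega>. cos (t * (\<omega> $ i))) = K (t *\<^sub>R axis i 1)"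
        unfolding EK[symmetric] by (simp add: inner_axis)
      then show ?thesis using a[OF that] by simp
    qed
    then show ?thesis by (intro exp_moment_of_power_series[OF _ e]) measurable
  qed
  then obtain s where s: "0 < s" "integrable M (\<lambda>\<omega>. exp (s * (sqrt C * (1 + norm \<omega>))))"
    using exp_moment_norm[OF P sM, of "sqrt C"] C by auto
  \<comment> \<open>The factor \<open>C * (1 + norm \<omega>)\<^sup>2\<close> of the lower bound
    written as a square; it does not depend on \<open>z\<close>, which gives uniformity over all
    pairs.\<close>
  define H where "H \<omega> = sqrt C * (1 + norm \<omega>)" for \<omega> :: "real^'d"
  have H2: "(H \<omega>)\<^sup>2 = C * (1 + norm \<omega>)\<^sup>2" for \<omega> using C by (simp add: H_def power_mult_distrib)
  show "\<exists>H s. H \<in> borel_measurable borel \<and> (\<forall>\<omega>. 0 \<le> H \<omega>) \<and> 0 < s \<and> integrable M (\<lambda>\<omega>. exp (s * H \<omega>)) \<and>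
      (\<forall>z. z \<noteq> 0 \<longrightarrow> 0 < 1 - K z \<and> (\<forall>\<omega>. 1 - cos (\<omega> \<bullet> z) \<le> (H \<omega>)\<^sup>2 * (1 - K z)))"
  proof (intro exI[of _ H] exI[of _ s] conjI allI impI)
    show "H \<in> borel_measurable borel" unfolding H_def by measurable
    show "0 < s" "integrable M (\<lambda>\<omega>. exp (s * H \<omega>))" using s by (simp_all add: H_def)
    show "0 \<le> H \<omega>" for \<omega> using C by (simp add: H_def)
    show "0 < 1 - K z'" if "z' \<noteq> 0" for z' using z(1)[OF that] by (simp add: K1)
    show "1 - cos (\<omega> \<bullet> z') \<le> (H \<omega>)\<^sup>2 * (1 - K z')" if "z' \<noteq> 0" for z' \<omega>
      using z(2)[OF that, of \<omega>] by (simp add: K1 H2)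
  qed
qed

text \<open>Packed into a predicate so that the constants \<open>c\<close>, \<open>B\<close>,
  \<open>s\<close>, \<open>A\<close> can be fixed before the feature map, the dimension, the
  accuracy and the points.\<close>

definition rff_pair_estimates :: "(real^'d \<Rightarrow> real) \<Rightarrow> (real^'d \<Rightarrow> 'h::real_inner) \<Rightarrow> real \<Rightarrow> real \<Rightarrow> real \<Rightarrow> real \<Rightarrow> bool" where
  "rff_pair_estimates pK \<phi> c B s A \<longleftrightarrow> (\<forall>D \<eta> p x y. 0 < \<eta> \<and> \<eta> \<le> 1 \<and> 1 \<le> real D * \<eta>\<^sup>2 \<and> 1 \<le> p \<longrightarrow>
     measure (rff_space pK D) {W \<in> space (rff_space pK D). \<not> quasi_iso \<eta> \<phi> (rff_map D W) x y}
       \<le> B * exp (- c * (real D * \<eta>\<^sup>2) powr (1/3)) \<and>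
     integrable (rff_space pK D) (\<lambda>W. dist (rff_map D W x) (rff_map D W y) powr (2*p)) \<and>
     (LINT W|rff_space pK D. dist (rff_map D W x) (rff_map D W y) powr (2*p))
       \<le> ((2*p/s) powr (2*p) * A) * dist (\<phi> x) (\<phi> y) powr (2*p))"

text \<open>Both the failure probability of a single pair and the moment bound are expressed through
  the quotient of the squared distances, which is an average of i.i.d. variables of mean one.\<close>
lemma rff_pair_bounds:
  fixes K :: "real^'d \<Rightarrow> real" and pK :: "real^'d \<Rightarrow> real"
  assumes K0: "K 0 = 1" and an: "analytic_at_origin K" and pos: "\<forall>\<omega>. pK \<omega> \<ge> 0"
    and m: "pK \<in> borel_measurable lborel" and int: "integrable lborel pK"
    and K: "\<forall>x. complex_of_real (K x) = (LINT \<omega>|lborel. complex_of_real (pK \<omega>) * cis (\<omega> \<bullet> x))"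
  shows "\<exists>c>0. \<exists>B>0. \<exists>s>0. \<exists>A>0. \<forall>\<phi> :: real^'d \<Rightarrow> 'h::real_inner.
    (\<forall>x y. \<phi> x \<bullet> \<phi> y = K (x - y)) \<longrightarrow> inj \<phi> \<and> rff_pair_estimates pK \<phi> c B s A"
proof -
  define M where "M = density lborel (\<lambda>\<omega>. ennreal (pK \<omega>))"
  note facts = spectral_measure_facts[OF K0 an pos m int K, folded M_def]
  note sM[measurable_cong] = facts(2)
  interpret prob_space M by (rule facts(1))
  obtain H s where H[measurable]: "H \<in> borel_measurable borel" and H0: "\<And>\<omega>. 0 \<le> H \<omega>" and s: "0 < s"
    and intH: "integrable M (\<lambda>\<omega>. exp (s * H \<omega>))" and K1: "\<And>z. z \<noteq> 0 \<Longrightarrow> 0 < 1 - K z"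
    and HK: "\<And>z \<omega>. z \<noteq> 0 \<Longrightarrow> 1 - cos (\<omega> \<bullet> z) \<le> (H \<omega>)\<^sup>2 * (1 - K z)"
    using facts(4) by blast
  have HM[measurable]: "H \<in> borel_measurable M" using H by measurable
  obtain c B where c: "0 < c" and B: "0 < B" and tail: "\<forall>Y D \<eta>. Y \<in> borel_measurable M \<and> (\<forall>x. 0 \<le> Y x \<and> Y x \<le> (H x)\<^sup>2) \<and> expectation Y = 1 \<and>
     0 < \<eta> \<and> \<eta> \<le> 1 \<and> 1 \<le> real D * \<eta>\<^sup>2 \<longrightarrow>
     measure (iid D) {W \<in> space (iid D). \<eta> < \<bar>(\<Sum>j<D. Y (W j)) / D - 1\<bar>} \<le> B * exp (- c * (D * \<eta>\<^sup>2) powr (1/3))"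
    using iid_average_tail[OF HM H0 s intH] by (elim exE conjE) (rule that)
  define A where "A = expectation (\<lambda>\<omega>. exp (s * H \<omega>))"
  have A: "0 < A"
  proof -
    have "expectation (\<lambda>_. 1) \<le> A" unfolding A_def
      by (intro integral_mono intH) (use s H0 in auto)
    then show ?thesis by (simp add: prob_space)
  qed
  have rs: "rff_space pK D = iid D" for D by (simp add: rff_space_def M_def)
  have main: "inj \<phi> \<and> rff_pair_estimates pK \<phi> c B s A" if \<phi>: "\<forall>x y. \<phi> x \<bullet> \<phi> y = K (x - y)" for \<phi> :: "real^'d \<Rightarrow> 'h"
  proof -
    have dphi: "(dist (\<phi> x) (\<phi> y))\<^sup>2 = 2 * (1 - K (x - y))" for x y
    proof -
      have "K (y - x) = K (x - y)" using \<phi> by (metis inner_commute)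
      then show ?thesis
        unfolding dist_norm power2_norm_eq_inner by (simp add: inner_diff_left inner_diff_right \<phi>[rule_format] K0)
    qed
    have "inj \<phi>"
    proof
      fix x y assume "\<phi> x = \<phi> y"
      then have "1 - K (x - y) = 0" using dphi[of x y] by simp
      then show "x = y" using K1[of "x - y"] by auto
    qed
    have "measure (iid D) {W \<in> space (iid D). \<not> quasi_iso \<eta> \<phi> (rff_map D W) x y}
         \<le> B * exp (- c * (real D * \<eta>\<^sup>2) powr (1/3)) \<and>
       integrable (iid D) (\<lambda>W. dist (rff_map D W x) (rff_map D W y) powr (2*p)) \<and>
       (LINT W|iid D. dist (rff_map D W x) (rff_map D W y) powr (2*p))
         \<le> ((2*p/s) powr (2*p) * A) * dist (\<phi> x) (\<phi> y) powr (2*p)"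
      if \<eta>: "0 < \<eta>" "\<eta> \<le> 1" and N: "1 \<le> real D * \<eta>\<^sup>2" and p: "1 \<le> p" for D \<eta> p x y
    proof -
    have D: "0 < D" using N by (cases D) auto
    show ?thesis
    \<comment> \<open>For \<open>x = y\<close> the normalising factor \<open>1 - K 0\<close> is 0
      and the quotient is meaningless; all distances vanish then.\<close>
    proof (cases "x = y")
      case True
      have "\<not> \<not> quasi_iso \<eta> \<phi> (rff_map D W) x y" for W
        using True by (simp add: quasi_iso_def)
      then have "{W \<in> space (iid D). \<not> quasi_iso \<eta> \<phi> (rff_map D W) x y} = {}" by blast
      then have "measure (iid D) {W \<in> space (iid D). \<not> quasi_iso \<eta> \<phi> (rff_map D W) x y} = 0"
        by (simp only: measure_empty)
      then show ?thesis using True B p by simp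
    next
      case False
      define z where "z = x - y"
      have z: "z \<noteq> 0" using False by (simp add: z_def)
      define Y where "Y \<omega> = (1 - cos (\<omega> \<bullet> z)) / (1 - K z)" for \<omega>
      have Y[measurable]: "Y \<in> borel_measurable M" unfolding Y_def by measurable
      have Y0: "0 \<le> Y \<omega>" for \<omega> using K1[OF z] by (simp add: Y_def)
      have YH: "Y \<omega> \<le> (H \<omega>)\<^sup>2" for \<omega>
        using HK[OF z, of \<omega>] K1[OF z] by (simp add: Y_def divide_le_eq)
      have EY: "expectation Y = 1"
      proof -
        have "integrable M (\<lambda>\<omega>. cos (\<omega> \<bullet> z))" by (rule integrable_const_bound[of _ 1]) auto
        then show ?thesis using K1[OF z] by (simp add: Y_def[abs_def] facts(3) prob_space)
      qed
      define avg where "avg W = (\<Sum>j<D. Y (W j)) / D" for W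
      have avg0: "0 \<le> avg W" for W unfolding avg_def by (intro divide_nonneg_nonneg sum_nonneg Y0) auto
      define d where "d = dist (\<phi> x) (\<phi> y)"
      have d0: "0 \<le> d" by (simp add: d_def)
      have d2: "d\<^sup>2 = 2 * (1 - K z)" unfolding d_def z_def by (rule dphi)
      have dv: "dist (rff_map D W x) (rff_map D W y) = sqrt (avg W) * d" for W
      proof -
        have "(dist (rff_map D W x) (rff_map D W y))\<^sup>2 = (\<Sum>j<D. 2 - 2 * cos (W j \<bullet> z)) / D"
          unfolding z_def by (rule dist_rff_map)
        also have "\<dots> = (\<Sum>j<D. Y (W j) * d\<^sup>2) / D"
        proof -
          have cancel: "a / b * (2 * b) = 2 * a" if "b \<noteq> 0" for a b :: real using that by simp
          have "1 - K z \<noteq> 0" using K1[OF z] by simp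
          then have "2 - 2 * cos t = (1 - cos t) / (1 - K z) * d\<^sup>2" for t
            unfolding d2 by (subst cancel) auto
          then show ?thesis by (simp only: Y_def)
        qed
        also have "\<dots> = (sqrt (avg W) * d)\<^sup>2"
          using avg0[of W] unfolding power_mult_distrib by (simp add: avg_def sum_distrib_right)
        finally show ?thesis using avg0 d0 by (simp add: power2_eq_iff_nonneg)
      qed
      interpret N: prob_space "iid D" by (rule prob_space_iid)
      \<comment> \<open>A deviation of at most \<eta> in the squared ratio yields both inequalities,
        by (1 - \<eta>)^2 \<le> 1 - \<eta> and (1 - \<eta>)^2 (1 + \<eta>) \<le> 1.\<close>
      have qi: "quasi_iso \<eta> \<phi> (rff_map D W) x y" if "\<not> \<eta> < \<bar>avg W - 1\<bar>" for W
      proof -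
        have a: "1 - \<eta> \<le> avg W" "avg W \<le> 1 + \<eta>" using that by linarith+
        have "(1 - \<eta>)\<^sup>2 \<le> 1 - \<eta>" using \<eta> by (simp add: power2_eq_square mult_left_le)
        then have 1: "1 - \<eta> \<le> sqrt (avg W)" using a by (intro real_le_rsqrt) auto
        have "((1 - \<eta>) * sqrt (avg W))\<^sup>2 = (1 - \<eta>)\<^sup>2 * avg W" using avg0 by (simp add: power_mult_distrib)
        also have "\<dots> \<le> (1 - \<eta>)\<^sup>2 * (1 + \<eta>)" using a by (intro mult_left_mono) auto
        also have "\<dots> = (1 - \<eta>\<^sup>2) * (1 - \<eta>)" by (simp add: power2_eq_square algebra_simps)
        also have "\<dots> \<le> 1 * 1" using \<eta> by (intro mult_mono) (auto simp: power_le_one)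
        finally have "((1 - \<eta>) * sqrt (avg W))\<^sup>2 \<le> 1\<^sup>2" by simp
        then have 2: "(1 - \<eta>) * sqrt (avg W) \<le> 1" by (rule power2_le_imp_le) simp
        show ?thesis unfolding quasi_iso_def dv d_def[symmetric]
          using mult_right_mono[OF 1 d0] mult_right_mono[OF 2 d0] by (simp add: mult.assoc)
      qed
      have m1: "measure (iid D) {W \<in> space (iid D). \<not> quasi_iso \<eta> \<phi> (rff_map D W) x y}
         \<le> B * exp (- c * (real D * \<eta>\<^sup>2) powr (1/3))"
      proof -
        have "measure (iid D) {W \<in> space (iid D). \<not> quasi_iso \<eta> \<phi> (rff_map D W) x y}
          \<le> measure (iid D) {W \<in> space (iid D). \<eta> < \<bar>(\<Sum>j<D. Y (W j)) / D - 1\<bar>}"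
          using qi by (intro N.finite_measure_mono) (auto simp: avg_def)
        also have "\<dots> \<le> B * exp (- c * (D * \<eta>\<^sup>2) powr (1/3))"
          by (rule tail[rule_format]) (use Y Y0 YH EY \<eta> N in auto)
        finally show ?thesis .
      qed
      have pw: "(sqrt (avg W) * d) powr (2*p) = d powr (2*p) * avg W powr p" for W
      proof -
        have "(sqrt (avg W) * d) powr (2*p) = ((sqrt (avg W))\<^sup>2) powr p * d powr (2*p)"
          using avg0[of W] d0 by (simp add: powr_mult power2_powr del: real_sqrt_pow2)
        then show ?thesis using avg0[of W] by simp
      qed
      note mom = iid_average_moment[OF HM H0 s intH Y Y0 YH p D, folded avg_def A_def]
      have m2: "integrable (iid D) (\<lambda>W. dist (rff_map D W x) (rff_map D W y) powr (2*p))"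
        unfolding dv pw using mom(1) by simp
      have m3: "(LINT W|iid D. dist (rff_map D W x) (rff_map D W y) powr (2*p))
         \<le> ((2*p/s) powr (2*p) * A) * dist (\<phi> x) (\<phi> y) powr (2*p)"
        unfolding dv pw using mult_left_mono[OF mom(2), of "d powr (2*p)"] by (simp add: d_def mult_ac)
      show ?thesis using m1 m2 m3 by blast
    qed
  qed
    with \<open>inj \<phi>\<close> show ?thesis unfolding rff_pair_estimates_def rs by blast
  qed
  show ?thesis
    by (rule exI[of _ c], rule conjI[OF c], rule exI[of _ B], rule conjI[OF B], rule exI[of _ s], rule conjI[OF s],
        rule exI[of _ A], rule conjI[OF A]) (use main in blast)
qed

section \<open>Choice of parameters\<close>

text \<open>Nine is the convexity constant for three summands, attained when they are equal; the
  difference is written through squares and the inequality of arithmetic and geometric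
  means.\<close>

lemma sum3_cube_le:
  fixes x y z :: real
  assumes "0 \<le> x" "0 \<le> y" "0 \<le> z"
  shows "(x + y + z)^3 \<le> 9 * (x^3 + y^3 + z^3)"
proof -
  have *: "0 \<le> (a + b) * (a - b)\<^sup>2" if "0 \<le> a" "0 \<le> b" for a b :: real using that by simp
  have "0 \<le> (x + y + z) * ((x - y)\<^sup>2 + (y - z)\<^sup>2 + (z - x)\<^sup>2)" using assms by simp
  then have amgm: "3 * (x * y * z) \<le> x^3 + y^3 + z^3"
    by (simp add: power2_eq_square power3_eq_cube algebra_simps)
  have "9 * (x^3 + y^3 + z^3) - (x + y + z)^3 =
     3 * ((x + y) * (x - y)\<^sup>2 + (y + z) * (y - z)\<^sup>2 + (z + x) * (z - x)\<^sup>2) + 2 * (x^3 + y^3 + z^3 - 3 * (x * y * z))"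
    by algebra
  moreover have "0 \<le> \<dots>" using *[of x y] *[of y z] *[of z x] assms amgm by simp
  ultimately show ?thesis by linarith
qed

lemma le_exp_of_ln_le: "0 < x \<Longrightarrow> ln x \<le> y \<Longrightarrow> x \<le> exp y" for x y :: real
  by (metis exp_le_cancel_iff exp_ln)

text \<open>Everything in the failure budget is at most a fixed power of \<open>exp S\<close>, so
  only logarithms are compared. In \<open>1 / \<theta>\<close> the power \<open>p + 1\<close> is
  applied to \<open>6/\<eta>/\<kappa>\<close>, whose logarithm is of order p + ln (1 / \<epsilon>);
  this produces the summands p ln (1 / \<epsilon>) and p^2 of \<open>S\<close>. The part of
  \<open>a\<close> with \<open>s\<close> and \<open>A\<close> comes from the moment factor.\<close>

lemma parameter_bounds:
  fixes p \<epsilon> \<delta> s A :: real and k :: nat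
  assumes p: "1 \<le> p" and k: "1 \<le> k" and \<epsilon>: "0 < \<epsilon>" "\<epsilon> < 1" and \<delta>: "0 < \<delta>" "\<delta> < 1" and s: "0 < s" and A: "0 < A"
  defines "S \<equiv> ln (real k / \<delta>) + p * ln (1 / \<epsilon>) + p\<^sup>2"
    and "e \<equiv> \<epsilon> / 20"
  defines "\<eta> \<equiv> e / (8 * p)" and "\<kappa> \<equiv> e / (2 * 2 powr p * p)"
  defines "\<theta> \<equiv> e / (k * (p * (6/\<eta>/\<kappa>) powr (p+1)) * 2 powr p)"
    and "\<theta>' \<equiv> e / ((1 + 2*p/e) powr p * 2 powr p)"
    and "a \<equiv> 100 + 2 * \<bar>ln s\<bar> + \<bar>ln A\<bar>"
  shows "1 \<le> S" "real k \<le> exp (a * S)" "1 / \<delta> \<le> exp (a * S)" "0 < \<theta>" "1 / \<theta> \<le> exp (a * S)"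
    "0 < \<theta>'" "1 / \<theta>' \<le> exp (a * S)" "(2*p/s) powr (2*p) * A + 1 \<le> exp (a * S)"
proof -
  define l where "l = ln (1/\<epsilon>)"
  have l0: "0 \<le> l" using \<epsilon> by (simp add: l_def)
  have lk: "0 \<le> ln (real k)" using k by simp
  have ld: "0 \<le> ln (1/\<delta>)" using \<delta> by simp
  have lkd: "ln (real k / \<delta>) = ln (real k) + ln (1/\<delta>)" using k \<delta> by (simp add: ln_div)
  have S_eq: "S = ln (real k) + ln (1/\<delta>) + p * l + p\<^sup>2" by (simp add: S_def l_def lkd)
  have pl: "l \<le> p * l" "0 \<le> p * l" using mult_right_mono[OF p l0] l0 p by auto
  have "p \<le> p\<^sup>2" using mult_left_mono[OF p, of p] p by (simp add: power2_eq_square)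
  then have p2: "p \<le> p\<^sup>2" "1 \<le> p\<^sup>2" using p by linarith+
  have S1: "1 \<le> S" and Sl: "l \<le> S" "p * l \<le> S" and Sp: "p\<^sup>2 \<le> S" "p \<le> S"
    and Sk: "ln (real k) \<le> S" and Sd: "ln (1/\<delta>) \<le> S"
    using lk ld pl p2 unfolding S_eq by linarith+
  show "1 \<le> S" by (rule S1)
  have aS: "100 * S \<le> a * S" using S1 by (intro mult_right_mono) (auto simp: a_def)
  then have aS': "S \<le> a * S" using S1 by linarith
  have lnp: "0 \<le> ln p" "ln p \<le> p" using p ln_le_minus_one[of p] by auto
  have e: "0 < e" using \<epsilon> by (simp add: e_def)
  have ln20: "ln (20::real) \<le> 4"
  proof -
    have "ln (20::real) \<le> ln (2^5)" by (subst ln_le_cancel_iff) auto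
    also have "\<dots> = 5 * ln 2" by (subst ln_realpow) auto
    also have "\<dots> \<le> 5 * (4/5)" using ln2_le_25_over_36 by simp
    finally show ?thesis by simp
  qed
  have ln2: "0 \<le> ln (2::real)" "ln (2::real) \<le> 1" using ln_le_minus_one[of 2] by auto
  have le: "ln (1/e) \<le> 4 + l"
  proof -
    have "ln (1/e) = ln 20 + l" using \<epsilon> by (simp add: e_def l_def ln_div)
    then show ?thesis using ln20 by simp
  qed
  have e1: "e \<le> 1" using \<epsilon> by (simp add: e_def)
  show "real k \<le> exp (a * S)" by (rule le_exp_of_ln_le) (use k in simp, use Sk aS' in linarith)
  show "1 / \<delta> \<le> exp (a * S)" by (rule le_exp_of_ln_le) (use \<delta> in simp, use Sd aS' in linarith)
  define X where "X = 6/\<eta>/\<kappa>"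
  \<comment> \<open>\<open>96 = 6 * 8 * 2\<close> collects the constants of \<open>\<eta>\<close>
    and \<open>\<kappa>\<close>; the factor \<open>2 powr p\<close> from \<open>\<kappa>\<close>
    makes \<open>ln X\<close> grow linearly in \<open>p\<close>.\<close>
  have X_eq: "X = 96 * p\<^sup>2 * 2 powr p * (1/e)\<^sup>2"
    using p e by (simp add: X_def \<eta>_def \<kappa>_def field_simps power2_eq_square)
  have X0: "0 < X" unfolding X_eq using p e by simp
  have lnX: "ln X \<le> 13 + 3 * p + 2 * l"
  proof -
    have "ln X = ln 96 + 2 * ln p + p * ln 2 + 2 * ln (1/e)"
      unfolding X_eq using p e by (simp add: ln_mult ln_realpow ln_powr ln_div)
    moreover have "ln (96::real) \<le> 5"
    proof -
      have "ln (96::real) \<le> ln (2^7)" by (subst ln_le_cancel_iff) auto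
      also have "\<dots> = 7 * ln 2" by (subst ln_realpow) auto
      also have "\<dots> \<le> 7 * (5/7)" using ln2_le_25_over_36 by simp
      finally show ?thesis by simp
    qed
    moreover have "p * ln 2 \<le> p * 1" using p ln2 by (intro mult_left_mono) auto
    moreover have "2 * ln p \<le> 2 * p" using lnp by simp
    ultimately show ?thesis using le by linarith
  qed
  have \<theta>_eq: "1 / \<theta> = k * p * X powr (p+1) * 2 powr p * (1/e)"
    unfolding \<theta>_def X_def[symmetric] using e by (simp add: mult_ac)
  show "0 < \<theta>" unfolding \<theta>_def X_def[symmetric] using X0 p k e by simp
  show "1 / \<theta> \<le> exp (a * S)"
  proof (rule le_exp_of_ln_le)
    show "0 < 1 / \<theta>" using \<open>0 < \<theta>\<close> by simp
    have "ln (1/\<theta>) = ln (real k) + ln p + (p+1) * ln X + p * ln 2 + ln (1/e)"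
      unfolding \<theta>_eq using X0 p k e by (simp add: ln_mult ln_powr ln_div)
    moreover have "(p+1) * ln X \<le> (p+1) * (13 + 3 * p + 2 * l)" using lnX p by (intro mult_left_mono) auto
    moreover have "(p+1) * (13 + 3 * p + 2 * l) = 13 + 16 * p + 3 * p\<^sup>2 + 2 * (p * l) + 2 * l"
      by (simp add: algebra_simps power2_eq_square)
    moreover have "p * ln 2 \<le> p * 1" using p ln2 by (intro mult_left_mono) auto
    ultimately have "ln (1/\<theta>) \<le> 100 * S" using Sk lnp Sp Sl S1 le by linarith
    then show "ln (1/\<theta>) \<le> a * S" using aS by linarith
  qed
  have Y0: "0 < 1 + 2*p/e" using p e by (simp add: add_pos_nonneg)
  have lnY: "ln (1 + 2*p/e) \<le> 7 + p + l"
  proof -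
    have "1 \<le> p / e" using p e e1 by (simp add: le_divide_eq)
    moreover have "2*p/e = 2 * (p/e)" "4 * p * (1/e) = 4 * (p/e)" by simp_all
    ultimately have "1 + 2*p/e \<le> 4 * p * (1/e)" by linarith
    then have "ln (1 + 2*p/e) \<le> ln (4 * p * (1/e))" using Y0 p e by (subst ln_le_cancel_iff) auto
    also have "\<dots> = ln (2^2) + ln p + ln (1/e)" using p e by (simp add: ln_mult ln_div)
    also have "ln ((2::real)^2) = 2 * ln 2" by (subst ln_realpow) auto
    finally show ?thesis using ln2 lnp le by linarith
  qed
  have \<theta>'_eq: "1 / \<theta>' = (1 + 2*p/e) powr p * 2 powr p * (1/e)" unfolding \<theta>'_def by simp
  show "0 < \<theta>'" unfolding \<theta>'_def using Y0 e by simp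
  show "1 / \<theta>' \<le> exp (a * S)"
  proof (rule le_exp_of_ln_le)
    show "0 < 1 / \<theta>'" using \<open>0 < \<theta>'\<close> by simp
    have "ln (1/\<theta>') = p * ln (1 + 2*p/e) + p * ln 2 + ln (1/e)"
      unfolding \<theta>'_eq using Y0 e by (simp add: ln_mult ln_powr ln_div)
    moreover have "p * ln (1 + 2*p/e) \<le> p * (7 + p + l)" using lnY p by (intro mult_left_mono) auto
    moreover have "p * (7 + p + l) = 7 * p + p\<^sup>2 + p * l" by (simp add: algebra_simps power2_eq_square)
    moreover have "p * ln 2 \<le> p * 1" using p ln2 by (intro mult_left_mono) auto
    ultimately have "ln (1/\<theta>') \<le> 100 * S" using Sp Sl S1 le by linarith
    then show "ln (1/\<theta>') \<le> a * S" using aS by linarith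
  qed
  define m where "m = (2*p/s) powr (2*p) * A"
  define b where "b = 2 * \<bar>ln s\<bar> + \<bar>ln A\<bar>"
  have m0: "0 < m" using p s A by (simp add: m_def)
  have lnm: "ln m \<le> (10 + b) * S"
  proof -
    have "ln m = 2*p * (ln 2 + ln p - ln s) + ln A"
      unfolding m_def using p s A by (simp add: ln_mult ln_powr ln_div)
    also have "\<dots> \<le> 2*p * (1 + p + \<bar>ln s\<bar>) + \<bar>ln A\<bar> * 1"
      using ln2 lnp p by (intro add_mono mult_left_mono) auto
    also have "\<dots> = 2 * p + 2 * p\<^sup>2 + (2 * \<bar>ln s\<bar>) * p + \<bar>ln A\<bar> * 1"
      by (simp add: algebra_simps power2_eq_square)
    also have "\<dots> \<le> 2 * S + 2 * S + (2 * \<bar>ln s\<bar>) * S + \<bar>ln A\<bar> * S"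
      using Sp S1 by (intro add_mono mult_left_mono) auto
    finally show ?thesis using S1 by (simp add: b_def algebra_simps)
  qed
  have b0: "0 \<le> b * S" using S1 by (simp add: b_def)
  have "m \<le> exp ((10 + b) * S)" using m0 lnm by (rule le_exp_of_ln_le)
  moreover have "1 \<le> exp ((10 + b) * S)" using S1 b0 by (simp add: distrib_right)
  \<comment> \<open>The extra summand 1 is absorbed by one more factor \<open>exp S\<close>, which
    is at least 2.\<close>
  moreover have "2 * exp ((10 + b) * S) \<le> exp S * exp ((10 + b) * S)"
  proof (intro mult_right_mono)
    show "2 \<le> exp S" using exp_ge_add_one_self[of S] S1 by linarith
  qed simp
  ultimately have "m + 1 \<le> exp S * exp ((10 + b) * S)" by linarith
  also have "\<dots> = exp ((11 + b) * S)" by (simp add: distrib_right flip: exp_add)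
  also have "\<dots> \<le> exp (a * S)" using S1 by (simp add: a_def b_def)
  finally show "(2*p/s) powr (2*p) * A + 1 \<le> exp (a * S)" by (simp add: m_def)
qed

text \<open>The term with \<open>sqrt q\<close> decides the exponent 8: for
  \<open>sqrt q * E\<^sup>2\<close> to be below \<open>1 / E\<close>, \<open>q\<close> has to be of
  order \<open>1 / E^6\<close> and \<open>\<delta>'\<close> of order \<open>1 / E^7\<close>; the
  eighth power leaves room.\<close>

lemma failure_budget:
  fixes E \<delta> \<delta>' \<theta> \<theta>' m q k :: real
  assumes E: "1 \<le> E" and k: "0 \<le> k" "k \<le> E" and \<delta>: "0 < \<delta>" "1/\<delta> \<le> E" and \<theta>: "0 < \<theta>" "1/\<theta> \<le> E" "0 < \<theta>'" "1/\<theta>' \<le> E"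
    and m: "0 \<le> m" "m + 1 \<le> E" and \<delta>': "0 < \<delta>'" "16 * E^8 * \<delta>' \<le> 1" and q: "q = k * \<delta>' + \<delta>' / \<theta>"
  shows "k\<^sup>2 * \<delta>' + q / \<theta>' + sqrt q * (m + 1) / \<theta>' \<le> \<delta>"
proof -
  have E0: "0 < E" using E by simp
  have "\<delta>' / \<theta> \<le> \<delta>' * E" using mult_left_mono[OF \<theta>(2), of \<delta>'] \<delta>' by simp
  moreover have "k * \<delta>' \<le> E * \<delta>'" using k \<delta>' by (intro mult_right_mono) auto
  ultimately have q2: "q \<le> 2 * (E * \<delta>')" by (simp add: q mult.commute)
  have q0: "0 \<le> q" unfolding q using k \<delta>' \<theta> by (intro add_nonneg_nonneg) auto
  have d8: "\<delta>' \<le> 1 / (16 * E^8)" using \<delta>'(2) E0 by (simp add: le_divide_eq mult_ac)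
  have dE: "1 / E \<le> \<delta>" using \<delta> E0 by (simp add: field_simps)
  have "k\<^sup>2 * \<delta>' \<le> E\<^sup>2 * \<delta>'" using k \<delta>' by (intro mult_right_mono power_mono) auto
  moreover have "q / \<theta>' \<le> 2 * (E * \<delta>') * E"
    using mult_mono[OF q2 \<theta>(4)] q0 \<theta> \<delta>' E0 by simp
  ultimately have "k\<^sup>2 * \<delta>' + q / \<theta>' \<le> 3 * E\<^sup>2 * \<delta>'" by (simp add: power2_eq_square algebra_simps)
  also have "\<dots> \<le> 3 * E\<^sup>2 * (1 / (16 * E^8))" using d8 by (intro mult_left_mono) auto
  also have "\<dots> = (3/16) * (1 / E) * (1 / E^5)" using E0 by (simp add: field_simps power_numeral_reduce)
  also have "\<dots> \<le> (3/16) * (1/E) * 1" using E E0 by (intro mult_left_mono) (auto simp: one_le_power)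
  also have "\<dots> \<le> 1 / E / 2" using E0 by (simp add: field_simps)
  finally have 1: "k\<^sup>2 * \<delta>' + q / \<theta>' \<le> 1 / E / 2" .
  have "q \<le> 2 * (E * (1 / (16 * E^8)))"
    using q2 mult_left_mono[OF d8, of E] E0 by linarith
  also have "\<dots> = 1 / (8 * E^7)" using E0 by (simp add: field_simps power_numeral_reduce)
  also have "\<dots> \<le> 1 / (4 * E^6)"
  proof (intro divide_left_mono)
    have "4 * (1 * E^6) \<le> 8 * (E * E^6)" using E by (intro mult_mono) auto
    then show "4 * E^6 \<le> 8 * E^7" by (simp add: power_numeral_reduce)
  qed (use E0 in auto)
  also have "\<dots> = (1 / (2 * E^3))\<^sup>2" by (simp add: power_divide power_mult_distrib flip: power_mult)
  finally have sq: "sqrt q \<le> 1 / (2 * E^3)" using E0 by (intro real_le_lsqrt) auto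
  have "sqrt q * (m + 1) / \<theta>' = sqrt q * (m + 1) * (1/\<theta>')" by simp
  also have "\<dots> \<le> 1 / (2 * E^3) * E * E"
    using sq m \<theta> E0 q0 by (intro mult_mono) auto
  also have "\<dots> = 1 / E / 2" using E0 by (simp add: field_simps power_numeral_reduce)
  finally show ?thesis using 1 dE by linarith
qed

lemma clust_cost_cong:
  assumes "\<And>x. x \<in> P \<Longrightarrow> \<sigma> x = \<sigma>' x"
  shows "clust_cost d p f P k \<sigma> = clust_cost d p f P k \<sigma>'"
proof -
  have "{x\<in>P. \<sigma> x = i} = {x\<in>P. \<sigma>' x = i}" for i using assms by auto
  then show ?thesis by (simp add: clust_cost_def)
qed

text \<open>\<open>230400 = 9 * 160\<^sup>2\<close>: the 9 from the cube of a sum,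
  \<open>160 = 20 * 8\<close> from the accuracy \<epsilon> / (160 p). The factor p^2 turns the cubes
  (p l')^3 and p^6 into p^5 l'^3 and p^8.\<close>

lemma dimension_bound:
  fixes p \<epsilon> g l l' :: real and D :: nat
  assumes p: "1 \<le> p" and \<epsilon>: "0 < \<epsilon>" and g: "0 \<le> g" and l: "0 \<le> l" "0 \<le> l'"
    and D: "real D \<ge> 230400 * g^3 * (p^2 * l^3 + p^5 * l'^3 + p^8) / \<epsilon>^2"
  shows "(g * (l + p * l' + p\<^sup>2))^3 \<le> real D * (\<epsilon> / 20 / (8 * p))\<^sup>2"
proof -
  have "(g * (l + p * l' + p\<^sup>2))^3 \<le> g^3 * (9 * (l^3 + (p * l')^3 + (p\<^sup>2)^3))"
    unfolding power_mult_distrib[of g] using p g l by (intro mult_left_mono sum3_cube_le) auto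
  also have "\<dots> = 230400 * g^3 * (p^2 * l^3 + p^5 * l'^3 + p^8) / \<epsilon>^2 * (\<epsilon> / 20 / (8 * p))\<^sup>2"
    using p \<epsilon> by (simp add: field_simps power_numeral_reduce)
  also have "\<dots> \<le> real D * (\<epsilon> / 20 / (8 * p))\<^sup>2" by (intro mult_right_mono D) auto
  finally show ?thesis .
qed

theorem theorem3p5:
  fixes K :: "real^'d \<Rightarrow> real" and pK :: "real^'d \<Rightarrow> real"
  assumes "K 0 = 1"
    and "analytic_at_origin K"
    and "\<forall>\<omega>. pK \<omega> \<ge> 0"
    and "pK \<in> borel_measurable lborel"
    and "integrable lborel pK"
    and "\<forall>x. complex_of_real (K x) =
               (LINT \<omega>|lborel. complex_of_real (pK \<omega>) * cis (\<omega> \<bullet> x))"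
  shows "\<exists>C>0. \<forall>(\<phi>::real^'d \<Rightarrow> 'h::{real_inner,complete_space}) (p::real) (k::nat)
            (\<epsilon>::real) (\<delta>::real) (D::nat) (P::(real^'d) set).
     (\<forall>x y. \<phi> x \<bullet> \<phi> y = K (x - y)) \<and> p \<ge> 1 \<and> k \<ge> 1 \<and> 0 < \<epsilon> \<and> \<epsilon> < 1 \<and> 0 < \<delta> \<and> \<delta> < 1 \<and>
     finite P \<and>
     real D \<ge> C * (p^2 * (ln (real k / \<delta>))^3 + p^5 * (ln (1 / \<epsilon>))^3 + p^8) / \<epsilon>^2
     \<longrightarrow>
     measure (rff_space pK D)
       {W \<in> space (rff_space pK D). \<forall>\<sigma>. (\<forall>x\<in>P. \<sigma> x < k) \<longrightarrow>
          clust_cost (euclid_dist (2*D)) p (rff D W) P k \<sigma>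
            \<in> {(1 - \<epsilon>) * clust_cost dist p \<phi> P k \<sigma> .. (1 + \<epsilon>) * clust_cost dist p \<phi> P k \<sigma>}}
     \<ge> 1 - \<delta>"
proof -
  obtain c B s A where c: "0 < c" and B: "0 < B" and s: "0 < s" and A: "0 < A"
    and pair: "\<forall>\<phi> :: real^'d \<Rightarrow> 'h. (\<forall>x y. \<phi> x \<bullet> \<phi> y = K (x - y)) \<longrightarrow> inj \<phi> \<and> rff_pair_estimates pK \<phi> c B s A"
    using rff_pair_bounds[OF assms, where 'h='h] by (elim exE conjE) (rule that)
  define a where "a = 100 + 2 * \<bar>ln s\<bar> + \<bar>ln A\<bar>"
  \<comment> \<open>Large enough for the exponent \<open>c * (g * S)\<close> to outweigh both
    \<open>E^8\<close> and the constant \<open>16 * B\<close>, using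
    \<open>1 \<le> S\<close>.\<close>
  define g where "g = max 1 ((8 * a + \<bar>ln (16 * B)\<bar>) / c)"
  have "(8 * a + \<bar>ln (16 * B)\<bar>) / c \<le> g" by (simp add: g_def)
  then have "8 * a + \<bar>ln (16 * B)\<bar> \<le> c * g"
    using c by (simp add: pos_divide_le_eq mult.commute)
  moreover have "1 \<le> g" by (simp add: g_def)
  ultimately have g: "1 \<le> g" "8 * a + \<bar>ln (16 * B)\<bar> \<le> c * g" by simp_all
  have ps: "prob_space (rff_space pK D)" and sets_rff: "sets (rff_space pK D) = sets (PiM {..<D} (\<lambda>_. borel))" for D
  proof -
    have "prob_space (density lborel (\<lambda>\<omega>. ennreal (pK \<omega>)))" by (rule spectral_measure_facts(1)[OF assms])
    then show "prob_space (rff_space pK D)" unfolding rff_space_def by (intro prob_space_PiM)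
    show "sets (rff_space pK D) = sets (PiM {..<D} (\<lambda>_. borel))"
      unfolding rff_space_def by (intro sets_PiM_cong) simp_all
  qed
  have main: "1 - \<delta> \<le> measure (rff_space pK D)
       {W \<in> space (rff_space pK D). \<forall>\<sigma>. (\<forall>x\<in>P. \<sigma> x < k) \<longrightarrow>
          clust_cost (euclid_dist (2*D)) p (rff D W) P k \<sigma>
            \<in> {(1 - \<epsilon>) * clust_cost dist p \<phi> P k \<sigma> .. (1 + \<epsilon>) * clust_cost dist p \<phi> P k \<sigma>}}"
    if \<phi>: "\<forall>x y. \<phi> x \<bullet> \<phi> y = K (x - y)" and p: "1 \<le> p" and k: "1 \<le> k" and \<epsilon>: "0 < \<epsilon>" "\<epsilon> < 1" and \<delta>: "0 < \<delta>" "\<delta> < 1"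
      and P: "finite P" and D: "real D \<ge> 230400 * g^3 * (p^2 * (ln (real k / \<delta>))^3 + p^5 * (ln (1 / \<epsilon>))^3 + p^8) / \<epsilon>^2"
    for \<phi> :: "real^'d \<Rightarrow> 'h" and p :: real and k :: nat and \<epsilon> \<delta> :: real and D :: nat and P :: "(real^'d) set"
  proof -
    interpret N: prob_space "rff_space pK D" by (rule ps)
    define S where "S = ln (real k / \<delta>) + p * ln (1 / \<epsilon>) + p\<^sup>2"
    \<comment> \<open>The comparison \<open>ccost_close\<close> loses \<open>20 * e\<close>; the
      parameters after it are read off from its conditions \<open>e1\<close> to
      \<open>e4\<close>.\<close>
    define e where "e = \<epsilon> / 20"
    define \<eta> where "\<eta> = e / (8 * p)"
    define \<kappa> where "\<kappa> = e / (2 * 2 powr p * p)"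
    define \<theta> where "\<theta> = e / (k * (p * (6/\<eta>/\<kappa>) powr (p+1)) * 2 powr p)"
    define \<theta>' where "\<theta>' = e / ((1 + 2*p/e) powr p * 2 powr p)"
    define m where "m = (2*p/s) powr (2*p) * A"
    note params = parameter_bounds[OF p k \<epsilon> \<delta> s A, folded S_def e_def, folded \<eta>_def \<kappa>_def, folded \<theta>_def \<theta>'_def m_def a_def]
    have e: "0 < e" "e \<le> 1/20" using \<epsilon> by (auto simp: e_def)
    have \<eta>: "0 < \<eta>" "\<eta> \<le> 1/4" using e p by (auto simp: \<eta>_def divide_le_eq)
    have p2: "1 \<le> 2 powr p" using p by (simp add: ge_one_powr_ge_zero)
    have pp: "1 \<le> 2 powr p * p" using mult_mono[OF p2 p] by simp
    have \<kappa>: "0 < \<kappa>" "\<kappa> \<le> 1"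
      unfolding \<kappa>_def using e p pp by (auto simp: divide_le_eq)
    define N0 where "N0 = real D * \<eta>\<^sup>2"
    have lk: "0 \<le> ln (real k / \<delta>)" "0 \<le> ln (1/\<epsilon>)" using k \<delta> \<epsilon> by (auto simp: le_divide_eq)
    have gS: "1 \<le> g * S" using mult_mono[OF g(1) params(1)] g by simp
    have "(g * S)^3 \<le> N0"
      unfolding N0_def \<eta>_def e_def S_def by (rule dimension_bound[OF p \<epsilon>(1) _ lk D]) (use g in simp)
    then have N0: "1 \<le> N0" "g * S \<le> N0 powr (1/3)"
    proof -
      assume h: "(g * S)^3 \<le> N0"
      show "1 \<le> N0" using h one_le_power[OF gS, of 3] by linarith
      have "g * S = ((g * S)^3) powr (1/3)" using gS by (simp add: powr_powr flip: powr_numeral)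
      also have "\<dots> \<le> N0 powr (1/3)" using h gS by (intro powr_mono2) auto
      finally show "g * S \<le> N0 powr (1/3)" .
    qed
    define \<delta>' where "\<delta>' = B * exp (- c * N0 powr (1/3))"
    have \<delta>'0: "0 < \<delta>'" using B by (simp add: \<delta>'_def)
    define E where "E = exp (a * S)"
    have a0: "0 \<le> a" by (simp add: a_def)
    have E1: "1 \<le> E" using params(1) a0 by (simp add: E_def)
    \<comment> \<open>The place where the size of \<open>D\<close> is used up: the failure
      probability of a pair has to be below \<open>1 / (16 * E^8)\<close>.\<close>
    have "16 * E^8 * \<delta>' = (16 * B) * exp (8 * (a * S) - c * N0 powr (1/3))"
      by (simp add: E_def \<delta>'_def exp_diff exp_minus field_simps flip: exp_of_nat_mult)
    also have "16 * B \<le> exp (\<bar>ln (16 * B)\<bar> * S)"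
      using B params(1) mult_left_mono[OF params(1), of "\<bar>ln (16 * B)\<bar>"] by (intro le_exp_of_ln_le) auto
    also have "exp (\<bar>ln (16 * B)\<bar> * S) * exp (8 * (a * S) - c * N0 powr (1/3)) = exp ((8 * a + \<bar>ln (16 * B)\<bar>) * S - c * N0 powr (1/3))"
      by (simp add: algebra_simps flip: exp_add)
    also have "\<dots> \<le> 1"
    proof -
      have "(8 * a + \<bar>ln (16 * B)\<bar>) * S \<le> c * g * S" using g params(1) by (intro mult_right_mono) auto
      also have "\<dots> = c * (g * S)" by simp
      also have "\<dots> \<le> c * N0 powr (1/3)" using c N0 by (intro mult_left_mono) auto
      finally show ?thesis by simp
    qed
    finally have \<delta>'8: "16 * E^8 * \<delta>' \<le> 1" by (simp add: mult_right_mono)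
    define q where "q = k * \<delta>' + \<delta>' / \<theta>"
    have m0: "0 \<le> m" using A by (simp add: m_def)
    have budget: "(real k)\<^sup>2 * \<delta>' + q / \<theta>' + sqrt q * (m + 1) / \<theta>' \<le> \<delta>"
      by (rule failure_budget[OF E1 _ _ \<delta>(1) _ params(4) _ params(6) _ m0 _ \<delta>'0 \<delta>'8 q_def]) (use params in \<open>simp_all add: E_def\<close>)
    obtain z S' where S': "S' \<subseteq> P" "card S' \<le> k" and cS': "\<forall>x\<in>P. z x \<in> S'"
      and cost: "\<forall>\<sigma>. (\<forall>x\<in>P. \<sigma> x < k) \<longrightarrow> (\<Sum>x\<in>P. dist (\<phi> x) (\<phi> (z x)) powr p) \<le> 2 powr p * ccost p k P \<sigma> \<phi>"
      using center_selection[OF P p k, of \<phi>] by (elim exE conjE) (rule that)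
    define R where "R = (\<Sum>x\<in>P. dist (\<phi> x) (\<phi> (z x)) powr p)"
    have inj: "inj \<phi>" and est: "rff_pair_estimates pK \<phi> c B s A" using pair \<phi> by blast+
    have \<eta>1: "\<eta> \<le> 1" using \<eta> by simp
    note pair' = est[unfolded rff_pair_estimates_def, rule_format, of \<eta> D p,
        OF conjI[OF \<eta>(1) conjI[OF \<eta>1 conjI[OF N0(1)[unfolded N0_def] p]]], folded N0_def, folded \<delta>'_def m_def]
    have dv: "(\<lambda>W. dist (rff_map D W x) (rff_map D W y)) \<in> borel_measurable (rff_space pK D)" for x y
    proof -
      have "dist (rff_map D W x) (rff_map D W y) = sqrt ((\<Sum>j<D. 2 - 2 * cos (W j \<bullet> (x - y))) / D)" for W :: "nat \<Rightarrow> real^'d"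
        unfolding dist_rff_map[symmetric] by simp
      moreover have "(\<lambda>W. sqrt ((\<Sum>j<D. 2 - 2 * cos (W j \<bullet> (x - y))) / D)) \<in> borel_measurable (PiM {..<D} (\<lambda>_. borel))"
        by measurable
      ultimately show ?thesis by (simp add: measurable_cong_sets[OF sets_rff refl])
    qed
    have "\<exists>Ev\<in>sets (rff_space pK D). 1 - ((real k)\<^sup>2 * \<delta>' + q / \<theta>' + sqrt q * (m + 1) / \<theta>') \<le> N.prob Ev \<and>
       (\<forall>W\<in>Ev. \<exists>Z. outlier_set \<eta> \<phi> (rff_map D W) P S' z p (\<theta> * R) (\<theta>' * R) Z)"
    proof (rule N.random_map_good_event[OF P _ dv S' _ _ m0 _ _ params(4,6) \<delta>'0 R_def q_def])
      show "inj_on \<phi> P" using inj inj_on_subset by blast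
    qed (use cS' pair' in blast)+
    then obtain Ev where Ev: "Ev \<in> sets (rff_space pK D)" and pEv: "1 - ((real k)\<^sup>2 * \<delta>' + q / \<theta>' + sqrt q * (m + 1) / \<theta>') \<le> N.prob Ev"
      and good: "\<forall>W\<in>Ev. \<exists>Z. outlier_set \<eta> \<phi> (rff_map D W) P S' z p (\<theta> * R) (\<theta>' * R) Z"
      by (elim bexE conjE) (rule that)
    let ?T = "{W \<in> space (rff_space pK D). \<forall>\<sigma>. (\<forall>x\<in>P. \<sigma> x < k) \<longrightarrow>
          clust_cost (euclid_dist (2*D)) p (rff D W) P k \<sigma>
            \<in> {(1 - \<epsilon>) * clust_cost dist p \<phi> P k \<sigma> .. (1 + \<epsilon>) * clust_cost dist p \<phi> P k \<sigma>}}"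
    \<comment> \<open>Monotonicity of the measure needs this, since a non-measurable set has measure
      0 by convention.\<close>
    have T: "?T \<in> sets (rff_space pK D)"
    proof (rule all_clusterings_measurable[OF P])
      show "(\<lambda>W. clust_cost (euclid_dist (2*D)) p (rff D W) P k \<sigma>) \<in> borel_measurable (rff_space pK D)" for \<sigma>
        using clust_cost_rff_measurable[OF p] by (simp add: measurable_cong_sets[OF sets_rff refl])
      show "clust_cost (euclid_dist (2*D)) p (rff D W) P k \<sigma> = clust_cost (euclid_dist (2*D)) p (rff D W) P k \<sigma>' \<and>
        (1 - \<epsilon>) * clust_cost dist p \<phi> P k \<sigma> = (1 - \<epsilon>) * clust_cost dist p \<phi> P k \<sigma>' \<and>
        (1 + \<epsilon>) * clust_cost dist p \<phi> P k \<sigma> = (1 + \<epsilon>) * clust_cost dist p \<phi> P k \<sigma>'"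
        if "\<And>x. x \<in> P \<Longrightarrow> \<sigma> x = \<sigma>' x" for W \<sigma> \<sigma>'
        using clust_cost_cong[of P \<sigma> \<sigma>', OF that] by metis
    qed
    have R0: "0 \<le> R" unfolding R_def by (simp add: sum_nonneg)
    have "Ev \<subseteq> ?T"
    proof
      fix W assume W: "W \<in> Ev"
      obtain Z where Z: "outlier_set \<eta> \<phi> (rff_map D W) P S' z p (\<theta> * R) (\<theta>' * R) Z"
        using bspec[OF good W] ..
      have "clust_cost (euclid_dist (2*D)) p (rff D W) P k \<sigma>
            \<in> {(1 - \<epsilon>) * clust_cost dist p \<phi> P k \<sigma> .. (1 + \<epsilon>) * clust_cost dist p \<phi> P k \<sigma>}" if \<sigma>: "\<forall>x\<in>P. \<sigma> x < k" for \<sigma>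
      proof -
        define Co where "Co = ccost p k P \<sigma> \<phi>"
        \<comment> \<open>The only link between the fixed reference cost and an arbitrary partition;
          its factor \<open>2 powr p\<close> is compensated in \<open>\<kappa>\<close>,
          \<open>\<theta>\<close> and \<open>\<theta>'\<close>.\<close>
        have RC: "R \<le> 2 powr p * Co" using cost \<sigma> unfolding R_def Co_def by blast
        have RC': "e / 2 powr p * R \<le> e * Co"
          using mult_left_mono[OF RC, of "e / 2 powr p"] e by simp
        have e1: "4 * p * \<eta> + p * \<kappa> \<le> e"
        proof -
          have "p * \<kappa> = e / 2 * (1 / 2 powr p)" using p by (simp add: \<kappa>_def)
          also have "\<dots> \<le> e / 2 * 1" using e p2 by (intro mult_left_mono) auto
          finally show ?thesis using p by (simp add: \<eta>_def)
        qed
        have e2: "\<kappa> * R \<le> e * Co"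
        proof -
          have "\<kappa> = e / 2 powr p * (1 / (2 * p))" by (simp add: \<kappa>_def)
          also have "\<dots> \<le> e / 2 powr p * 1" using e p by (intro mult_left_mono) auto
          finally have "\<kappa> * R \<le> e / 2 powr p * R" using R0 by (intro mult_right_mono) auto
          then show ?thesis using RC' by linarith
        qed
        have "0 < p * (6/\<eta>/\<kappa>) powr (p+1)" using p \<eta> \<kappa> by simp
        then have "k * (p * (6/\<eta>/\<kappa>) powr (p+1) * (\<theta> * R)) = e / 2 powr p * R"
          unfolding \<theta>_def using k p \<eta> \<kappa> by simp
        then have e3: "k * (p * (6/\<eta>/\<kappa>) powr (p+1) * (\<theta> * R)) \<le> e * Co" using RC' by simp
        have "0 < 1 + 2*p/e" using p e by (simp add: add_pos_nonneg)
        then have "(1 + 2*p/e) powr p * (\<theta>' * R) = e / 2 powr p * R" unfolding \<theta>'_def by simp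
        then have e4: "(1 + 2*p/e) powr p * (\<theta>' * R) \<le> e * Co" using RC' by simp
        have \<theta>R: "0 \<le> \<theta> * R" using params(4) R0 by simp
        note close = ccost_close[OF P \<sigma> p \<eta> \<kappa> e \<theta>R cS'[rule_format] Z e1 e2[unfolded R_def Co_def] e3[unfolded Co_def] e4[unfolded Co_def]]
        have "clust_cost (euclid_dist (2*D)) p (rff D W) P k \<sigma> = ccost p k P \<sigma> (rff_map D W)"
          unfolding rff_map_def[abs_def] using p by (intro clust_cost_euclid_dist) simp
        then show ?thesis using close by (simp add: clust_cost_dist e_def)
      qed
      then show "W \<in> ?T" using W sets.sets_into_space[OF Ev] by blast
    qed
    then have "N.prob Ev \<le> N.prob ?T" by (rule N.finite_measure_mono[OF _ T])
    then show ?thesis using pEv budget by linarith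
  qed
  have C: "0 < 230400 * g^3" using g by simp
  show ?thesis
    by (intro exI[of _ "230400 * g^3"] conjI[OF C] allI impI, elim conjE, rule main; assumption)
qed

end
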